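(* Let $s>0$, let $P_1,\dots,P_n$ be zero-mean $s$-subgaussian distributions on $\mathbb{R}^d$, and let $Q=\mathcal{N}(0,I_d)$. Let $u=(u_1,\dots,u_N)$ and $v=(v_1,\dots,v_d)$ be variables. Fix an even $t\in\mathbb{N}$ and reals $a_1,\dots,a_{n'}$. Let $h_1,\dots,h_{n'}$ be polynomials in $u,v$ of degree at most $t$, and let $p_1,\dots,p_n$ be fixed polynomials in $u,v$ of degree less than $t-1$. Let $\mathcal{T}$ be any set of degree-$t$ pseudoexpectations over $u,v$ (fixed independently of the samples). Let $\mathcal{T}^*=\{\tilde{\mathbb{E}}\in\mathcal{T}:\tilde{\mathbb{E}}[h_j(u,v)]\neq0\ \forall j\in[n']\}$. For vectors $y_1,\dots,y_n\in\mathbb{R}^d$ define $$F(y_{1:n})=\sup_{\tilde{\mathbb{E}}\in\mathcal{T}^*}\frac{\tilde{\mathbb{E}}\left[\frac1n\sum_{i=1}^n p_i(u,v)\langle y_i,v\rangle\right]}{\prod_{j=1}^{n'}\left(\tilde{\mathbb{E}}[h_j(u,v)]\right)^{a_j}}.$$ Then $$\mathbb{E}_{Y_{1:n}\sim\prod_{i=1}^nP_i}\left[F(Y_{1:n})\right]\lesssim s\cdot\mathbb{E}_{G_{1:n}\sim Q^{\otimes n}}\left[F(G_{1:n})\right].$$ Moreover, letting $Z=F(Y_{1:n})$ with $Y_{1:n}\sim\prod_i P_i$ and $R=s\cdot\mathbb{E}_{G_{1:n}\sim Q^{\otimes n}}[F(G_{1:n})]$, for all $q\in\mathbb{N}$,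 $$\|Z\|_{L_q(Y_{1:n})}\lesssim R+s\sqrt{q}\cdot\sup_{\tilde{\mathbb{E}}\in\mathcal{T}^*}\frac{\left(\sum_{i=1}^n\sum_{j=1}^d\left(\tilde{\mathbb{E}}\left[\frac{p_i(u,v)v_j}{n}\right]\right)^2\right)^{1/2}}{\prod_{j=1}^{n'}\left|\tilde{\mathbb{E}}[h_j(u,v)]\right|^{a_j}}.$$
   Context: $Y_1,\dots,Y_n$ are independent with $Y_i\sim P_i$; $G_1,\dots,G_n$ are i.i.d. $\mathcal{N}(0,I_d)$; $Y_{1:n}$ denotes the concatenation. A distribution $P$ on $\mathbb{R}^d$ with mean $\mu$ is $s$-subgaussian if for all $v\in\mathbb{R}^d$ and all $m\ge1$, $(\mathbb{E}|\langle v,X-\mu\rangle|^m)^{1/m}\le C_0 s\sqrt m\|v\|_2$, where $C_0$ is the universal constant making $\mathcal{N}(0,I_d)$ $1$-subgaussian. A degree-$t$ pseudoexpectation over variables $x$ is a linear map $\tilde{\mathbb{E}}$ from real polynomials in $x$ of degree at most $t$ to $\mathbb{R}$ with $\tilde{\mathbb{E}}[1]=1$ and $\tilde{\mathbb{E}}[p(x)^2]\ge0$ for every polynomial $p$ of degree at most $t/2$. $\|Z\|_{L_q}=(\mathbb{E}|Z|^q)^{1/q}$. $a\lesssim b$ means $a\le Cb$ for an absolute constant $C$. The supremum over an empty set is taken to be $0$. *)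

theory Defs
  imports "HOL-Probability.Probability" "HOL-Library.Poly_Mapping"
begin

text \<open>Polynomials over the variables u_1..u_N (encoded as Inl k, k < N) and
 v_1..v_d (encoded as Inr j, j < d): finitely supported maps from monomials
 (finitely supported exponent vectors) to real coefficients.\<close>

type_synonym mpoly = "((nat + nat) \<Rightarrow>\<^sub>0 nat) \<Rightarrow>\<^sub>0 real"

definition mdeg :: "((nat + nat) \<Rightarrow>\<^sub>0 nat) \<Rightarrow> nat" where
  "mdeg m = (\<Sum>x\<in>Poly_Mapping.keys m. Poly_Mapping.lookup m x)"

definition pdeg :: "mpoly \<Rightarrow> nat" where
  "pdeg p = Max (insert 0 (mdeg ` Poly_Mapping.keys p))"

definition pvars :: "mpoly \<Rightarrow> (nat + nat) set" where
  "pvars p = \<Union> (Poly_Mapping.keys ` Poly_Mapping.keys p)"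

definition pconst :: "real \<Rightarrow> mpoly" where
  "pconst c = Poly_Mapping.single 0 c"

definition pvar :: "nat + nat \<Rightarrow> mpoly" where
  "pvar x = Poly_Mapping.single (Poly_Mapping.single x 1) 1"

definition uv_vars :: "nat \<Rightarrow> nat \<Rightarrow> (nat + nat) set" where
  "uv_vars N d = Inl ` {..<N} \<union> Inr ` {..<d}"

definition pseudoexp :: "(nat + nat) set \<Rightarrow> nat \<Rightarrow> (mpoly \<Rightarrow> real) \<Rightarrow> bool" where
  "pseudoexp V t E \<longleftrightarrow>
     (\<forall>p q. pvars p \<subseteq> V \<longrightarrow> pvars q \<subseteq> V \<longrightarrow> pdeg p \<le> t \<longrightarrow> pdeg q \<le> t \<longrightarrow>
        E (p + q) = E p + E q) \<and>
     (\<forall>c p. pvars p \<subseteq> V \<longrightarrow> pdeg p \<le> t \<longrightarrow> E (pconst c * p) = c * E p) \<and>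
     E 1 = 1 \<and>
     (\<forall>p. pvars p \<subseteq> V \<longrightarrow> pdeg p \<le> t div 2 \<longrightarrow> E (p * p) \<ge> 0)"

text \<open>Vectors in R^d are functions nat \<Rightarrow> real, of which only the coordinates
 j < d matter; distributions on R^d are probability measures with the Borel
 product sigma-algebra on {..<d}.\<close>

definition inner_d :: "nat \<Rightarrow> (nat \<Rightarrow> real) \<Rightarrow> (nat \<Rightarrow> real) \<Rightarrow> real" where
  "inner_d d x y = (\<Sum>j<d. x j * y j)"

definition norm_d :: "nat \<Rightarrow> (nat \<Rightarrow> real) \<Rightarrow> real" where
  "norm_d d x = sqrt (inner_d d x x)"

definition borel_d :: "nat \<Rightarrow> (nat \<Rightarrow> real) measure" where
  "borel_d d = PiM {..<d} (\<lambda>_. borel)"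

definition std_normal :: "real measure" where
  "std_normal = density lborel std_normal_density"

definition gauss_d :: "nat \<Rightarrow> (nat \<Rightarrow> real) measure" where
  "gauss_d d = PiM {..<d} (\<lambda>_. std_normal)"

definition mean_d :: "(nat \<Rightarrow> real) measure \<Rightarrow> nat \<Rightarrow> real" where
  "mean_d P = (\<lambda>j. \<integral>x. x j \<partial>P)"

text \<open>C_0: the smallest constant making N(0, I_d) 1-subgaussian
 (for unit v, <v,G> is N(0,1), so this does not depend on d).\<close>
definition C0 :: real where
  "C0 = (SUP m\<in>{1::nat..}. (\<integral>x. \<bar>x\<bar> ^ m \<partial>std_normal) powr (1 / real m) / sqrt (real m))"

definition subgaussian :: "nat \<Rightarrow> real \<Rightarrow> (nat \<Rightarrow> real) measure \<Rightarrow> bool" where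
  "subgaussian d s P \<longleftrightarrow>
     prob_space P \<and> sets P = sets (borel_d d) \<and>
     (\<forall>j<d. integrable P (\<lambda>x. x j)) \<and>
     (\<forall>v. \<forall>m::nat. m \<ge> 1 \<longrightarrow>
        integrable P (\<lambda>x. \<bar>inner_d d v (x - mean_d P)\<bar> ^ m) \<and>
        (\<integral>x. \<bar>inner_d d v (x - mean_d P)\<bar> ^ m \<partial>P) powr (1 / real m)
           \<le> C0 * s * sqrt (real m) * norm_d d v)"

definition zero_mean :: "nat \<Rightarrow> (nat \<Rightarrow> real) measure \<Rightarrow> bool" where
  "zero_mean d P \<longleftrightarrow> (\<forall>j<d. integrable P (\<lambda>x. x j) \<and> (\<integral>x. x j \<partial>P) = 0)"

text \<open>Real power x^a: for x > 0 the usual x powr a; for integer a the signed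
 power x^a; for x < 0 and non-integer a (undefined in the paper) we use the
 convention |x|^a.\<close>
definition gpow :: "real \<Rightarrow> real \<Rightarrow> real" where
  "gpow x a = (if x < 0 \<and> a \<in> \<int> then x powi \<lfloor>a\<rfloor> else \<bar>x\<bar> powr a)"

definition lin_v :: "nat \<Rightarrow> (nat \<Rightarrow> real) \<Rightarrow> mpoly" where
  "lin_v d y = (\<Sum>j<d. pconst (y j) * pvar (Inr j))"

definition Tstar :: "(mpoly \<Rightarrow> real) set \<Rightarrow> nat \<Rightarrow> (nat \<Rightarrow> mpoly) \<Rightarrow> (mpoly \<Rightarrow> real) set" where
  "Tstar T n' h = {E \<in> T. \<forall>j<n'. E (h j) \<noteq> 0}"

definition Ffun :: "nat \<Rightarrow> nat \<Rightarrow> (mpoly \<Rightarrow> real) set \<Rightarrow> nat \<Rightarrow> (nat \<Rightarrow> mpoly)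
     \<Rightarrow> (nat \<Rightarrow> real) \<Rightarrow> (nat \<Rightarrow> mpoly) \<Rightarrow> (nat \<Rightarrow> nat \<Rightarrow> real) \<Rightarrow> ereal" where
  "Ffun d n T n' h a p y =
     (if Tstar T n' h = {} then 0 else
      (SUP E\<in>Tstar T n' h.
         ereal (E (pconst (1 / real n) * (\<Sum>i<n. p i * lin_v d (y i)))
                / (\<Prod>j<n'. gpow (E (h j)) (a j)))))"

text \<open>The second supremum in the moment bound (empty supremum = 0).\<close>
definition Sfun :: "nat \<Rightarrow> nat \<Rightarrow> (mpoly \<Rightarrow> real) set \<Rightarrow> nat \<Rightarrow> (nat \<Rightarrow> mpoly)
     \<Rightarrow> (nat \<Rightarrow> real) \<Rightarrow> (nat \<Rightarrow> mpoly) \<Rightarrow> ennreal" where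
  "Sfun d n T n' h a p =
     (SUP E\<in>Tstar T n' h.
        ennreal (sqrt (\<Sum>i<n. \<Sum>j<d. (E (pconst (1 / real n) * p i * pvar (Inr j)))\<^sup>2)
                 / (\<Prod>j<n'. \<bar>E (h j)\<bar> powr (a j))))"

text \<open>Expectation of an extended-real random variable: positive part minus
 negative part (well defined whenever one of them is finite).\<close>
definition eexpect :: "'a measure \<Rightarrow> ('a \<Rightarrow> ereal) \<Rightarrow> ereal" where
  "eexpect M f = enn2ereal (\<integral>\<^sup>+x. e2ennreal (f x) \<partial>M) - enn2ereal (\<integral>\<^sup>+x. e2ennreal (- f x) \<partial>M)"

definition emoment :: "'a measure \<Rightarrow> ('a \<Rightarrow> ereal) \<Rightarrow> nat \<Rightarrow> ennreal" where
  "emoment M f q = (\<integral>\<^sup>+x. e2ennreal \<bar>f x\<bar> ^ q \<partial>M)"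

end

theory Submission
  imports Defs
begin

text \<open>For each pseudoexpectation the objective is a linear functional \<open>\<langle>a, y\<rangle>\<close> of the samples, so \<open>F\<close> is the
 supremum of a process indexed by a set of vectors and the theorem is Talagrand's subgaussian
 comparison theorem together with its moment version. The lower bound for the Gaussian side
 rests on a growth condition: if clusters of radius \<open>\<rho>/8\<close> sit around \<open>2\<^sup>k\<close> points at mutual
 distance at least \<open>\<rho>\<close>, the Gaussian width of their union exceeds the smallest width of a cluster by
 \<open>c \<rho> \<surd>k\<close>. It follows in one stroke from the Sudakov-Fernique inequality. Greedy partitioning
 turns it into a tree along which the chaining costs telescope to a multiple of the width, and
 subgaussian increments are summed along the same tree by the union bound.\<close>

section \<open>Gaussian integration by parts\<close>

text \<open>Pseudoexpectations enter only through linearity: dividing by the product of powers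
  rescales a vector, so the index set is arbitrary, possibly uncountable and with infinite supremum.
  Hence the supremum is reduced to increasing finite maxima, and its value at one fixed index is
  split off. That value is centred under both laws; the rest is nonnegative, so the comparison runs
  in \<open>ennreal\<close> even when expectations are infinite.

  The usual proof of the growth condition combines Sudakov minoration with Gaussian concentration. A
  comparison process with independent sign terms yields both at once, which leaves integration by
  parts as the main analytic input.

  In the chaining, one random variable of mean at most 1 carries all exceptional events. Adding q to
  the logarithmic cost of every edge makes its logarithm enter with a factor 1/sqrt q, so q-th
  moments follow from one pointwise bound. For the expectation the radius of the index set is
  absorbed into the Gaussian width; for moments it is at most twice the second supremum.\<close>

lemma prob_space_std_normal: "prob_space std_normal"
  unfolding std_normal_def by (rule prob_space_normal_density) simp

lemma sets_std_normal [simp, measurable_cong]: "sets std_normal = sets borel"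
  by (simp add: std_normal_def)

lemma space_std_normal [simp]: "space std_normal = UNIV"
  by (simp add: std_normal_def)

lemma integral_std_normal:
  fixes f :: "real \<Rightarrow> real"
  assumes "f \<in> borel_measurable borel"
  shows "(\<integral>x. f x \<partial>std_normal) = (\<integral>x. std_normal_density x * f x \<partial>lborel)"
  unfolding std_normal_def using assms by (subst integral_density) auto

lemma integrable_std_normal_iff:
  fixes f :: "real \<Rightarrow> real"
  assumes "f \<in> borel_measurable borel"
  shows "integrable std_normal f \<longleftrightarrow> integrable lborel (\<lambda>x. std_normal_density x * f x)"
  unfolding std_normal_def using assms by (subst integrable_density) auto

lemma integrable_std_normal_id: "integrable std_normal (\<lambda>x. x)"
  using integrable_std_normal_moment[of 1] by (subst integrable_std_normal_iff) auto

lemma integral_std_normal_id: "(\<integral>x. x \<partial>std_normal) = 0"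
  using integral_std_normal_moment_odd[of 0] by (subst integral_std_normal) auto

lemma integral_std_normal_abs_pos: "0 < (\<integral>x. \<bar>x\<bar> \<partial>std_normal)"
  using integral_std_normal_moment_abs_odd[of 0] by (subst integral_std_normal) auto

lemma std_normal_density_deriv:
  "(std_normal_density has_real_derivative - x * std_normal_density x) (at x)"
  unfolding std_normal_density_def[abs_def]
  by (rule derivative_eq_intros refl | simp)+

lemma std_normal_density_tendsto:
  "(std_normal_density \<longlongrightarrow> 0) at_top" "(std_normal_density \<longlongrightarrow> 0) at_bot"
proof -
  have top: "filterlim (\<lambda>x::real. x\<^sup>2 / 2) at_top at_top"
    using filterlim_tendsto_pos_mult_at_top[OF tendsto_const[of "1/2"] _ filterlim_pow_at_top[OF _ filterlim_ident, of 2]]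
    by simp
  have "((\<lambda>x. (1 / sqrt (2 * pi)) * exp (- (x\<^sup>2 / 2))) \<longlongrightarrow> (1 / sqrt (2 * pi)) * 0) at_top"
    using top by (intro tendsto_mult_left filterlim_compose[OF exp_at_bot]) (simp add: filterlim_uminus_at_bot)
  then show 1: "(std_normal_density \<longlongrightarrow> 0) at_top"
    by (simp add: std_normal_density_def[abs_def])
  have "(\<lambda>x. std_normal_density (- x)) = std_normal_density"
    by (simp add: std_normal_density_def fun_eq_iff)
  then show "(std_normal_density \<longlongrightarrow> 0) at_bot"
    using 1 by (simp add: filterlim_at_bot_mirror)
qed

text \<open>The difference of the two integrands, weighted by the density, is the derivative of
  \<open>f\<close> times the density. Boundedness of \<open>f\<close> makes that product vanish at
  both ends, so its derivative integrates to zero over the line.\<close>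

lemma std_normal_stein:
  fixes f f' :: "real \<Rightarrow> real"
  assumes d: "\<And>x. (f has_real_derivative f' x) (at x)" and c: "\<And>x. isCont f' x"
    and b: "\<And>x. \<bar>f x\<bar> \<le> B" and b': "\<And>x. \<bar>f' x\<bar> \<le> B'"
  shows "(\<integral>x. x * f x \<partial>std_normal) = (\<integral>x. f' x \<partial>std_normal)"
proof -
  have cf: "isCont f x" for x using d DERIV_isCont by blast
  have [measurable]: "f \<in> borel_measurable borel" "f' \<in> borel_measurable borel"
    by (auto intro!: borel_measurable_continuous_onI continuous_at_imp_continuous_on cf c)
  have i1: "integrable lborel (\<lambda>x. std_normal_density x * f' x)"
    by (rule Bochner_Integration.integrable_bound[OF integrable_mult_right[OF integrable_normal_density[of 1 0], of B']])
       (use order_trans[OF b' abs_ge_self] in \<open>auto simp: abs_mult mult.commute[of _ "std_normal_density _"] intro!: AE_I2 mult_left_mono\<close>)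
  have i2: "integrable lborel (\<lambda>x. std_normal_density x * (x * f x))"
  proof (rule Bochner_Integration.integrable_bound[OF integrable_mult_right[OF integrable_std_normal_moment_abs[of 1], of B]])
    show "AE x in lborel. norm (std_normal_density x * (x * f x)) \<le> norm (B * (std_normal_density x * \<bar>x\<bar> ^ 1))"
    proof (rule AE_I2)
      fix x
      have "std_normal_density x * \<bar>x\<bar> * \<bar>f x\<bar> \<le> std_normal_density x * \<bar>x\<bar> * \<bar>B\<bar>"
        using b[of x] by (intro mult_left_mono) auto
      then show "norm (std_normal_density x * (x * f x)) \<le> norm (B * (std_normal_density x * \<bar>x\<bar> ^ 1))"
        by (simp add: abs_mult mult_ac)
    qed
  qed simp
  define g where "g = (\<lambda>x. std_normal_density x * f' x - std_normal_density x * (x * f x))"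
  have ig: "integrable lborel g" unfolding g_def using i1 i2 by simp
  have D: "((\<lambda>x. f x * std_normal_density x) has_vector_derivative g x) (at x)" for x
    unfolding has_real_derivative_iff_has_vector_derivative[symmetric] g_def
    by (rule derivative_eq_intros d std_normal_density_deriv refl | simp add: algebra_simps)+
  have cd: "isCont std_normal_density x" for x using std_normal_density_deriv DERIV_isCont by blast
  have lim: "((\<lambda>x. f x * std_normal_density x) \<longlongrightarrow> 0) F" if "(std_normal_density \<longlongrightarrow> 0) F" for F
  proof (rule Lim_null_comparison)
    show "\<forall>\<^sub>F x in F. norm (f x * std_normal_density x) \<le> B * std_normal_density x"
      by (intro always_eventually allI) (use b in \<open>auto simp: abs_mult intro!: mult_right_mono\<close>)
    show "((\<lambda>x. B * std_normal_density x) \<longlongrightarrow> 0) F"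
      using tendsto_mult_left[OF that, of B] by simp
  qed
  have "(LBINT x=-\<infinity>..\<infinity>. g x) = 0 - 0"
  proof (rule interval_integral_FTC_integrable[OF _ D])
    show "isCont g x" for x unfolding g_def by (intro continuous_intros cd c cf)
    show "set_integrable lborel (einterval (-\<infinity>) \<infinity>) g"
      using ig by (simp add: set_integrable_def)
    show "(((\<lambda>x. f x * std_normal_density x) \<circ> real_of_ereal) \<longlongrightarrow> 0) (at_right (-\<infinity>))"
      by (simp add: at_right_MInf filterlim_filtermap comp_def lim std_normal_density_tendsto)
    show "(((\<lambda>x. f x * std_normal_density x) \<circ> real_of_ereal) \<longlongrightarrow> 0) (at_left \<infinity>)"
      by (simp add: at_left_PInf filterlim_filtermap comp_def lim std_normal_density_tendsto)
  qed simp
  then have "(\<integral>x. g x \<partial>lborel) = 0"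
    by (simp add: interval_lebesgue_integral_def set_lebesgue_integral_def)
  then show ?thesis
    unfolding g_def using i1 i2 by (simp add: integral_std_normal)
qed

abbreviation gauss :: "'k set \<Rightarrow> ('k \<Rightarrow> real) measure" where
  "gauss J \<equiv> PiM J (\<lambda>_. std_normal)"

interpretation std_normal: prob_space std_normal by (rule prob_space_std_normal)
interpretation std_normal_prod: product_prob_space "\<lambda>_. std_normal" I for I :: "'i set" ..

lemma prob_space_gauss: "prob_space (gauss J)"
  by (rule prob_space_PiM) (rule prob_space_std_normal)

lemma integrable_gauss_component:
  assumes "k \<in> J" shows "integrable (gauss J) (\<lambda>w. w k)"
proof -
  have "distr (gauss J) std_normal (\<lambda>w. w k) = std_normal"
    by (rule std_normal_prod.PiM_component[OF assms])
  then have "integrable (distr (gauss J) std_normal (\<lambda>w. w k)) (\<lambda>x. x)"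
    using integrable_std_normal_id by simp
  then show ?thesis by (subst (asm) integrable_distr_eq) (use assms in auto)
qed

lemma integral_gauss_component:
  fixes f :: "real \<Rightarrow> real"
  assumes "k \<in> J" and [measurable]: "f \<in> borel_measurable borel"
  shows "(\<integral>w. f (w k) \<partial>gauss J) = (\<integral>x. f x \<partial>std_normal)"
proof -
  have "(\<integral>x. f x \<partial>std_normal) = (\<integral>x. f x \<partial>distr (gauss J) std_normal (\<lambda>w. w k))"
    by (simp add: std_normal_prod.PiM_component[OF assms(1)])
  then show ?thesis by (subst (asm) integral_distr) (use assms in auto)
qed

text \<open>Fubini isolates coordinate \<open>k\<close>, and Stein's identity is applied with the
  other coordinates frozen. The derivative hypothesis is phrased through \<open>w(k:=y)\<close>, the
  form in which the product integral over \<open>insert k I\<close> presents the integrand.\<close>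

lemma gauss_integration_by_parts:
  fixes F F' :: "('k \<Rightarrow> real) \<Rightarrow> real"
  assumes J: "finite J" "k \<in> J"
    and [measurable]: "F \<in> borel_measurable (gauss J)" "F' \<in> borel_measurable (gauss J)"
    and d: "\<And>w x. ((\<lambda>y. F (w(k:=y))) has_real_derivative F' (w(k:=x))) (at x)"
    and c: "\<And>w x. isCont (\<lambda>y. F' (w(k:=y))) x"
    and b: "\<And>w. \<bar>F w\<bar> \<le> B" and b': "\<And>w. \<bar>F' w\<bar> \<le> B'"
  shows "(\<integral>w. w k * F w \<partial>gauss J) = (\<integral>w. F' w \<partial>gauss J)" "integrable (gauss J) (\<lambda>w. w k * F w)"
    "integrable (gauss J) F'"
proof -
  show i1: "integrable (gauss J) (\<lambda>w. w k * F w)"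
  proof (rule Bochner_Integration.integrable_bound[OF integrable_mult_right[OF integrable_gauss_component[OF J(2)], of B]])
    show "AE w in gauss J. norm (w k * F w) \<le> norm (B * w k)"
    proof (rule AE_I2)
      fix w :: "'k \<Rightarrow> real"
      have "\<bar>w k\<bar> * \<bar>F w\<bar> \<le> \<bar>w k\<bar> * \<bar>B\<bar>" by (intro mult_left_mono order_trans[OF b]) auto
      then show "norm (w k * F w) \<le> norm (B * w k)" by (simp add: abs_mult mult_ac)
    qed
  qed (use J in measurable)
  show i2: "integrable (gauss J) F'"
    by (rule finite_measure.integrable_const_bound[of _ _ B']) (use b' prob_space.finite_measure[OF prob_space_gauss] in auto)
  define I where "I = J - {k}"
  have I: "finite I" "k \<notin> I" "J = insert k I" using J by (auto simp: I_def)
  have "(\<integral>w. w k * F w \<partial>gauss (insert k I)) = (\<integral>w. (\<integral>y. y * F (w(k:=y)) \<partial>std_normal) \<partial>gauss I)"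
    by (subst std_normal_prod.product_integral_insert) (use I i1 in auto)
  also have "\<dots> = (\<integral>w. (\<integral>y. F' (w(k:=y)) \<partial>std_normal) \<partial>gauss I)"
    by (intro Bochner_Integration.integral_cong refl std_normal_stein[OF d c b b'])
  also have "\<dots> = (\<integral>w. F' w \<partial>gauss (insert k I))"
    by (subst std_normal_prod.product_integral_insert) (use I i2 in auto)
  finally show "(\<integral>w. w k * F w \<partial>gauss J) = (\<integral>w. F' w \<partial>gauss J)" by (simp add: I(3))
qed

text \<open>The mean value inequality bounds every difference quotient by \<open>g w\<close>, so
  dominated convergence applies along each sequence tending to \<open>t\<close>.\<close>

lemma DERIV_integral_dominated:
  fixes f f' :: "real \<Rightarrow> 'a \<Rightarrow> real"
  assumes i: "\<And>t. integrable M (f t)" and m[measurable]: "\<And>t. f' t \<in> borel_measurable M"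
    and d: "\<And>t w. ((\<lambda>t. f t w) has_real_derivative f' t w) (at t)"
    and b: "\<And>t w. \<bar>f' t w\<bar> \<le> g w" and g: "integrable M g"
  shows "((\<lambda>t. \<integral>w. f t w \<partial>M) has_real_derivative (\<integral>w. f' t w \<partial>M)) (at t)"
  unfolding has_field_derivative_iff tendsto_at_iff_sequentially comp_def
proof (intro allI impI)
  fix X :: "nat \<Rightarrow> real" assume X: "\<forall>i. X i \<in> UNIV - {t}" "X \<longlonglongrightarrow> t"
  have [measurable]: "f t \<in> borel_measurable M" for t using i by auto
  have "(\<lambda>i. \<integral>w. (f (X i) w - f t w) / (X i - t) \<partial>M) \<longlonglongrightarrow> (\<integral>w. f' t w \<partial>M)"
  proof (rule integral_dominated_convergence[where w=g])
    show "AE w in M. (\<lambda>i. (f (X i) w - f t w) / (X i - t)) \<longlonglongrightarrow> f' t w"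
    proof (rule AE_I2)
      fix w
      have "((\<lambda>y. (f y w - f t w) / (y - t)) \<longlongrightarrow> f' t w) (at t)"
        using d[of w t] by (simp add: has_field_derivative_iff)
      then show "(\<lambda>i. (f (X i) w - f t w) / (X i - t)) \<longlonglongrightarrow> f' t w"
        using X unfolding tendsto_at_iff_sequentially comp_def by blast
    qed
    show "AE w in M. norm ((f (X i) w - f t w) / (X i - t)) \<le> g w" for i
    proof (rule AE_I2)
      fix w
      have "norm (f (X i) w - f t w) \<le> g w * norm (X i - t)"
        by (rule field_differentiable_bound[of UNIV "\<lambda>t. f t w" "\<lambda>t. f' t w"])
           (use d b in \<open>auto intro: has_field_derivative_at_within\<close>)
      then show "norm ((f (X i) w - f t w) / (X i - t)) \<le> g w"
        using X(1) by (simp add: divide_simps)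
    qed
  qed (use g in auto)
  then show "(\<lambda>i. ((\<integral>w. f (X i) w \<partial>M) - (\<integral>w. f t w \<partial>M)) / (X i - t)) \<longlonglongrightarrow> (\<integral>w. f' t w \<partial>M)"
    using i by simp
qed

section \<open>The Sudakov-Fernique inequality\<close>

definition lin :: "'k set \<Rightarrow> ('k \<Rightarrow> real) \<Rightarrow> ('k \<Rightarrow> real) \<Rightarrow> real" where
  "lin J x w = (\<Sum>k\<in>J. x k * w k)"

lemma measurable_lin [measurable]: "finite J \<Longrightarrow> lin J x \<in> borel_measurable (gauss J)"
  unfolding lin_def[abs_def] by measurable

lemma integrable_lin: "finite J \<Longrightarrow> integrable (gauss J) (lin J x)"
  unfolding lin_def[abs_def] by (auto intro!: integrable_gauss_component)

lemma integral_lin: "finite J \<Longrightarrow> (\<integral>w. lin J x w \<partial>gauss J) = 0"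
  unfolding lin_def[abs_def]
  by (subst Bochner_Integration.integral_sum)
     (auto intro!: integrable_gauss_component sum.neutral simp: integral_gauss_component[where f="\<lambda>x. x"] integral_std_normal_id)

section \<open>Smoothing the maximum by log-sum-exp\<close>

lemma Max_image_attained:
  assumes "finite I" "I \<noteq> {}" obtains i where "i \<in> I" "Max (f ` I) = f i"
proof -
  have "Max (f ` I) \<in> f ` I" using assms by (intro Max_in) auto
  then show ?thesis using that by (elim imageE)
qed

text \<open>A smooth substitute for \<beta> times the maximum, too large by at most
  \<open>ln (card I)\<close>. Its gradient is \<beta> times the mean of the vectors
  \<open>z i\<close> under the Gibbs weights \<open>smax\<close>.\<close>

definition lse :: "'k set \<Rightarrow> 'i set \<Rightarrow> real \<Rightarrow> ('i \<Rightarrow> 'k \<Rightarrow> real) \<Rightarrow> ('k \<Rightarrow> real) \<Rightarrow> real" where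
  "lse J I \<beta> z w = ln (\<Sum>i\<in>I. exp (\<beta> * lin J (z i) w))"

definition smax :: "'k set \<Rightarrow> 'i set \<Rightarrow> real \<Rightarrow> ('i \<Rightarrow> 'k \<Rightarrow> real) \<Rightarrow> 'i \<Rightarrow> ('k \<Rightarrow> real) \<Rightarrow> real" where
  "smax J I \<beta> z i w = exp (\<beta> * lin J (z i) w) / (\<Sum>j\<in>I. exp (\<beta> * lin J (z j) w))"

context
  fixes J :: "'k set" and I :: "'i set" and \<beta> :: real
  assumes J: "finite J" and I: "finite I" "I \<noteq> {}" and \<beta>: "\<beta> > 0"
begin

lemma sum_exp_lin_pos: "0 < (\<Sum>i\<in>I. exp (\<beta> * lin J (z i) w))"
  using I by (intro sum_pos) auto

lemma smax_nonneg: "0 \<le> smax J I \<beta> z i w"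
  unfolding smax_def by (auto intro!: divide_nonneg_nonneg sum_nonneg)

lemma sum_smax: "(\<Sum>i\<in>I. smax J I \<beta> z i w) = 1"
  unfolding smax_def sum_divide_distrib[symmetric] using sum_exp_lin_pos[of z w] by simp

lemma smax_le_1: "i \<in> I \<Longrightarrow> smax J I \<beta> z i w \<le> 1"
  using member_le_sum[of i I "\<lambda>i. smax J I \<beta> z i w"] I by (simp add: sum_smax smax_nonneg)

lemma measurable_smax [measurable]: "smax J I \<beta> z i \<in> borel_measurable (gauss J)"
  unfolding smax_def[abs_def] using J by measurable

lemma measurable_lse [measurable]: "lse J I \<beta> z \<in> borel_measurable (gauss J)"
  unfolding lse_def[abs_def] using J by measurable

lemma lse_ge_Max: "\<beta> * Max ((\<lambda>i. lin J (z i) w) ` I) \<le> lse J I \<beta> z w"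
proof -
  obtain i where i: "i \<in> I" "Max ((\<lambda>i. lin J (z i) w) ` I) = lin J (z i) w"
    using Max_image_attained[OF I] by metis
  have "exp (\<beta> * lin J (z i) w) \<le> (\<Sum>i\<in>I. exp (\<beta> * lin J (z i) w))"
    using I i by (intro member_le_sum) auto
  then show ?thesis unfolding lse_def i(2) using sum_exp_lin_pos[of z w] by (simp add: ln_ge_iff)
qed

lemma lse_le_Max: "lse J I \<beta> z w \<le> \<beta> * Max ((\<lambda>i. lin J (z i) w) ` I) + ln (card I)"
proof -
  let ?m = "Max ((\<lambda>i. lin J (z i) w) ` I)"
  have "(\<Sum>i\<in>I. exp (\<beta> * lin J (z i) w)) \<le> (\<Sum>i\<in>I. exp (\<beta> * ?m))"
    using I \<beta> by (intro sum_mono) auto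
  then have "ln (\<Sum>i\<in>I. exp (\<beta> * lin J (z i) w)) \<le> ln (card I * exp (\<beta> * ?m))"
    using sum_exp_lin_pos[of z w] by (subst ln_le_cancel_iff) (auto simp: I card_gt_0_iff)
  also have "\<dots> = \<beta> * ?m + ln (card I)" using I by (subst ln_mult) (auto simp: card_gt_0_iff)
  finally show ?thesis by (simp add: lse_def)
qed

lemma integrable_Max_lin: "integrable (gauss J) (\<lambda>w. Max ((\<lambda>i. lin J (z i) w) ` I))"
proof (rule Bochner_Integration.integrable_bound[where f="\<lambda>w. \<Sum>i\<in>I. \<bar>lin J (z i) w\<bar>"])
  show "AE w in gauss J. norm (Max ((\<lambda>i. lin J (z i) w) ` I)) \<le> norm (\<Sum>i\<in>I. \<bar>lin J (z i) w\<bar>)"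
  proof (rule AE_I2)
    fix w :: "'k \<Rightarrow> real"
    obtain i where i: "i \<in> I" "Max ((\<lambda>i. lin J (z i) w) ` I) = lin J (z i) w"
      using Max_image_attained[OF I] by metis
    have "\<bar>lin J (z i) w\<bar> \<le> (\<Sum>i\<in>I. \<bar>lin J (z i) w\<bar>)" using I i by (intro member_le_sum) auto
    then show "norm (Max ((\<lambda>i. lin J (z i) w) ` I)) \<le> norm (\<Sum>i\<in>I. \<bar>lin J (z i) w\<bar>)"
      unfolding i(2) by (simp add: sum_nonneg)
  qed
  show "integrable (gauss J) (\<lambda>w. \<Sum>i\<in>I. \<bar>lin J (z i) w\<bar>)"
    by (intro Bochner_Integration.integrable_sum integrable_abs integrable_lin J)
  show "(\<lambda>w. Max ((\<lambda>i. lin J (z i) w) ` I)) \<in> borel_measurable (gauss J)"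
    by (rule borel_measurable_Max[OF I(1) measurable_lin[OF J]])
qed

lemma integrable_lse: "integrable (gauss J) (lse J I \<beta> z)"
proof (rule Bochner_Integration.integrable_bound[where f="\<lambda>w. \<beta> * \<bar>Max ((\<lambda>i. lin J (z i) w) ` I)\<bar> + \<bar>ln (card I)\<bar>"])
  show "AE w in gauss J. norm (lse J I \<beta> z w) \<le> norm (\<beta> * \<bar>Max ((\<lambda>i. lin J (z i) w) ` I)\<bar> + \<bar>ln (card I)\<bar>)"
  proof (rule AE_I2)
    fix w
    let ?m = "Max ((\<lambda>i. lin J (z i) w) ` I)"
    have "\<bar>lse J I \<beta> z w\<bar> \<le> \<bar>\<beta> * ?m\<bar> + \<bar>ln (card I)\<bar>"
      using lse_ge_Max[of z w] lse_le_Max[of z w] by linarith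
    then show "norm (lse J I \<beta> z w) \<le> norm (\<beta> * \<bar>?m\<bar> + \<bar>ln (card I)\<bar>)"
      using \<beta> by (simp add: abs_mult)
  qed
  show "integrable (gauss J) (\<lambda>w. \<beta> * \<bar>Max ((\<lambda>i. lin J (z i) w) ` I)\<bar> + \<bar>ln (card I)\<bar>)"
    by (intro Bochner_Integration.integrable_add integrable_mult_right integrable_abs integrable_Max_lin
         finite_measure.integrable_const prob_space.finite_measure prob_space_gauss)
qed measurable

lemma lin_upd: "k \<in> J \<Longrightarrow> lin J x (w(k:=y)) = x k * y + lin (J - {k}) x w"
  unfolding lin_def using J by (subst sum.remove[of _ k]) (auto intro!: sum.cong)

text \<open>Differentiating a Gibbs weight in \<open>w k\<close> gives \<beta> times the weight
  times the deviation of \<open>z i k\<close> from its mean under the weights. The weights form a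
  probability vector, so weight and derivative are bounded uniformly in \<open>w\<close>, as
  integration by parts requires.\<close>

lemma smax_integration_by_parts:
  fixes z :: "'i \<Rightarrow> 'k \<Rightarrow> real"
  assumes "k \<in> J" "i \<in> I"
  defines "D \<equiv> \<lambda>w. \<beta> * (smax J I \<beta> z i w * (z i k - (\<Sum>j\<in>I. smax J I \<beta> z j w * z j k)))"
  shows "(\<integral>w. w k * smax J I \<beta> z i w \<partial>gauss J) = (\<integral>w. D w \<partial>gauss J)"
    "integrable (gauss J) (\<lambda>w. w k * smax J I \<beta> z i w)" "integrable (gauss J) D"
proof -
  have [measurable]: "D \<in> borel_measurable (gauss J)" unfolding D_def using J by measurable
  have ds: "((\<lambda>y. smax J I \<beta> z j (w(k:=y))) has_real_derivative
      \<beta> * (smax J I \<beta> z j (w(k:=x)) * (z j k - (\<Sum>l\<in>I. smax J I \<beta> z l (w(k:=x)) * z l k)))) (at x)" for w x j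
  proof -
    let ?e = "\<lambda>j y. exp (\<beta> * (z j k * y + lin (J - {k}) (z j) w))"
    have pos: "0 < (\<Sum>l\<in>I. ?e l y)" for y using I by (intro sum_pos) auto
    have "((\<lambda>y. ?e j y / (\<Sum>l\<in>I. ?e l y)) has_real_derivative
      ((?e j x * (\<beta> * z j k)) * (\<Sum>l\<in>I. ?e l x) - ?e j x * (\<Sum>l\<in>I. ?e l x * (\<beta> * z l k))) /
        ((\<Sum>l\<in>I. ?e l x) * (\<Sum>l\<in>I. ?e l x))) (at x)"
      using less_imp_neq[OF pos[of x]] by (auto intro!: derivative_eq_intros simp: mult_ac)
    also have "((?e j x * (\<beta> * z j k)) * (\<Sum>l\<in>I. ?e l x) - ?e j x * (\<Sum>l\<in>I. ?e l x * (\<beta> * z l k))) /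
        ((\<Sum>l\<in>I. ?e l x) * (\<Sum>l\<in>I. ?e l x))
        = \<beta> * (?e j x / (\<Sum>l\<in>I. ?e l x) * (z j k - (\<Sum>l\<in>I. ?e l x / (\<Sum>l\<in>I. ?e l x) * z l k)))"
    proof -
      have "(\<Sum>l\<in>I. ?e l x * (\<beta> * z l k)) = \<beta> * (\<Sum>l\<in>I. ?e l x * z l k)"
        by (simp add: sum_distrib_left mult_ac)
      moreover have "(\<Sum>l\<in>I. ?e l x / (\<Sum>l\<in>I. ?e l x) * z l k) = (\<Sum>l\<in>I. ?e l x * z l k) / (\<Sum>l\<in>I. ?e l x)"
        by (simp add: sum_divide_distrib)
      ultimately show ?thesis using less_imp_neq[OF pos[of x]] by (simp add: field_simps)
    qed
    finally show ?thesis unfolding smax_def lin_upd[OF assms(1)] .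
  qed
  have d: "((\<lambda>y. smax J I \<beta> z i (w(k:=y))) has_real_derivative D (w(k:=x))) (at x)" for w x
    unfolding D_def by (rule ds)
  have c: "isCont (\<lambda>y. D (w(k:=y))) x" for w x
    unfolding D_def by (intro continuous_intros DERIV_isCont[OF ds])
  have b: "\<bar>smax J I \<beta> z i w\<bar> \<le> 1" for w using smax_le_1[OF assms(2)] smax_nonneg by simp
  have b': "\<bar>D w\<bar> \<le> \<beta> * (\<bar>z i k\<bar> + (\<Sum>j\<in>I. \<bar>z j k\<bar>))" for w
  proof -
    have "\<bar>\<Sum>j\<in>I. smax J I \<beta> z j w * z j k\<bar> \<le> (\<Sum>j\<in>I. \<bar>z j k\<bar>)"
      by (intro order_trans[OF sum_abs] sum_mono)
         (auto simp: abs_mult smax_nonneg smax_le_1 intro!: mult_left_le_one_le)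
    then have "\<bar>z i k - (\<Sum>j\<in>I. smax J I \<beta> z j w * z j k)\<bar> \<le> \<bar>z i k\<bar> + (\<Sum>j\<in>I. \<bar>z j k\<bar>)" by linarith
    moreover have "smax J I \<beta> z i w * \<bar>z i k - (\<Sum>j\<in>I. smax J I \<beta> z j w * z j k)\<bar> \<le> \<bar>z i k - (\<Sum>j\<in>I. smax J I \<beta> z j w * z j k)\<bar>"
      using smax_le_1[OF assms(2)] smax_nonneg by (intro mult_left_le_one_le) auto
    ultimately show ?thesis unfolding D_def using \<beta> by (simp add: abs_mult smax_nonneg)
  qed
  note * = gauss_integration_by_parts[OF J assms(1) _ _ d c b b']
  show "(\<integral>w. w k * smax J I \<beta> z i w \<partial>gauss J) = (\<integral>w. D w \<partial>gauss J)"
    "integrable (gauss J) (\<lambda>w. w k * smax J I \<beta> z i w)" "integrable (gauss J) D"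
    by (rule *; measurable)+
qed

text \<open>Weights at most 1 and the uniform bound \<open>B\<close> on the velocity of the path
  give a dominating function linear in the \<open>\<bar>w k\<bar>\<close>.\<close>

lemma DERIV_integral_lse:
  assumes d: "\<And>i k t. ((\<lambda>t. z t i k) has_real_derivative z' t i k) (at t)"
    and b: "\<And>i k t. i \<in> I \<Longrightarrow> k \<in> J \<Longrightarrow> \<bar>z' t i k\<bar> \<le> B"
  shows "((\<lambda>t. \<integral>w. lse J I \<beta> (z t) w \<partial>gauss J) has_real_derivative
     (\<integral>w. (\<Sum>i\<in>I. \<Sum>k\<in>J. \<beta> * z' t i k * (w k * smax J I \<beta> (z t) i w)) \<partial>gauss J)) (at t)"
proof (rule DERIV_integral_dominated[where g="\<lambda>w. \<Sum>i\<in>I. \<Sum>k\<in>J. \<beta> * (B * \<bar>w k\<bar>)"])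
  show "integrable (gauss J) (lse J I \<beta> (z t))" for t by (rule integrable_lse)
  show "(\<lambda>w. \<Sum>i\<in>I. \<Sum>k\<in>J. \<beta> * z' t i k * (w k * smax J I \<beta> (z t) i w)) \<in> borel_measurable (gauss J)" for t
    using J I by measurable
  show "integrable (gauss J) (\<lambda>w. \<Sum>i\<in>I. \<Sum>k\<in>J. \<beta> * (B * \<bar>w k\<bar>))"
    by (intro Bochner_Integration.integrable_sum integrable_mult_right integrable_abs integrable_gauss_component)
  fix t w
  have "((\<lambda>t. lse J I \<beta> (z t) w) has_real_derivative
    (\<Sum>i\<in>I. exp (\<beta> * lin J (z t i) w) * (\<beta> * (\<Sum>k\<in>J. z' t i k * w k))) / (\<Sum>i\<in>I. exp (\<beta> * lin J (z t i) w))) (at t)"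
    unfolding lse_def lin_def using sum_exp_lin_pos[of "z t" w, unfolded lin_def]
    by (auto intro!: derivative_eq_intros d simp: divide_inverse mult_ac)
  also have "(\<Sum>i\<in>I. exp (\<beta> * lin J (z t i) w) * (\<beta> * (\<Sum>k\<in>J. z' t i k * w k))) / (\<Sum>i\<in>I. exp (\<beta> * lin J (z t i) w))
    = (\<Sum>i\<in>I. \<Sum>k\<in>J. \<beta> * z' t i k * (w k * smax J I \<beta> (z t) i w))"
    unfolding smax_def sum_divide_distrib sum_distrib_left sum_distrib_right
    by (intro sum.cong refl) (simp add: mult_ac)
  finally show "((\<lambda>t. lse J I \<beta> (z t) w) has_real_derivative
    (\<Sum>i\<in>I. \<Sum>k\<in>J. \<beta> * z' t i k * (w k * smax J I \<beta> (z t) i w))) (at t)" .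
  show "\<bar>\<Sum>i\<in>I. \<Sum>k\<in>J. \<beta> * z' t i k * (w k * smax J I \<beta> (z t) i w)\<bar> \<le> (\<Sum>i\<in>I. \<Sum>k\<in>J. \<beta> * (B * \<bar>w k\<bar>))"
  proof (intro order_trans[OF sum_abs] sum_mono)
    fix i k assume ik: "i \<in> I" "k \<in> J"
    have "\<bar>z' t i k\<bar> * (\<bar>w k\<bar> * smax J I \<beta> (z t) i w) \<le> B * (\<bar>w k\<bar> * 1)"
      using b[OF ik] smax_le_1[OF ik(1)] by (intro mult_mono mult_left_mono) (auto simp: smax_nonneg intro: order_trans[OF abs_ge_zero])
    then show "\<bar>\<beta> * z' t i k * (w k * smax J I \<beta> (z t) i w)\<bar> \<le> \<beta> * (B * \<bar>w k\<bar>)"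
      using \<beta> by (simp add: abs_mult smax_nonneg mult.assoc)
  qed
qed

text \<open>The derivative of the expected soft maximum along a path of linear Gaussian processes is
 \<open>\<beta>\<^sup>2/4\<close> times an average, with nonnegative weights, of the derivatives of the squared increments.\<close>

lemma integral_smax_path:
  "(\<integral>w. (\<Sum>i\<in>I. \<Sum>k\<in>J. \<beta> * z' i k * (w k * smax J I \<beta> z i w)) \<partial>gauss J)
   = \<beta>\<^sup>2 / 2 * (\<integral>w. (\<Sum>i\<in>I. \<Sum>j\<in>I. smax J I \<beta> z i w * smax J I \<beta> z j w *
       (\<Sum>k\<in>J. (z' i k - z' j k) * (z i k - z j k))) \<partial>gauss J)" (is "?L = _")
proof -
  let ?p = "smax J I \<beta> z"
  define D where "D = (\<lambda>i k w. \<beta> * (?p i w * (z i k - (\<Sum>j\<in>I. ?p j w * z j k))))"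
  note ibp = smax_integration_by_parts[of _ _ z, folded D_def]
  have "?L = (\<Sum>i\<in>I. \<Sum>k\<in>J. \<beta> * z' i k * (\<integral>w. w k * ?p i w \<partial>gauss J))"
    by (simp add: Bochner_Integration.integral_sum integrable_sum ibp(2))
  also have "\<dots> = (\<Sum>i\<in>I. \<Sum>k\<in>J. \<beta> * z' i k * (\<integral>w. D i k w \<partial>gauss J))"
    by (intro sum.cong refl) (simp add: D_def ibp(1))
  also have "\<dots> = (\<integral>w. (\<Sum>i\<in>I. \<Sum>k\<in>J. \<beta> * z' i k * D i k w) \<partial>gauss J)"
    using ibp(3) unfolding D_def by (simp add: Bochner_Integration.integral_sum integrable_sum)
  also have "\<dots> = (\<integral>w. \<beta>\<^sup>2 / 2 * (\<Sum>i\<in>I. \<Sum>j\<in>I. ?p i w * ?p j w * (\<Sum>k\<in>J. (z' i k - z' j k) * (z i k - z j k))) \<partial>gauss J)"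
  proof (intro Bochner_Integration.integral_cong refl)
    fix w
    define p where "p = (\<lambda>i. ?p i w)"
    have p1: "(\<Sum>i\<in>I. p i) = 1" by (simp add: p_def sum_smax)
    \<comment> \<open>Symmetrisation of a covariance: twice the covariance of \<open>z'\<close> and
      \<open>z\<close> under the weights \<open>p\<close> is the mean, over two independent indices,
      of the product of their differences.\<close>
    have one: "2 * (\<Sum>i\<in>I. z' i k * (p i * (z i k - (\<Sum>j\<in>I. p j * z j k))))
       = (\<Sum>i\<in>I. \<Sum>j\<in>I. p i * p j * ((z' i k - z' j k) * (z i k - z j k)))" for k
    proof -
      let ?a = "\<lambda>i. z' i k" and ?b = "\<lambda>i. z i k"
      have "(\<Sum>i\<in>I. \<Sum>j\<in>I. p i * p j * ((?a i - ?a j) * (?b i - ?b j)))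
        = (\<Sum>i\<in>I. \<Sum>j\<in>I. p i * ?a i * ?b i * p j) + (\<Sum>i\<in>I. \<Sum>j\<in>I. p i * (p j * ?a j * ?b j))
          - (\<Sum>i\<in>I. \<Sum>j\<in>I. p i * ?a i * (p j * ?b j)) - (\<Sum>i\<in>I. \<Sum>j\<in>I. p i * ?b i * (p j * ?a j))"
        unfolding sum.distrib[symmetric] sum_subtractf[symmetric]
        by (intro sum.cong refl) (simp add: algebra_simps)
      also have "\<dots> = 2 * (\<Sum>i\<in>I. p i * ?a i * ?b i) - 2 * (\<Sum>i\<in>I. p i * ?a i) * (\<Sum>j\<in>I. p j * ?b j)"
        by (simp add: sum_product[symmetric] p1)
      also have "\<dots> = 2 * (\<Sum>i\<in>I. ?a i * (p i * (?b i - (\<Sum>j\<in>I. p j * ?b j))))"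
      proof -
        define c where "c = (\<Sum>j\<in>I. p j * ?b j)"
        have "(\<Sum>i\<in>I. ?a i * (p i * (?b i - c))) = (\<Sum>i\<in>I. p i * ?a i * ?b i - p i * ?a i * c)"
          by (intro sum.cong refl) (simp add: algebra_simps)
        also have "\<dots> = (\<Sum>i\<in>I. p i * ?a i * ?b i) - (\<Sum>i\<in>I. p i * ?a i) * c"
          by (simp add: sum_subtractf sum_distrib_right)
        finally show ?thesis by (simp add: c_def)
      qed
      finally show ?thesis by simp
    qed
    have "(\<Sum>i\<in>I. \<Sum>k\<in>J. \<beta> * z' i k * D i k w) = \<beta>\<^sup>2 * (\<Sum>k\<in>J. \<Sum>i\<in>I. z' i k * (p i * (z i k - (\<Sum>j\<in>I. p j * z j k))))"
    proof -
      have "(\<Sum>i\<in>I. \<Sum>k\<in>J. \<beta> * z' i k * D i k w)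
        = (\<Sum>i\<in>I. \<Sum>k\<in>J. \<beta>\<^sup>2 * (z' i k * (p i * (z i k - (\<Sum>j\<in>I. p j * z j k)))))"
        unfolding D_def p_def by (intro sum.cong refl) (simp only: power2_eq_square mult_ac)
      also have "\<dots> = (\<Sum>k\<in>J. \<Sum>i\<in>I. \<beta>\<^sup>2 * (z' i k * (p i * (z i k - (\<Sum>j\<in>I. p j * z j k)))))"
        by (rule sum.swap)
      finally show ?thesis by (simp only: sum_distrib_left)
    qed
    also have "\<dots> = \<beta>\<^sup>2 / 2 * (\<Sum>k\<in>J. \<Sum>i\<in>I. \<Sum>j\<in>I. p i * p j * ((z' i k - z' j k) * (z i k - z j k)))"
      unfolding one[symmetric] by (subst sum_distrib_left[symmetric]) simp
    also have "(\<Sum>k\<in>J. \<Sum>i\<in>I. \<Sum>j\<in>I. p i * p j * ((z' i k - z' j k) * (z i k - z j k)))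
       = (\<Sum>i\<in>I. \<Sum>j\<in>I. p i * p j * (\<Sum>k\<in>J. (z' i k - z' j k) * (z i k - z j k)))"
      unfolding sum_distrib_left by (rule trans[OF sum.swap]) (rule sum.cong[OF refl], rule sum.swap)
    finally show "(\<Sum>i\<in>I. \<Sum>k\<in>J. \<beta> * z' i k * D i k w) =
      \<beta>\<^sup>2 / 2 * (\<Sum>i\<in>I. \<Sum>j\<in>I. ?p i w * ?p j w * (\<Sum>k\<in>J. (z' i k - z' j k) * (z i k - z j k)))"
      by (simp add: p_def)
  qed
  finally show ?thesis by simp
qed

text \<open>The path \<open>cos t * x + sin t * y\<close> joins the two processes. By
  \<open>disj\<close> each coordinate serves only one of them, which expresses their independence:
  cross terms vanish, and the squared increment along the path is cos^2 t times that of
  \<open>x\<close> plus sin^2 t times that of \<open>y\<close>. On the quarter circle its derivative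
  is nonpositive by \<open>incr\<close>.\<close>

lemma lse_comparison:
  assumes disj: "\<And>k. k \<in> J \<Longrightarrow> (\<forall>i\<in>I. x i k = 0) \<or> (\<forall>i\<in>I. y i k = 0)"
    and incr: "\<And>i j. i \<in> I \<Longrightarrow> j \<in> I \<Longrightarrow> (\<Sum>k\<in>J. (y i k - y j k)\<^sup>2) \<le> (\<Sum>k\<in>J. (x i k - x j k)\<^sup>2)"
  shows "(\<integral>w. lse J I \<beta> y w \<partial>gauss J) \<le> (\<integral>w. lse J I \<beta> x w \<partial>gauss J)"
proof -
  define z where "z = (\<lambda>t i k. cos t * x i k + sin t * y i k)"
  define z' where "z' = (\<lambda>t i k. - sin t * x i k + cos t * y i k)"
  define B where "B = (\<Sum>i\<in>I. \<Sum>k\<in>J. \<bar>x i k\<bar> + \<bar>y i k\<bar>)"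
  have b: "\<bar>z' t i k\<bar> \<le> B" if "i \<in> I" "k \<in> J" for i k t
  proof -
    have "\<bar>z' t i k\<bar> \<le> \<bar>sin t\<bar> * \<bar>x i k\<bar> + \<bar>cos t\<bar> * \<bar>y i k\<bar>"
      using abs_triangle_ineq[of "- sin t * x i k" "cos t * y i k"] by (simp add: z'_def abs_mult)
    also have "\<dots> \<le> 1 * \<bar>x i k\<bar> + 1 * \<bar>y i k\<bar>" by (intro add_mono mult_right_mono) auto
    also have "\<dots> \<le> (\<Sum>k\<in>J. \<bar>x i k\<bar> + \<bar>y i k\<bar>)"
      using J that by (subst sum.remove[of _ k]) (auto intro!: sum_nonneg)
    also have "\<dots> \<le> B" unfolding B_def
      using I that by (subst sum.remove[of _ i]) (auto intro!: sum_nonneg)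
    finally show ?thesis .
  qed
  have d: "((\<lambda>t. z t i k) has_real_derivative z' t i k) (at t)" for i k t
    unfolding z_def z'_def by (auto intro!: derivative_eq_intros)
  let ?f = "\<lambda>t. \<integral>w. lse J I \<beta> (z t) w \<partial>gauss J"
  have "?f (pi/2) \<le> ?f 0"
  proof (rule DERIV_nonpos_imp_nonincreasing[of 0 "pi/2" ?f])
    fix t :: real assume t: "0 \<le> t" "t \<le> pi/2"
    have cs: "0 \<le> cos t" "0 \<le> sin t" using t cos_ge_zero[of t] sin_ge_zero[of t] pi_gt_zero by linarith+
    have inc: "(\<Sum>k\<in>J. (z' t i k - z' t j k) * (z t i k - z t j k)) \<le> 0" if "i \<in> I" "j \<in> I" for i j
    proof -
      have "(\<Sum>k\<in>J. (z' t i k - z' t j k) * (z t i k - z t j k))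
         = (\<Sum>k\<in>J. (sin t * cos t) * ((y i k - y j k)\<^sup>2 - (x i k - x j k)\<^sup>2))"
      proof (intro sum.cong refl)
        fix k assume "k \<in> J"
        then have "(x i k = 0 \<and> x j k = 0) \<or> (y i k = 0 \<and> y j k = 0)" using disj[of k] that by auto
        then have DE: "(x i k - x j k) * (y i k - y j k) = 0" by auto
        have z: "z t i k - z t j k = cos t * (x i k - x j k) + sin t * (y i k - y j k)"
          "z' t i k - z' t j k = - sin t * (x i k - x j k) + cos t * (y i k - y j k)"
          by (simp_all add: z_def z'_def right_diff_distrib)
        have gen: "(- s * D + c * E) * (c * D + s * E) = (s * c) * (E\<^sup>2 - D\<^sup>2) + (c * c - s * s) * (D * E)" for s c D E :: real
          by (simp add: power2_eq_square algebra_simps)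
        show "(z' t i k - z' t j k) * (z t i k - z t j k) = (sin t * cos t) * ((y i k - y j k)\<^sup>2 - (x i k - x j k)\<^sup>2)"
          unfolding z gen DE by simp
      qed
      also have "\<dots> = (sin t * cos t) * ((\<Sum>k\<in>J. (y i k - y j k)\<^sup>2) - (\<Sum>k\<in>J. (x i k - x j k)\<^sup>2))"
        by (simp only: sum_distrib_left[symmetric] sum_subtractf)
      also have "\<dots> \<le> 0" using cs incr[OF that] by (simp add: mult_nonneg_nonpos)
      finally show ?thesis .
    qed
    have "(\<integral>w. (\<Sum>i\<in>I. \<Sum>k\<in>J. \<beta> * z' t i k * (w k * smax J I \<beta> (z t) i w)) \<partial>gauss J) \<le> 0"
    proof -
      let ?F = "\<lambda>w. \<Sum>i\<in>I. \<Sum>j\<in>I. smax J I \<beta> (z t) i w * smax J I \<beta> (z t) j w *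
         (\<Sum>k\<in>J. (z' t i k - z' t j k) * (z t i k - z t j k))"
      have "?F w \<le> 0" for w
        by (intro sum_nonpos mult_nonneg_nonpos[OF mult_nonneg_nonneg[OF smax_nonneg smax_nonneg]] inc)
      then have "0 \<le> (\<integral>w. - ?F w \<partial>gauss J)" by (intro integral_nonneg_AE AE_I2) simp
      then have "(\<integral>w. ?F w \<partial>gauss J) \<le> 0" by (simp only: Bochner_Integration.integral_minus neg_0_le_iff_le)
      then show ?thesis unfolding integral_smax_path by (rule mult_nonneg_nonpos[rotated]) simp
    qed
    with DERIV_integral_lse[OF d b]
    show "\<exists>f'. (?f has_real_derivative f') (at t) \<and> f' \<le> 0" by (intro exI conjI)
  qed simp
  then show ?thesis by (simp add: z_def)
qed

end

text \<open>The smoothing error is at most \<open>ln (card I) / \<beta>\<close> and disappears for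
  large \<beta>. Disjoint coordinates are obtained by placing the two processes on separate blocks
  of \<open>J\<close>.\<close>

theorem sudakov_fernique_disjoint:
  fixes x y :: "'i \<Rightarrow> 'k \<Rightarrow> real"
  assumes J: "finite J" and I: "finite I" "I \<noteq> {}"
    and disj: "\<And>k. k \<in> J \<Longrightarrow> (\<forall>i\<in>I. x i k = 0) \<or> (\<forall>i\<in>I. y i k = 0)"
    and incr: "\<And>i j. i \<in> I \<Longrightarrow> j \<in> I \<Longrightarrow> (\<Sum>k\<in>J. (y i k - y j k)\<^sup>2) \<le> (\<Sum>k\<in>J. (x i k - x j k)\<^sup>2)"
  shows "(\<integral>w. Max ((\<lambda>i. lin J (y i) w) ` I) \<partial>gauss J) \<le> (\<integral>w. Max ((\<lambda>i. lin J (x i) w) ` I) \<partial>gauss J)" (is "?Y \<le> ?X")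
proof (rule field_le_epsilon)
  fix e :: real assume e: "e > 0"
  define \<beta> where "\<beta> = (\<bar>ln (card I)\<bar> + 1) / e"
  have \<beta>: "\<beta> > 0" using e by (auto simp: \<beta>_def)
  note iM = integrable_Max_lin[OF J I \<beta>] and iL = integrable_lse[OF J I \<beta>]
  have c: "integrable (gauss J) (\<lambda>w. ln (card I))"
    using prob_space.finite_measure[OF prob_space_gauss] by (rule finite_measure.integrable_const)
  have "\<beta> * ?Y = (\<integral>w. \<beta> * Max ((\<lambda>i. lin J (y i) w) ` I) \<partial>gauss J)" by simp
  also have "\<dots> \<le> (\<integral>w. lse J I \<beta> y w \<partial>gauss J)"
    by (rule integral_mono[OF integrable_mult_right[OF iM] iL lse_ge_Max[OF J I \<beta>]])
  also have "\<dots> \<le> (\<integral>w. lse J I \<beta> x w \<partial>gauss J)"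
    by (rule lse_comparison[OF J I \<beta> disj incr])
  also have "\<dots> \<le> (\<integral>w. \<beta> * Max ((\<lambda>i. lin J (x i) w) ` I) + ln (card I) \<partial>gauss J)"
    by (rule integral_mono[OF iL Bochner_Integration.integrable_add[OF integrable_mult_right[OF iM] c] lse_le_Max[OF J I \<beta>]])
  also have "\<dots> = \<beta> * ?X + ln (card I)"
    using iM c by (simp add: prob_space.prob_space[OF prob_space_gauss])
  also have "\<dots> \<le> \<beta> * ?X + \<beta> * e" using e abs_ge_self[of "ln (card I)"] by (simp add: \<beta>_def)
  also have "\<dots> = \<beta> * (?X + e)" by (simp add: algebra_simps)
  finally show "?Y \<le> ?X + e" using \<beta> by simp
qed

section \<open>Growth of the Gaussian width\<close>

lemma lin_diff: "lin J (\<lambda>k. x k - y k) w = lin J x w - lin J y w"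
  by (simp add: lin_def left_diff_distrib sum_subtractf)

text \<open>Based on \<open>Max\<close>, hence meant for finite nonempty sets; a general index set
  is reached through an increasing sequence of finite ones.\<close>

definition gwidth :: "'k set \<Rightarrow> ('k \<Rightarrow> real) set \<Rightarrow> real" where
  "gwidth J A = (\<integral>w. Max ((\<lambda>x. lin J x w) ` A) \<partial>gauss J)"

text \<open>A pseudometric, since coordinates outside \<open>J\<close> are invisible. Where distinct
  points must have positive distance, they are required to vanish outside \<open>J\<close>.\<close>

definition l2d :: "'k set \<Rightarrow> ('k \<Rightarrow> real) \<Rightarrow> ('k \<Rightarrow> real) \<Rightarrow> real" where
  "l2d J x y = L2_set (\<lambda>k. x k - y k) J"

lemma l2d_nonneg [simp]: "0 \<le> l2d J x y"
  by (simp add: l2d_def)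

lemma l2d_self [simp]: "l2d J x x = 0"
  by (simp add: l2d_def L2_set_def)

lemma l2d_commute: "l2d J x y = l2d J y x"
  by (simp add: l2d_def L2_set_def power2_commute)

lemma l2d_triangle: "l2d J x z \<le> l2d J x y + l2d J y z"
  using L2_set_triangle_ineq[of "\<lambda>k. x k - y k" "\<lambda>k. y k - z k" J] by (simp add: l2d_def)

lemma l2d_square: "(l2d J x y)\<^sup>2 = (\<Sum>k\<in>J. (x k - y k)\<^sup>2)"
  by (simp add: l2d_def L2_set_def sum_nonneg)

lemma integrable_Max_lin':
  assumes "finite J" "finite I" "I \<noteq> {}"
  shows "integrable (gauss J) (\<lambda>w. Max ((\<lambda>i. lin J (z i) w) ` I))"
  using integrable_Max_lin[OF assms, of 1] by simp

lemma gwidth_mono: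
  assumes "finite J" "finite B" "A \<subseteq> B" "A \<noteq> {}"
  shows "gwidth J A \<le> gwidth J B"
  unfolding gwidth_def
proof (rule integral_mono)
  show "integrable (gauss J) (\<lambda>w. Max ((\<lambda>x. lin J x w) ` A))" "integrable (gauss J) (\<lambda>w. Max ((\<lambda>x. lin J x w) ` B))"
    using assms by (auto intro!: integrable_Max_lin' intro: finite_subset)
  show "Max ((\<lambda>x. lin J x w) ` A) \<le> Max ((\<lambda>x. lin J x w) ` B)" for w
    using assms by (intro Max_mono) auto
qed

lemma gwidth_singleton: "finite J \<Longrightarrow> gwidth J {x} = 0"
  by (simp add: gwidth_def integral_lin)

lemma gwidth_nonneg: "finite J \<Longrightarrow> finite A \<Longrightarrow> A \<noteq> {} \<Longrightarrow> 0 \<le> gwidth J A"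
  using gwidth_mono[of J A "{_}"] gwidth_singleton[of J] by (metis empty_not_insert ex_in_conv insert_subset empty_subsetI)

section \<open>Coordinate blocks of a Gaussian product measure\<close>

lemma gauss_reindex:
  fixes F :: "('k \<Rightarrow> real) \<Rightarrow> real" and f :: "'k \<Rightarrow> 'l"
  assumes "finite K" "inj_on f J" "f ` J \<subseteq> K" and [measurable]: "F \<in> borel_measurable (gauss J)"
  shows "(\<integral>w. F (\<lambda>k\<in>J. w (f k)) \<partial>gauss K) = (\<integral>w. F w \<partial>gauss J)"
proof -
  have d: "distr (gauss K) (gauss J) (\<lambda>w. \<lambda>k\<in>J. w (f k)) = gauss J"
    using distr_PiM_reindex[of K "\<lambda>_. std_normal" f J] assms prob_space_std_normal by auto
  have m: "(\<lambda>w. \<lambda>k\<in>J. w (f k)) \<in> measurable (gauss K) (gauss J)"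
    using assms by (intro measurable_restrict measurable_component_singleton) auto
  have "(\<integral>w. F w \<partial>gauss J) = (\<integral>w. F w \<partial>distr (gauss K) (gauss J) (\<lambda>w. \<lambda>k\<in>J. w (f k)))"
    by (simp only: d)
  also have "\<dots> = (\<integral>w. F (\<lambda>k\<in>J. w (f k)) \<partial>gauss K)"
    by (rule integral_distr[OF m]) measurable
  finally show ?thesis ..
qed

text \<open>Independence is expressed through \<open>merge\<close>: \<open>f\<close> reads only the
  \<open>A\<close> block of a point and \<open>h\<close> only the \<open>B\<close> block, so Fubini
  separates the product.\<close>

lemma gauss_indep:
  fixes f h :: "('k \<Rightarrow> real) \<Rightarrow> real"
  assumes AB: "finite A" "finite B" "A \<inter> B = {}"
    and i: "integrable (gauss (A \<union> B)) f" "integrable (gauss (A \<union> B)) h" "integrable (gauss (A \<union> B)) (\<lambda>w. f w * h w)"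
    and fA: "\<And>x y. f (merge A B (x, y)) = f x" and hB: "\<And>x y. h (merge A B (x, y)) = h y"
  shows "(\<integral>w. f w * h w \<partial>gauss (A \<union> B)) = (\<integral>w. f w \<partial>gauss (A \<union> B)) * (\<integral>w. h w \<partial>gauss (A \<union> B))"
proof -
  note fold = std_normal_prod.product_integral_fold[OF AB(3,1,2)]
  have one: "(\<integral>w. c \<partial>gauss L) = c" for c :: real and L :: "'k set"
    using prob_space.prob_space[OF prob_space_gauss, of L] by simp
  show ?thesis
    unfolding fold[OF i(1)] fold[OF i(2)] fold[OF i(3)] fA hB one by simp
qed

text \<open>The comparison process attaches to the cluster around \<open>t\<^sub>T\<close> the same Gaussian vector, recentred at
 \<open>t\<^sub>T\<close>, plus an independent multiple of \<open>\<langle>\<epsilon>\<^sub>T, g\<rangle>\<close> for the sign vector \<open>\<epsilon>\<^sub>T\<close> of \<open>T\<close>. Selecting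
 the sign pattern of \<open>g\<close> gives the gain \<open>E \<Sum>\<bar>g\<^sub>i\<bar>\<close> and needs neither concentration of measure nor
 tail bounds.\<close>

theorem gwidth_super_sudakov:
  fixes t :: "nat set \<Rightarrow> 'k \<Rightarrow> real" and H :: "nat set \<Rightarrow> ('k \<Rightarrow> real) set"
  assumes J: "finite J" and A: "finite A" and k: "0 < (k::nat)"
    and \<rho>: "0 \<le> \<rho>"
    and HA: "\<And>T. T \<subseteq> {..<k} \<Longrightarrow> H T \<subseteq> A" and Hne: "\<And>T. T \<subseteq> {..<k} \<Longrightarrow> H T \<noteq> {}"
    and sep: "\<And>T U. T \<subseteq> {..<k} \<Longrightarrow> U \<subseteq> {..<k} \<Longrightarrow> T \<noteq> U \<Longrightarrow> \<rho> \<le> l2d J (t T) (t U)"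
    and ball: "\<And>T x. T \<subseteq> {..<k} \<Longrightarrow> x \<in> H T \<Longrightarrow> l2d J x (t T) \<le> \<rho> / 8"
    and m: "\<And>T. T \<subseteq> {..<k} \<Longrightarrow> m \<le> gwidth J (H T)"
  shows "m + (\<integral>x. \<bar>x\<bar> \<partial>std_normal) / 3 * (\<rho> * sqrt k) \<le> gwidth J A"
proof -
  define I where "I = Sigma (Pow {..<k}) H"
  have finH: "finite (H T)" if "T \<subseteq> {..<k}" for T using HA[OF that] A by (rule finite_subset)
  have I: "finite I" "I \<noteq> {}" using Hne finH unfolding I_def by (auto intro!: finite_SigmaI)
  \<comment> \<open>The factor 3 balances two demands. Points of different clusters are at distance
    at least \<rho> - 2 \<rho>/8 = 3\<rho>/4. In the comparison process the recentred points
    contribute at most (\<rho>/4)^2 and the signs at most 4 r^2 k = 4\<rho>^2/9, and 1/16 + 4/9 is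
    below 9/16.\<close>
  define r where "r = \<rho> / (3 * sqrt k)"
  have r: "0 \<le> r" "r * k = \<rho> * sqrt k / 3" "r\<^sup>2 * k = \<rho>\<^sup>2 / 9"
    using \<rho> k by (auto simp: r_def power2_eq_square field_simps)
  define \<epsilon> :: "nat set \<Rightarrow> nat \<Rightarrow> real" where "\<epsilon> = (\<lambda>T i. if i \<in> T then 1 else -1)"
  \<comment> \<open>Three independent blocks: the first carries the original process
    \<open>x\<close>, the second is a copy of \<open>J\<close> for the recentred points of
    \<open>y\<close>, the third holds the \<open>k\<close> sign coordinates of
    \<open>y\<close>.\<close>
  define K where "K = J <+> (J <+> {..<k})"
  have K: "finite K" unfolding K_def using J by auto
  define x :: "nat set \<times> ('k \<Rightarrow> real) \<Rightarrow> 'k + ('k + nat) \<Rightarrow> real"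
    where "x = (\<lambda>(T, a). case_sum a (\<lambda>_. 0))"
  define y :: "nat set \<times> ('k \<Rightarrow> real) \<Rightarrow> 'k + ('k + nat) \<Rightarrow> real"
    where "y = (\<lambda>(T, a). case_sum (\<lambda>_. 0) (case_sum (\<lambda>k. a k - t T k) (\<lambda>i. r * \<epsilon> T i)))"
  have sumK: "(\<Sum>l\<in>K. f l) = (\<Sum>l\<in>J. f (Inl l)) + ((\<Sum>l\<in>J. f (Inr (Inl l))) + (\<Sum>i<k. f (Inr (Inr i))))" for f :: "_ \<Rightarrow> real"
    unfolding K_def using J by (simp add: sum.Plus)
  have sf: "(\<integral>w. Max ((\<lambda>i. lin K (y i) w) ` I) \<partial>gauss K) \<le> (\<integral>w. Max ((\<lambda>i. lin K (x i) w) ` I) \<partial>gauss K)"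
  proof (rule sudakov_fernique_disjoint[OF K I])
    show "(\<forall>i\<in>I. x i l = 0) \<or> (\<forall>i\<in>I. y i l = 0)" for l
      unfolding x_def y_def by (cases l) auto
    fix i j assume ij: "i \<in> I" "j \<in> I"
    obtain T a U b where [simp]: "i = (T, a)" "j = (U, b)" by (cases i, cases j) auto
    have T: "T \<subseteq> {..<k}" "a \<in> H T" "U \<subseteq> {..<k}" "b \<in> H U" using ij by (auto simp: I_def)
    have X: "(\<Sum>l\<in>K. (x i l - x j l)\<^sup>2) = (l2d J a b)\<^sup>2"
      unfolding sumK x_def by (simp add: l2d_square)
    have Y: "(\<Sum>l\<in>K. (y i l - y j l)\<^sup>2) = (l2d J (\<lambda>l. a l - t T l) (\<lambda>l. b l - t U l))\<^sup>2 + r\<^sup>2 * (\<Sum>i<k. (\<epsilon> T i - \<epsilon> U i)\<^sup>2)"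
      unfolding sumK y_def by (simp add: l2d_square right_diff_distrib[symmetric] power_mult_distrib sum_distrib_left)
    show "(\<Sum>l\<in>K. (y i l - y j l)\<^sup>2) \<le> (\<Sum>l\<in>K. (x i l - x j l)\<^sup>2)"
    proof (cases "T = U")
      case True
      then show ?thesis unfolding X Y by (simp add: l2d_square)
    next
      case False
      have "l2d J (\<lambda>l. a l - t T l) (\<lambda>l. b l - t U l) \<le> l2d J a (t T) + l2d J (t U) b"
        using l2d_triangle[of J "\<lambda>l. a l - t T l" "\<lambda>l. b l - t U l" "\<lambda>_. 0"] by (simp add: l2d_def L2_set_def power2_commute)
      also have "\<dots> \<le> \<rho> / 4" using ball[OF T(1,2)] ball[OF T(3,4)] by (simp add: l2d_commute[of J "t U"])
      finally have "(l2d J (\<lambda>l. a l - t T l) (\<lambda>l. b l - t U l))\<^sup>2 \<le> (\<rho> / 4)\<^sup>2" by (intro power_mono) auto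
      moreover have "(\<Sum>i<k. (\<epsilon> T i - \<epsilon> U i)\<^sup>2) \<le> (\<Sum>i<k. 4)" by (intro sum_mono) (auto simp: \<epsilon>_def)
      then have "r\<^sup>2 * (\<Sum>i<k. (\<epsilon> T i - \<epsilon> U i)\<^sup>2) \<le> r\<^sup>2 * (4 * k)" by (intro mult_left_mono) auto
      then have "r\<^sup>2 * (\<Sum>i<k. (\<epsilon> T i - \<epsilon> U i)\<^sup>2) \<le> 4 * \<rho>\<^sup>2 / 9" using r(3) by (simp add: algebra_simps)
      ultimately have 1: "(\<Sum>l\<in>K. (y i l - y j l)\<^sup>2) \<le> (3 * \<rho> / 4)\<^sup>2"
        unfolding Y by (simp add: power_divide power_mult_distrib, use zero_le_power2[of \<rho>] in linarith)
      have "\<rho> \<le> l2d J (t T) (t U)" using sep[OF T(1,3) False] .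
      also have "\<dots> \<le> l2d J a (t T) + l2d J a b + l2d J b (t U)"
        using l2d_triangle[of J "t T" "t U" a] l2d_triangle[of J a "t U" b] by (simp add: l2d_commute[of J "t T"])
      finally have "3 * \<rho> / 4 \<le> l2d J a b" using ball[OF T(1,2)] ball[OF T(3,4)] by simp
      then have "(3 * \<rho> / 4)\<^sup>2 \<le> (l2d J a b)\<^sup>2" using \<rho> by (intro power_mono) auto
      with 1 show ?thesis unfolding X by linarith
    qed
  qed
  have linx: "lin K (x (T, a)) w = lin J a (\<lambda>l\<in>J. w (Inl l))" for T a w
    unfolding lin_def[of K] sumK x_def by (simp add: lin_def)
  have liny: "lin K (y (T, a)) w = lin J a (\<lambda>l\<in>J. w (Inr (Inl l))) - lin J (t T) (\<lambda>l\<in>J. w (Inr (Inl l)))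
      + r * (\<Sum>i<k. \<epsilon> T i * w (Inr (Inr i)))" for T a w
    unfolding lin_def[of K] sumK y_def
    by (simp add: lin_def left_diff_distrib right_diff_distrib sum_subtractf sum_distrib_left mult_ac)
  have "(\<integral>w. Max ((\<lambda>i. lin K (x i) w) ` I) \<partial>gauss K) \<le> (\<integral>w. Max ((\<lambda>a. lin J a (\<lambda>l\<in>J. w (Inl l))) ` A) \<partial>gauss K)"
  proof -
    have Ane: "A \<noteq> {}" using HA[of "{}"] Hne[of "{}"] by auto
    have "integrable (gauss K) (\<lambda>w. Max ((\<lambda>a. lin K (x ({}, a)) w) ` A))"
      using K A Ane by (rule integrable_Max_lin')
    moreover have "Max ((\<lambda>i. lin K (x i) w) ` I) \<le> Max ((\<lambda>a. lin J a (\<lambda>l\<in>J. w (Inl l))) ` A)" for w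
    proof (rule Max_mono)
      show "(\<lambda>i. lin K (x i) w) ` I \<subseteq> (\<lambda>a. lin J a (\<lambda>l\<in>J. w (Inl l))) ` A"
      proof
        fix v assume "v \<in> (\<lambda>i. lin K (x i) w) ` I"
        then obtain T a where "T \<subseteq> {..<k}" "a \<in> H T" "v = lin J a (\<lambda>l\<in>J. w (Inl l))"
          by (auto simp: I_def linx)
        then show "v \<in> (\<lambda>a. lin J a (\<lambda>l\<in>J. w (Inl l))) ` A" using HA[of T] by auto
      qed
    qed (use I A in auto)
    ultimately show ?thesis
      using integrable_Max_lin'[OF K I] by (intro integral_mono) (simp_all add: linx)
  qed
  also have "\<dots> = gwidth J A"
    unfolding gwidth_def using A J K
    by (subst gauss_reindex[where f=Inl and F="\<lambda>w. Max ((\<lambda>a. lin J a w) ` A)"]) (auto simp: K_def intro!: borel_measurable_Max)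
  finally have up: "(\<integral>w. Max ((\<lambda>i. lin K (y i) w) ` I) \<partial>gauss K) \<le> gwidth J A" using sf by simp

  \<comment> \<open>\<open>Z T\<close> is the maximum over the cluster of \<open>T\<close> with its
    sign term removed; it depends on the second block only. \<open>S T\<close> is the indicator that
    the signs of the third block form the pattern \<open>T\<close>, written as a product so that
    this dependence and its measurability are visible.\<close>
  define Z where "Z = (\<lambda>T w. Max ((\<lambda>a. lin K (y (T, a)) w) ` H T) - r * (\<Sum>i<k. \<epsilon> T i * w (Inr (Inr i))))"
  define S :: "nat set \<Rightarrow> ('k + ('k + nat) \<Rightarrow> real) \<Rightarrow> real"
    where "S = (\<lambda>T w. \<Prod>i<k. if i \<in> T then of_bool (0 \<le> w (Inr (Inr i))) else of_bool (w (Inr (Inr i)) < 0))"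
  have Ssel: "S T w = of_bool (T = {i\<in>{..<k}. 0 \<le> w (Inr (Inr i))})" if "T \<subseteq> {..<k}" for T w
  proof (cases "T = {i\<in>{..<k}. 0 \<le> w (Inr (Inr i))}")
    case True
    then show ?thesis unfolding S_def by (auto intro!: prod.neutral)
  next
    case False
    have "\<exists>i<k. (i \<in> T) \<noteq> (0 \<le> w (Inr (Inr i)))"
    proof (rule ccontr)
      assume "\<not> ?thesis"
      then have "T = {i\<in>{..<k}. 0 \<le> w (Inr (Inr i))}" using that by auto
      with False show False by blast
    qed
    then obtain i where "i < k" "(i \<in> T) \<noteq> (0 \<le> w (Inr (Inr i)))" by auto
    then show ?thesis using False unfolding S_def by (auto intro!: bexI[of _ i] split: if_splits)
  qed
  have S01: "S T w \<in> {0, 1}" if "T \<subseteq> {..<k}" for T w using Ssel[OF that] by auto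
  have Ssum: "(\<Sum>T\<in>Pow {..<k}. S T w) = 1" for w
  proof -
    have "(\<Sum>T\<in>Pow {..<k}. S T w) = (\<Sum>T\<in>Pow {..<k}. if T = {i\<in>{..<k}. 0 \<le> w (Inr (Inr i))} then 1 else 0)"
      by (intro sum.cong) (auto simp: Ssel)
    also have "\<dots> = 1" by (subst sum.delta) auto
    finally show ?thesis .
  qed
  have inK: "Inr (Inr i) \<in> K" if "i < k" for i using that by (auto simp: K_def)
  have mS [measurable]: "S T \<in> borel_measurable (gauss K)" for T
    unfolding S_def using inK by measurable
  have pfK: "finite_measure (gauss K)" by (rule prob_space.finite_measure[OF prob_space_gauss])
  have iS: "integrable (gauss K) (S T)" if "T \<subseteq> {..<k}" for T
  proof (rule finite_measure.integrable_const_bound[OF pfK, of _ 1])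
    show "AE w in gauss K. norm (S T w) \<le> 1" using S01[OF that] by (intro AE_I2) (metis abs_1 abs_zero insert_iff real_norm_def singletonD zero_le_one order_refl)
  qed simp
  have iMax: "integrable (gauss K) (\<lambda>w. Max ((\<lambda>a. lin K (y (T, a)) w) ` H T))" if "T \<subseteq> {..<k}" for T
    by (rule integrable_Max_lin'[OF K finH[OF that] Hne[OF that]])
  have iZ: "integrable (gauss K) (Z T)" if "T \<subseteq> {..<k}" for T
    unfolding Z_def using iMax[OF that]
    by (intro Bochner_Integration.integrable_diff integrable_mult_right Bochner_Integration.integrable_sum integrable_gauss_component inK) auto
  have iZS: "integrable (gauss K) (\<lambda>w. Z T w * S T w)" if "T \<subseteq> {..<k}" for T
  proof (rule Bochner_Integration.integrable_bound[OF iZ[OF that]])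
    show "AE w in gauss K. norm (Z T w * S T w) \<le> norm (Z T w)"
    proof (rule AE_I2)
      fix w show "norm (Z T w * S T w) \<le> norm (Z T w)" using S01[OF that, of w] by auto
    qed
  qed (use iZ[OF that] in measurable)
  have Zeq: "Z T w = Max ((\<lambda>a. lin J (\<lambda>l. a l - t T l) (\<lambda>l\<in>J. w (Inr (Inl l)))) ` H T)" if "T \<subseteq> {..<k}" for T w
  proof -
    have "Max ((\<lambda>a. lin K (y (T, a)) w) ` H T) = Max ((\<lambda>a. lin J (\<lambda>l. a l - t T l) (\<lambda>l\<in>J. w (Inr (Inl l))) + r * (\<Sum>i<k. \<epsilon> T i * w (Inr (Inr i)))) ` H T)"
      by (simp add: liny lin_diff)
    also have "\<dots> = Max ((\<lambda>a. lin J (\<lambda>l. a l - t T l) (\<lambda>l\<in>J. w (Inr (Inl l)))) ` H T) + r * (\<Sum>i<k. \<epsilon> T i * w (Inr (Inr i)))"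
      using finH[OF that] Hne[OF that] by (rule Max_add_commute)
    finally show ?thesis unfolding Z_def by simp
  qed
  have EZ: "(\<integral>w. Z T w \<partial>gauss K) = gwidth J (H T)" if T: "T \<subseteq> {..<k}" for T
  proof -
    have "(\<integral>w. Z T w \<partial>gauss K) = (\<integral>w. Max ((\<lambda>a. lin J (\<lambda>l. a l - t T l) w) ` H T) \<partial>gauss J)"
      unfolding Zeq[OF T] using K J finH[OF T]
      by (subst gauss_reindex[where f="\<lambda>l. Inr (Inl l)" and F="\<lambda>w. Max ((\<lambda>a. lin J (\<lambda>l. a l - t T l) w) ` H T)"])
         (auto simp: K_def inj_on_def intro!: borel_measurable_Max)
    also have "\<dots> = (\<integral>w. Max ((\<lambda>a. lin J a w) ` H T) - lin J (t T) w \<partial>gauss J)"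
      using Max_add_commute[OF finH[OF T] Hne[OF T], where k="- lin J (t T) _" and f="\<lambda>a. lin J a _"]
      by (intro Bochner_Integration.integral_cong refl) (simp add: lin_diff)
    also have "\<dots> = gwidth J (H T)"
      unfolding gwidth_def using integrable_Max_lin'[OF J finH[OF T] Hne[OF T]] J
      by (simp add: integrable_lin integral_lin)
    finally show ?thesis .
  qed
  define K1 :: "('k + ('k + nat)) set" where "K1 = Inl ` J \<union> Inr ` Inl ` J"
  define K2 :: "('k + ('k + nat)) set" where "K2 = Inr ` Inr ` {..<k}"
  have K12: "K = K1 \<union> K2" "finite K1" "finite K2" "K1 \<inter> K2 = {}"
    using J by (auto simp: K_def K1_def K2_def Plus_def)
  \<comment> \<open>The sign patterns partition the sample space, so \<open>m\<close> is split over
    them; independence of \<open>Z T\<close> and \<open>S T\<close> bounds each share by the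
    integral of \<open>Z T\<close> over its own event.\<close>
  have "m = m * (\<integral>w. (\<Sum>T\<in>Pow {..<k}. S T w) \<partial>gauss K)"
    unfolding Ssum using prob_space.prob_space[OF prob_space_gauss, of K] by simp
  also have "\<dots> = (\<Sum>T\<in>Pow {..<k}. m * (\<integral>w. S T w \<partial>gauss K))"
    using iS by (subst Bochner_Integration.integral_sum) (auto simp: sum_distrib_left)
  also have "\<dots> \<le> (\<Sum>T\<in>Pow {..<k}. (\<integral>w. Z T w * S T w \<partial>gauss K))"
  proof (rule sum_mono)
    fix T assume "T \<in> Pow {..<k}"
    then have T: "T \<subseteq> {..<k}" by simp
    have "(\<integral>w. Z T w * S T w \<partial>gauss (K1 \<union> K2)) = (\<integral>w. Z T w \<partial>gauss (K1 \<union> K2)) * (\<integral>w. S T w \<partial>gauss (K1 \<union> K2))"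
    proof (rule gauss_indep[OF K12(2-4)])
      show "Z T (merge K1 K2 (a, b)) = Z T a" for a b
      proof -
        have "(\<lambda>l\<in>J. merge K1 K2 (a, b) (Inr (Inl l))) = (\<lambda>l\<in>J. a (Inr (Inl l)))"
          by (rule restrict_ext) (auto simp: K1_def merge_def)
        then show ?thesis unfolding Zeq[OF T] by simp
      qed
      have "merge K1 K2 (a, b) (Inr (Inr i)) = b (Inr (Inr i))" if "i < k" for a b :: "'k + ('k + nat) \<Rightarrow> real" and i
        using that by (auto simp: K1_def K2_def merge_def)
      then show "S T (merge K1 K2 (a, b)) = S T b" for a b
        unfolding S_def by (intro prod.cong) auto
    qed (use iZ[OF T] iS[OF T] iZS[OF T] in \<open>simp_all add: K12(1)\<close>)
    then have "(\<integral>w. Z T w * S T w \<partial>gauss K) = gwidth J (H T) * (\<integral>w. S T w \<partial>gauss K)"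
      using EZ[OF T] by (simp add: K12(1))
    moreover have "0 \<le> (\<integral>w. S T w \<partial>gauss K)"
      using S01[OF T] by (intro integral_nonneg_AE AE_I2) (metis insert_iff order_refl singletonD zero_le_one)
    ultimately show "m * (\<integral>w. S T w \<partial>gauss K) \<le> (\<integral>w. Z T w * S T w \<partial>gauss K)"
      using m[OF T] by (simp add: mult_right_mono)
  qed
  also have "\<dots> = (\<integral>w. (\<Sum>T\<in>Pow {..<k}. Z T w * S T w) \<partial>gauss K)"
    using iZS by (subst Bochner_Integration.integral_sum) auto
  finally have mle: "m \<le> (\<integral>w. (\<Sum>T\<in>Pow {..<k}. Z T w * S T w) \<partial>gauss K)" .
  have "(\<integral>w. r * (\<Sum>i<k. \<bar>w (Inr (Inr i))\<bar>) \<partial>gauss K) = r * (\<Sum>i<k. \<integral>w. \<bar>w (Inr (Inr i))\<bar> \<partial>gauss K)"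
    by (simp add: Bochner_Integration.integral_sum integrable_gauss_component inK)
  also have "\<dots> = r * (\<Sum>i<k. \<integral>x. \<bar>x\<bar> \<partial>std_normal)"
    by (intro arg_cong[where f="\<lambda>x. r * x"] sum.cong refl integral_gauss_component) (auto intro: inK)
  also have "\<dots> = (r * k) * (\<integral>x. \<bar>x\<bar> \<partial>std_normal)" by simp
  finally have absE: "(\<integral>w. r * (\<Sum>i<k. \<bar>w (Inr (Inr i))\<bar>) \<partial>gauss K) = (\<integral>x. \<bar>x\<bar> \<partial>std_normal) / 3 * (\<rho> * sqrt k)"
    unfolding r(2) by simp
  have iabs: "integrable (gauss K) (\<lambda>w. r * (\<Sum>i<k. \<bar>w (Inr (Inr i))\<bar>))"
    by (intro integrable_mult_right Bochner_Integration.integrable_sum integrable_abs integrable_gauss_component inK) auto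
  have iSum: "integrable (gauss K) (\<lambda>w. \<Sum>T\<in>Pow {..<k}. Z T w * S T w)"
    using iZS by (intro Bochner_Integration.integrable_sum) auto
  have "m + (\<integral>x. \<bar>x\<bar> \<partial>std_normal) / 3 * (\<rho> * sqrt k)
     \<le> (\<integral>w. (\<Sum>T\<in>Pow {..<k}. Z T w * S T w) + r * (\<Sum>i<k. \<bar>w (Inr (Inr i))\<bar>) \<partial>gauss K)"
    using mle unfolding Bochner_Integration.integral_add[OF iSum iabs] absE by (rule add_right_mono)
  also have "\<dots> \<le> (\<integral>w. Max ((\<lambda>i. lin K (y i) w) ` I) \<partial>gauss K)"
  proof (rule integral_mono[OF Bochner_Integration.integrable_add[OF iSum iabs] integrable_Max_lin'[OF K I]])
    fix w :: "'k + ('k + nat) \<Rightarrow> real"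
    \<comment> \<open>The pattern selected by \<open>w\<close> itself: its sign term is
      \<open>r\<close> times the sum of absolute values, and its cluster alone bounds the maximum
      over \<open>I\<close> from below.\<close>
    define T where "T = {i\<in>{..<k}. 0 \<le> w (Inr (Inr i))}"
    have T: "T \<subseteq> {..<k}" by (auto simp: T_def)
    have "(\<Sum>U\<in>Pow {..<k}. Z U w * S U w) = (\<Sum>U\<in>Pow {..<k}. if U = T then Z U w else 0)"
      by (intro sum.cong) (auto simp: Ssel T_def)
    also have "\<dots> = Z T w" using T by (subst sum.delta) auto
    finally have "(\<Sum>U\<in>Pow {..<k}. Z U w * S U w) = Z T w" .
    moreover have "(\<Sum>i<k. \<epsilon> T i * w (Inr (Inr i))) = (\<Sum>i<k. \<bar>w (Inr (Inr i))\<bar>)"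
      by (intro sum.cong) (auto simp: \<epsilon>_def T_def)
    moreover have "Max ((\<lambda>a. lin K (y (T, a)) w) ` H T) \<le> Max ((\<lambda>i. lin K (y i) w) ` I)"
      using I Hne[OF T] T by (intro Max_mono) (auto simp: I_def)
    ultimately show "(\<Sum>T\<in>Pow {..<k}. Z T w * S T w) + r * (\<Sum>i<k. \<bar>w (Inr (Inr i))\<bar>) \<le> Max ((\<lambda>i. lin K (y i) w) ` I)"
      unfolding Z_def by simp
  qed
  also note up
  finally show ?thesis .
qed

section \<open>Greedy partitions and chaining\<close>

text \<open>The cutoff at zero gives a monotone nonnegative logarithm for a random variable that may
  vanish, with \<open>exp (lnp u) = max 1 u\<close>.\<close>

definition lnp :: "real \<Rightarrow> real" where "lnp u = ln (max 1 u)"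

lemma lnp_nonneg [simp]: "0 \<le> lnp u"
  by (simp add: lnp_def)

lemma lnp_mono: "u \<le> v \<Longrightarrow> lnp u \<le> lnp v"
  by (simp add: lnp_def)

lemma ln_le_lnp: "0 < u \<Longrightarrow> ln u \<le> lnp u"
  by (simp add: lnp_def)

lemma sum_telescoping_weights: "(\<Sum>l<N. 1 / (real (l + 1) * real (l + 2))) \<le> 1"
proof -
  have "(\<Sum>l<N. 1 / (real (l + 1) * real (l + 2))) = (\<Sum>l<N. 1 / real (l + 1) - 1 / real (Suc l + 1))"
    by (intro sum.cong) (auto simp: divide_simps)
  also have "\<dots> = 1 / real (0 + 1) - 1 / real (N + 1)" by (rule sum_lessThan_telescope')
  finally show ?thesis by simp
qed

text \<open>The weight 1/((l+1)(l+2)) of the \<open>l\<close>-th piece costs a logarithm of order at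
  most \<open>k + 1\<close>, so its square root matches the \<open>sqrt k\<close> that the growth
  condition repays.\<close>

lemma sqrt_ln_weight_le:
  assumes "l + 1 < 2 ^ (k + 1)"
  shows "sqrt (ln (2 * (real (l + 1) * real (l + 2)))) \<le> 2 * sqrt k + 2"
proof -
  have 1: "real (l + 1) \<le> 2 ^ (k + 1)" "real (l + 2) \<le> 2 ^ (k + 1)"
    using of_nat_mono[of "l + 1" "2 ^ (k + 1)", where 'a=real] of_nat_mono[of "l + 2" "2 ^ (k + 1)", where 'a=real] assms
    by simp_all
  have "2 * (real (l + 1) * real (l + 2)) \<le> 2 * (2 ^ (k + 1) * 2 ^ (k + 1))"
    by (intro mult_left_mono mult_mono 1) auto
  also have "\<dots> = 2 ^ (1 + (k + 1) + (k + 1))" by (simp add: power_add)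
  also have "1 + (k + 1) + (k + 1) = 2 * k + 3" by simp
  finally have "ln (2 * (real (l + 1) * real (l + 2))) \<le> ln (2 ^ (2 * k + 3))"
    by (subst ln_le_cancel_iff) auto
  also have "\<dots> = real (2 * k + 3) * ln 2" by (simp add: ln_realpow)
  also have "\<dots> \<le> real (2 * k + 3) * 1" by (intro mult_left_mono) (use ln_2_less_1 in auto)
  also have "\<dots> \<le> 4 * real k + 8 * sqrt k + 4" by simp
  also have "\<dots> = (2 * sqrt k + 2)\<^sup>2" by (simp add: power2_sum power_mult_distrib)
  finally show ?thesis by (intro real_le_lsqrt) auto
qed

text \<open>Each round removes the ball around a centre that maximises \<phi> on what is left. The
  centre itself goes because \<open>d x x \<le> \<rho>\<close>, so \<open>card A\<close> rounds
  exhaust \<open>A\<close>.\<close>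

lemma greedy_sequence:
  fixes d :: "'v \<Rightarrow> 'v \<Rightarrow> real" and \<phi> :: "'v set \<Rightarrow> 'v \<Rightarrow> real"
  assumes A: "finite A" and \<rho>: "\<And>x. d x x \<le> \<rho>"
  obtains D t where "D 0 = A" "\<And>l::nat. D (Suc l) = {x\<in>D l. \<not> d x (t l) \<le> \<rho>}"
    "\<And>l. D l \<noteq> {} \<Longrightarrow> t l \<in> D l" "\<And>l u. u \<in> D l \<Longrightarrow> \<phi> (D l) u \<le> \<phi> (D l) (t l)"
    "D (card A) = {}"
proof -
  define best where "best = (\<lambda>D. SOME t. t \<in> D \<and> (\<forall>u\<in>D. \<phi> D u \<le> \<phi> D t))"
  have best: "best D \<in> D \<and> (\<forall>u\<in>D. \<phi> D u \<le> \<phi> D (best D))" if "finite D" "D \<noteq> {}" for D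
  proof -
    have "Max (\<phi> D ` D) \<in> \<phi> D ` D" using that by (intro Max_in) auto
    then obtain t where "t \<in> D" "\<phi> D t = Max (\<phi> D ` D)" by auto
    then have "t \<in> D \<and> (\<forall>u\<in>D. \<phi> D u \<le> \<phi> D t)" using that by simp
    then show ?thesis unfolding best_def by (rule someI)
  qed
  define D where "D = rec_nat A (\<lambda>_ D. {x\<in>D. \<not> d x (best D) \<le> \<rho>})"
  have D: "D 0 = A" "D (Suc l) = {x\<in>D l. \<not> d x (best (D l)) \<le> \<rho>}" for l
    by (simp_all add: D_def)
  have fin: "finite (D l)" for l by (induction l) (simp_all add: D A)
  have card: "D l = {} \<or> card (D l) + l \<le> card A" for l
  proof (induction l)
    case (Suc l)
    show ?case
    proof (cases "D l = {}")
      case False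
      then have "D (Suc l) \<subset> D l" using best[OF fin False] \<rho> by (auto simp: D)
      then have "card (D (Suc l)) < card (D l)" by (rule psubset_card_mono[OF fin])
      then show ?thesis using Suc False by auto
    qed (simp add: D)
  qed (simp add: D)
  show ?thesis
  proof (rule that[of D "\<lambda>l. best (D l)"])
    show "\<phi> (D l) u \<le> \<phi> (D l) (best (D l))" if "u \<in> D l" for l u
      using best[OF fin, of l] that by auto
    show "D (card A) = {}" using card[of "card A"] fin[of "card A"] by auto
  qed (use D best[OF fin] in auto)
qed

text \<open>Keeps the two laws apart: the process \<open>X\<close> with subgaussian increments lives
  on \<open>M\<close>, whereas \<open>g\<close> stands for a Gaussian width with its growth
  condition. The clusters are indexed by the subsets of \<open>{..<k}\<close>, the sign patterns of
  \<open>gwidth_super_sudakov\<close>, so that there are \<open>2 ^ k\<close> of them.\<close>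

locale chaining = prob_space M for M :: "'y measure" +
  fixes X :: "'v \<Rightarrow> 'y \<Rightarrow> real" and d :: "'v \<Rightarrow> 'v \<Rightarrow> real" and g :: "'v set \<Rightarrow> real" and K c :: real
  assumes X_measurable [measurable]: "\<And>v. X v \<in> borel_measurable M"
    and K: "0 \<le> K" and c: "0 < c"
    and d_self: "\<And>x. d x x = 0" and d_nonneg: "\<And>x y. 0 \<le> d x y" and d_commute: "\<And>x y. d x y = d y x"
    and mgf: "\<And>a b h. (\<integral>\<^sup>+y. ennreal (exp (h * (X a y - X b y))) \<partial>M) \<le> ennreal (exp (K * h\<^sup>2 * (d a b)\<^sup>2))"
    and g_mono: "\<And>A B. finite B \<Longrightarrow> A \<subseteq> B \<Longrightarrow> A \<noteq> {} \<Longrightarrow> g A \<le> g B"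
    and g_nonneg: "\<And>A. finite A \<Longrightarrow> A \<noteq> {} \<Longrightarrow> 0 \<le> g A"
    and g_growth: "\<And>A (k::nat) \<rho> t H m. finite A \<Longrightarrow> 0 < k \<Longrightarrow> 0 \<le> \<rho> \<Longrightarrow>
      (\<And>T::nat set. T \<subseteq> {..<k} \<Longrightarrow> H T \<subseteq> A) \<Longrightarrow> (\<And>T::nat set. T \<subseteq> {..<k} \<Longrightarrow> H T \<noteq> {}) \<Longrightarrow>
      (\<And>T U::nat set. T \<subseteq> {..<k} \<Longrightarrow> U \<subseteq> {..<k} \<Longrightarrow> T \<noteq> U \<Longrightarrow> \<rho> \<le> d (t T) (t U)) \<Longrightarrow>
      (\<And>(T::nat set) x. T \<subseteq> {..<k} \<Longrightarrow> x \<in> H T \<Longrightarrow> d x (t T) \<le> \<rho> / 8) \<Longrightarrow>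
      (\<And>T::nat set. T \<subseteq> {..<k} \<Longrightarrow> m \<le> g (H T)) \<Longrightarrow> m + c * (\<rho> * sqrt k) \<le> g A"
begin

definition near :: "real \<Rightarrow> 'v set \<Rightarrow> 'v \<Rightarrow> 'v set" where
  "near \<rho> A t = {x\<in>A. d x t \<le> \<rho>}"

text \<open>The other half of the potential \<open>g A + gloc (r / 8) A\<close>. On descending to a
  piece, its \<open>g\<close> is at most the old \<open>gloc\<close>, while its \<open>gloc\<close>
  is below the old \<open>g\<close> by the amount charged for the edge.\<close>

definition gloc :: "real \<Rightarrow> 'v set \<Rightarrow> real" where
  "gloc \<rho> A = Max ((\<lambda>t. g (near \<rho> A t)) ` A)"

lemma near_subset: "near \<rho> A t \<subseteq> A"
  by (auto simp: near_def)

lemma near_self: "0 \<le> \<rho> \<Longrightarrow> t \<in> A \<Longrightarrow> t \<in> near \<rho> A t"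
  by (simp add: near_def d_self)

lemma gloc_ge: "finite A \<Longrightarrow> t \<in> A \<Longrightarrow> g (near \<rho> A t) \<le> gloc \<rho> A"
  unfolding gloc_def by (intro Max_ge) auto

lemma gloc_le:
  assumes "finite A" "A \<noteq> {}" "0 \<le> \<rho>"
  shows "gloc \<rho> A \<le> g A"
proof -
  have "g (near \<rho> A t) \<le> g A" if "t \<in> A" for t
    using near_self[OF assms(3) that] by (intro g_mono near_subset assms) auto
  then show ?thesis unfolding gloc_def using assms by (subst Max_le_iff) auto
qed

text \<open>A bijection numbers the sign patterns below \<open>2 ^ k\<close>, which turns the growth
  condition into one about the first \<open>l + 1\<close> terms of a greedy sequence. For
  \<open>k = 0\<close> the gain is zero and monotonicity of \<open>g\<close> suffices.\<close>

lemma g_growth_seq: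
  fixes k l :: nat and t :: "nat \<Rightarrow> 'v"
  assumes A: "finite A" and \<rho>: "0 \<le> \<rho>" and k: "2 ^ k \<le> Suc l"
    and H: "\<And>j. j \<le> l \<Longrightarrow> H j \<subseteq> A" "\<And>j. j \<le> l \<Longrightarrow> H j \<noteq> {}"
    and sep: "\<And>i j. i < j \<Longrightarrow> j \<le> l \<Longrightarrow> \<rho> \<le> d (t j) (t i)"
    and ball: "\<And>j x. j \<le> l \<Longrightarrow> x \<in> H j \<Longrightarrow> d x (t j) \<le> \<rho> / 8"
    and m: "\<And>j. j \<le> l \<Longrightarrow> m \<le> g (H j)"
  shows "m + c * (\<rho> * sqrt k) \<le> g A"
proof (cases "k = 0")
  case True
  have "m \<le> g (H 0)" by (rule m) simp
  also have "\<dots> \<le> g A" using A H by (intro g_mono) auto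
  finally show ?thesis using True by simp
next
  case False
  have "card (Pow {..<k}) = card {..<(2::nat)^k}" by (simp add: card_Pow)
  then obtain b where b: "bij_betw b (Pow {..<k}) {..<(2::nat)^k}"
    using finite_same_card_bij[of "Pow {..<k}" "{..<(2::nat)^k}"] by auto
  have bl: "b T \<le> l" if "T \<subseteq> {..<k}" for T
  proof -
    have "b T < 2 ^ k" using bij_betwE[OF b] that by auto
    then show ?thesis using k by linarith
  qed
  show ?thesis
  proof (rule g_growth[OF A _ \<rho>, where t="\<lambda>T. t (b T)" and H="\<lambda>T. H (b T)"])
    fix T U :: "nat set" assume T: "T \<subseteq> {..<k}" "U \<subseteq> {..<k}" "T \<noteq> U"
    then have "b T \<noteq> b U" using bij_betw_imp_inj_on[OF b] by (auto dest: inj_onD)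
    then consider "b T < b U" | "b U < b T" by linarith
    then show "\<rho> \<le> d (t (b T)) (t (b U))"
    proof cases
      case 1
      then show ?thesis using sep[of "b T" "b U"] bl[OF T(2)] d_commute[of "t (b T)"] by simp
    next
      case 2
      then show ?thesis using sep[of "b U" "b T"] bl[OF T(1)] by simp
    qed
  qed (use H ball m bl False in auto)
qed

text \<open>The growth condition for two singletons, with \<open>k = 1\<close> and
  \<open>m = 0\<close>. It lets the radius of an index set be absorbed into its width.\<close>

lemma diam_le:
  assumes "finite A" "x \<in> A" "y \<in> A"
  shows "c * d x y \<le> g A"
proof -
  have "0 + c * (d x y * sqrt (real 1)) \<le> g A"
    by (rule g_growth_seq[where l=1 and t="\<lambda>j. if j = 0 then x else y" and H="\<lambda>j. if j = 0 then {x} else {y}"])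
       (use assms in \<open>auto simp: d_nonneg d_commute d_self intro!: g_nonneg\<close>)
  then show ?thesis by simp
qed

text \<open>Induction on the number \<open>n\<close> of scales. The greedy partition at scale \<open>r/8\<close> always extracts the
 piece whose centre maximises \<open>g\<close> of a ball of radius \<open>r/64\<close>; hence the growth condition charges
 \<open>r \<surd>k\<close> for the \<open>l\<close>-th piece (\<open>2\<^sup>k \<le> l + 1\<close>) to the decrease of \<open>g + gloc\<close>, which telescopes along
 every branch of the tree. The variable \<open>S\<close> collects the exponential moments of all increments, with
 weights of total mass at most \<open>w\<close>, so that a bound on \<open>S\<close> controls all of them simultaneously.\<close>

lemma chaining_step:
  fixes q :: real and n :: nat
  assumes q: "1 \<le> q"
  shows "\<lbrakk>finite A; x0 \<in> A; \<And>x. x \<in> A \<Longrightarrow> d x x0 \<le> r; 0 < r;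
     \<And>x y. x \<in> A \<Longrightarrow> y \<in> A \<Longrightarrow> x \<noteq> y \<Longrightarrow> r / 8 ^ n < d x y; 0 < w; w \<le> 1\<rbrakk> \<Longrightarrow>
    \<exists>S. S \<in> borel_measurable M \<and> (\<forall>y. 0 \<le> S y) \<and> (\<integral>\<^sup>+y. ennreal (S y) \<partial>M) \<le> ennreal w \<and>
      (\<forall>x\<in>A. \<forall>y. X x y - X x0 y \<le> 20 * (K + 1) / c * (g A + gloc (r / 8) A)
         + 2 * (K + 1) * r * (sqrt (ln (1 / w)) + sqrt q + 2) + 2 * r / sqrt q * lnp (S y))"
proof (induction n arbitrary: A x0 r w)
  case 0
  \<comment> \<open>No scale is left: distinct points are farther apart than \<open>r\<close>, yet
    all lie within \<open>r\<close> of \<open>x0\<close>. So only \<open>x0\<close> remains, and the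
    zero variable serves as \<open>S\<close>.\<close>
  have A: "A = {x0}"
  proof -
    have "x = x0" if "x \<in> A" for x
      using 0(3)[OF that] 0(5)[OF that 0(2)] by (cases "x = x0") auto
    then show ?thesis using 0(2) by blast
  qed
  have "near (r / 8) A x0 \<noteq> {}" using near_self[of "r/8" x0 A] 0(2,4) by auto
  then have "0 \<le> g (near (r / 8) A x0)" by (rule g_nonneg[OF finite_subset[OF near_subset 0(1)]])
  then have "0 \<le> g A + gloc (r / 8) A"
    using g_nonneg[OF 0(1)] gloc_ge[OF 0(1,2), of "r/8"] 0(2) by fastforce
  then have "0 \<le> 20 * (K + 1) / c * (g A + gloc (r / 8) A)
     + 2 * (K + 1) * r * (sqrt (ln (1 / w)) + sqrt q + 2) + 2 * r / sqrt q * lnp 0"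
  proof -
    have "0 \<le> 20 * (K + 1) / c * (g A + gloc (r / 8) A)"
      using K c \<open>0 \<le> g A + gloc (r / 8) A\<close> by (intro mult_nonneg_nonneg) auto
    moreover have "0 \<le> 2 * (K + 1) * r * (sqrt (ln (1 / w)) + sqrt q + 2)"
      using K q 0(4,6,7) by (intro mult_nonneg_nonneg add_nonneg_nonneg) auto
    moreover have "0 \<le> 2 * r / sqrt q * lnp 0" using q 0(4) by simp
    ultimately show ?thesis by linarith
  qed
  then show ?case using 0 A by (intro exI[of _ "\<lambda>_. 0"]) auto
next
  case (Suc n)
  note A = Suc.prems(1) and x0 = Suc.prems(2) and Ax0 = Suc.prems(3) and r = Suc.prems(4) and sepA = Suc.prems(5)
    and w = Suc.prems(6,7)
  \<comment> \<open>The centres will be separated by \<open>r / 8\<close>; the growth condition asks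
    for clusters of an eighth of that, hence the radius \<open>r / 64\<close> in the selection
    rule.\<close>
  define \<phi> where "\<phi> = (\<lambda>D t. g (near (r / 64) D t))"
  obtain D t where D0: "D 0 = A" and DS: "\<And>l::nat. D (Suc l) = {x\<in>D l. \<not> d x (t l) \<le> r / 8}"
    and tD: "\<And>l. D l \<noteq> {} \<Longrightarrow> t l \<in> D l" and best: "\<And>l u. u \<in> D l \<Longrightarrow> \<phi> (D l) u \<le> \<phi> (D l) (t l)"
    and Dend: "D (card A) = {}"
    by (rule greedy_sequence[OF A, of d "r/8" \<phi>]) (use r d_self in auto)
  have Ddec: "D j \<subseteq> D i" if "i \<le> j" for i j
    by (rule lift_Suc_antimono_le[OF _ that]) (auto simp: DS)
  have DA: "D l \<subseteq> A" for l using Ddec[of 0 l] D0 by simp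
  have finD: "finite (D l)" for l using DA A by (rule finite_subset)
  define L where "L = {l. l < card A \<and> D l \<noteq> {}}"
  have L: "finite L" "L \<subseteq> {..<card A}" by (auto simp: L_def)
  define P where "P = (\<lambda>l. near (r / 8) (D l) (t l))"
  have PA: "P l \<subseteq> A" for l using near_subset DA unfolding P_def by blast
  have finP: "finite (P l)" for l using PA A by (rule finite_subset)
  have tP: "t l \<in> P l" if "l \<in> L" for l
    using that tD r by (auto simp: P_def L_def intro!: near_self)
  have cover: "\<exists>l\<in>L. x \<in> P l" if x: "x \<in> A" for x
  proof -
    \<comment> \<open>The round in which \<open>x\<close> disappears is the one whose ball contains
      it.\<close>
    define N where "N = (LEAST l. x \<notin> D l)"
    have "x \<notin> D (card A)" by (simp add: Dend)
    then have N: "x \<notin> D N" "N \<le> card A" unfolding N_def by (rule LeastI, rule Least_le)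
    have "N \<noteq> 0" using N x D0 by metis
    then obtain l where l: "N = Suc l" by (cases N) auto
    then have "x \<in> D l" using not_less_Least[of l "\<lambda>l. x \<notin> D l"] by (auto simp: N_def)
    with N l have l: "l < card A" "x \<in> D l" "x \<notin> D (Suc l)" by auto
    then show ?thesis by (intro bexI[of _ l]) (auto simp: L_def P_def near_def DS)
  qed
  define \<omega> where "\<omega> = (\<lambda>l::nat. 1 / (real (l + 1) * real (l + 2)))"
  \<comment> \<open>One half of \<open>w * \<omega> l\<close> is spent on the edge from
    \<open>x0\<close> to \<open>t l\<close>, the other on the subtree below
    \<open>t l\<close>.\<close>
  define v where "v = (\<lambda>l. w * \<omega> l / 2)"
  have \<omega>: "0 < \<omega> l" "\<omega> l \<le> 1" for l
  proof -
    have "1 * 1 \<le> real (l + 1) * real (l + 2)" by (intro mult_mono) auto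
    then show "0 < \<omega> l" "\<omega> l \<le> 1" by (auto simp: \<omega>_def)
  qed
  have v: "0 < v l" "v l \<le> 1" for l
  proof -
    show "0 < v l" using w \<omega> by (simp add: v_def)
    have "w * \<omega> l \<le> 1 * 1" using w \<omega>[of l] by (intro mult_mono) auto
    then show "v l \<le> 1" by (simp add: v_def)
  qed
  \<comment> \<open>A ball of radius \<open>r / 64\<close> inside \<open>P l\<close> lies in a
    candidate ball of every earlier round, because \<open>P l\<close> is contained in
    \<open>D j\<close>. By the greedy rule each of the first \<open>l + 1\<close> clusters therefore
    has \<open>g\<close> at least \<open>gloc (r / 64) (P l)\<close>.\<close>
  have growth: "gloc (r / 64) (P l) + c * (r / 8 * sqrt k) \<le> g A" if l: "l \<in> L" and k: "2 ^ k \<le> Suc l" for l k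
  proof (rule g_growth_seq[OF A _ k, where t=t and H="\<lambda>j. near (r / 64) (D j) (t j)"])
    fix j assume j: "j \<le> l"
    have Dj: "D j \<noteq> {}" using Ddec[OF j] l by (auto simp: L_def)
    show "near (r / 64) (D j) (t j) \<subseteq> A" using near_subset DA by blast
    show "near (r / 64) (D j) (t j) \<noteq> {}" using near_self[of "r/64", OF _ tD[OF Dj]] r by auto
    show "d x (t j) \<le> r / 8 / 8" if "x \<in> near (r / 64) (D j) (t j)" for x
      using that by (simp add: near_def)
    have "P l \<noteq> {}" using tP[OF l] by auto
    then have "gloc (r / 64) (P l) \<in> (\<lambda>u. g (near (r / 64) (P l) u)) ` P l"
      unfolding gloc_def using finP by (intro Max_in) auto
    then obtain u where u: "u \<in> P l" "gloc (r / 64) (P l) = g (near (r / 64) (P l) u)" by auto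
    have PD: "P l \<subseteq> D j" using Ddec[OF j] near_subset unfolding P_def by blast
    have "g (near (r / 64) (P l) u) \<le> g (near (r / 64) (D j) u)"
      using PD u r near_self[of "r/64" u "P l"]
      by (intro g_mono finite_subset[OF near_subset finD]) (auto simp: near_def)
    also have "\<dots> \<le> g (near (r / 64) (D j) (t j))" using best[of u j] PD u by (auto simp: \<phi>_def)
    finally show "gloc (r / 64) (P l) \<le> g (near (r / 64) (D j) (t j))" using u by simp
  next
    fix i j assume ij: "i < j" "j \<le> l"
    have "D j \<noteq> {}" using Ddec[OF ij(2)] l by (auto simp: L_def)
    then have "t j \<in> D (Suc i)" using tD[of j] Ddec[of "Suc i" j] ij by auto
    then show "r / 8 \<le> d (t j) (t i)" by (auto simp: DS)
  qed (use r in auto)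
  define Q where "Q = (\<lambda>l S. S \<in> borel_measurable M \<and> (\<forall>y. 0 \<le> S y) \<and> (\<integral>\<^sup>+y. ennreal (S y) \<partial>M) \<le> ennreal (v l) \<and>
      (\<forall>x\<in>P l. \<forall>y. X x y - X (t l) y \<le> 20 * (K + 1) / c * (g (P l) + gloc (r / 8 / 8) (P l))
         + 2 * (K + 1) * (r / 8) * (sqrt (ln (1 / v l)) + sqrt q + 2) + 2 * (r / 8) / sqrt q * lnp (S y)))"
  have "\<forall>l\<in>L. \<exists>S. Q l S"
  proof
    fix l assume l: "l \<in> L"
    show "\<exists>S. Q l S" unfolding Q_def
    proof (rule Suc.IH[OF finP tP[OF l] _ _ _ v])
      show "d x (t l) \<le> r / 8" if "x \<in> P l" for x using that by (simp add: P_def near_def)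
      show "r / 8 / 8 ^ n < d x y" if "x \<in> P l" "y \<in> P l" "x \<noteq> y" for x y
        using sepA[of x y] that PA by (auto simp: mult.commute)
    qed (use r in auto)
  qed
  from bchoice[OF this] obtain S where QS: "\<And>l. l \<in> L \<Longrightarrow> Q l (S l)" by blast
  have S: "\<And>l. l \<in> L \<Longrightarrow> S l \<in> borel_measurable M" "\<And>l y. l \<in> L \<Longrightarrow> 0 \<le> S l y"
      "\<And>l. l \<in> L \<Longrightarrow> (\<integral>\<^sup>+y. ennreal (S l y) \<partial>M) \<le> ennreal (v l)"
      "\<And>l x y. l \<in> L \<Longrightarrow> x \<in> P l \<Longrightarrow> X x y - X (t l) y \<le> 20 * (K + 1) / c * (g (P l) + gloc (r / 8 / 8) (P l))
         + 2 * (K + 1) * (r / 8) * (sqrt (ln (1 / v l)) + sqrt q + 2) + 2 * (r / 8) / sqrt q * lnp (S l y)"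
    using QS unfolding Q_def by simp_all
  \<comment> \<open>Including \<open>q\<close> keeps the exponent used in \<open>W\<close> at least
    \<open>sqrt q / r\<close>. This divides \<open>lnp (U y)\<close> by \<open>sqrt q\<close> below,
    at the price of a term of order \<open>r * sqrt q\<close>.\<close>
  define Lq where "Lq = (\<lambda>l. ln (1 / v l) + q)"
  have Lq: "q \<le> Lq l" "0 < Lq l" "ln (1 / v l) \<le> Lq l" "0 \<le> ln (1 / v l)" for l
    using v[of l] q by (auto simp: Lq_def ln_ge_zero intro!: add_nonneg_pos)
  \<comment> \<open>Exponential of the edge increment, normalised to mean at most 1: the edge has
    length at most \<open>r\<close>, so its moment at this exponent is at most
    \<open>exp (K * Lq l)\<close>.\<close>
  define W where "W = (\<lambda>l y. exp (sqrt (Lq l) / r * (X (t l) y - X x0 y)) * exp (- (K * Lq l)))"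
  have EW: "(\<integral>\<^sup>+y. ennreal (W l y) \<partial>M) \<le> 1" if l: "l \<in> L" for l
  proof -
    have "(\<integral>\<^sup>+y. ennreal (W l y) \<partial>M) = (\<integral>\<^sup>+y. ennreal (exp (sqrt (Lq l) / r * (X (t l) y - X x0 y))) \<partial>M) * ennreal (exp (- (K * Lq l)))"
      unfolding W_def by (subst nn_integral_multc[symmetric]) (auto simp: ennreal_mult)
    also have "\<dots> \<le> ennreal (exp (K * (sqrt (Lq l) / r)\<^sup>2 * (d (t l) x0)\<^sup>2)) * ennreal (exp (- (K * Lq l)))"
      by (intro mult_right_mono mgf) auto
    also have "\<dots> = ennreal (exp (K * (sqrt (Lq l) / r)\<^sup>2 * (d (t l) x0)\<^sup>2 - K * Lq l))"
      by (simp add: ennreal_mult[symmetric] exp_add[symmetric])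
    also have "\<dots> \<le> ennreal (exp 0)"
    proof -
      have "d (t l) x0 \<le> r" using Ax0 tP[OF l] PA by auto
      then have "(d (t l) x0)\<^sup>2 \<le> r\<^sup>2" using d_nonneg by (intro power_mono)
      then have "(sqrt (Lq l) / r)\<^sup>2 * (d (t l) x0)\<^sup>2 \<le> (sqrt (Lq l) / r)\<^sup>2 * r\<^sup>2" by (intro mult_left_mono) auto
      also have "\<dots> = Lq l" using r Lq(2)[of l] by (simp add: power_divide)
      finally have "K * ((sqrt (Lq l) / r)\<^sup>2 * (d (t l) x0)\<^sup>2) \<le> K * Lq l" using K by (rule mult_left_mono)
      then show ?thesis by (intro ennreal_leI) (simp add: mult.assoc)
    qed
    finally show ?thesis by simp
  qed
  define U where "U = (\<lambda>y. \<Sum>l\<in>L. v l * W l y + S l y)"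
  have Wm [measurable]: "W l \<in> borel_measurable M" for l unfolding W_def by measurable
  have W0: "0 \<le> W l y" for l y by (simp add: W_def)
  have term0: "0 \<le> v l * W l y + S l y" if "l \<in> L" for l y
    using v W0 S(2)[OF that] by (intro add_nonneg_nonneg mult_nonneg_nonneg) (auto intro: less_imp_le)
  show ?case
  proof (intro exI[of _ U] conjI allI ballI)
    show "U \<in> borel_measurable M" unfolding U_def using S(1) by measurable
    show "0 \<le> U y" for y unfolding U_def by (intro sum_nonneg term0)
    have "(\<integral>\<^sup>+y. ennreal (U y) \<partial>M) = (\<integral>\<^sup>+y. (\<Sum>l\<in>L. ennreal (v l) * ennreal (W l y) + ennreal (S l y)) \<partial>M)"
      unfolding U_def using term0 v W0 S(2)
      by (intro nn_integral_cong) (simp add: sum_ennreal[symmetric] ennreal_plus ennreal_mult less_imp_le del: sum_ennreal)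
    also have "\<dots> = (\<Sum>l\<in>L. ennreal (v l) * (\<integral>\<^sup>+y. ennreal (W l y) \<partial>M) + (\<integral>\<^sup>+y. ennreal (S l y) \<partial>M))"
      using S(1) by (simp add: nn_integral_sum nn_integral_add nn_integral_cmult)
    also have "\<dots> \<le> (\<Sum>l\<in>L. ennreal (v l) * 1 + ennreal (v l))"
      by (intro sum_mono add_mono mult_left_mono EW S(3)) auto
    also have "\<dots> = ennreal (\<Sum>l\<in>L. w * \<omega> l)"
      using v less_imp_le[OF v(1)] by (simp add: ennreal_plus[symmetric] sum_ennreal v_def del: ennreal_plus)
    also have "\<dots> \<le> ennreal w"
    proof (rule ennreal_leI)
      have "(\<Sum>l\<in>L. \<omega> l) \<le> (\<Sum>l<card A. \<omega> l)" using L \<omega>(1) by (intro sum_mono2) (auto intro: less_imp_le)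
      also have "\<dots> \<le> 1" unfolding \<omega>_def by (rule sum_telescoping_weights)
      finally have "w * (\<Sum>l\<in>L. \<omega> l) \<le> w * 1" using w by (intro mult_left_mono) auto
      then show "(\<Sum>l\<in>L. w * \<omega> l) \<le> w" by (simp add: sum_distrib_left)
    qed
    finally show "(\<integral>\<^sup>+y. ennreal (U y) \<partial>M) \<le> ennreal w" .
  next
    fix x y assume "x \<in> A"
    then obtain l where l: "l \<in> L" "x \<in> P l" using cover by blast
    obtain k where k: "2 ^ k \<le> Suc l" "Suc l < 2 ^ (k + 1)" using ex_power_ivl1[of 2 "Suc l"] by auto
    let ?a = "sqrt (ln (1 / w))" and ?u = "lnp (U y)"
    have tu: "v l * W l y + S l y \<le> U y"
      unfolding U_def using term0 L(1) l by (intro member_le_sum) auto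
    have vW: "v l * W l y \<le> U y" using tu S(2)[OF l(1), of y] by linarith
    have SU: "lnp (S l y) \<le> ?u" using tu W0[of l y] v(1)[of l] by (intro lnp_mono) (smt (verit) mult_nonneg_nonneg)
    have vWpos: "0 < v l * W l y" using v by (simp add: W_def)
    \<comment> \<open>Logarithms of \<open>v l * W l y \<le> U y\<close>: the weight costs
      \<open>ln (1 / v l)\<close>, at most \<open>Lq l\<close>, and division by the exponent turns
      \<open>Lq l\<close> into \<open>r * sqrt (Lq l)\<close>.\<close>
    have edge: "X (t l) y - X x0 y \<le> (K + 1) * r * sqrt (Lq l) + r / sqrt q * ?u"
    proof -
      let ?D = "X (t l) y - X x0 y"
      have "ln (v l) + (sqrt (Lq l) / r * ?D + - (K * Lq l)) = ln (v l * W l y)"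
        unfolding W_def exp_add[symmetric] using v(1)[of l] by (simp add: ln_mult)
      also have "\<dots> \<le> ln (U y)" using vW vWpos by simp
      also have "\<dots> \<le> ?u" using vW vWpos by (intro ln_le_lnp) linarith
      finally have "sqrt (Lq l) / r * ?D \<le> ?u + (K + 1) * Lq l"
        using Lq(3)[of l] v(1)[of l] by (simp add: ln_div algebra_simps)
      then have "?D \<le> r / sqrt (Lq l) * (?u + (K + 1) * Lq l)"
        using r Lq(2)[of l] by (simp add: field_simps)
      also have "\<dots> = (K + 1) * r * (Lq l / sqrt (Lq l)) + r / sqrt (Lq l) * ?u"
        by (simp add: algebra_simps add_divide_distrib)
      also have "\<dots> = (K + 1) * r * sqrt (Lq l) + r / sqrt (Lq l) * ?u" using Lq(2)[of l] by (simp add: real_div_sqrt)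
      also have "\<dots> \<le> (K + 1) * r * sqrt (Lq l) + r / sqrt q * ?u"
        using Lq(1)[of l] q r by (intro add_left_mono mult_right_mono divide_left_mono) auto
      finally show ?thesis .
    qed
    have sv: "sqrt (ln (1 / v l)) \<le> ?a + (2 * sqrt k + 2)"
    proof -
      have "1 / v l = (1 / w) * (2 * (real (l + 1) * real (l + 2)))" by (simp add: v_def \<omega>_def)
      moreover have "ln ((1 / w) * (2 * (real (l + 1) * real (l + 2)))) = ln (1 / w) + ln (2 * (real (l + 1) * real (l + 2)))"
        using w by (intro ln_mult_pos) auto
      ultimately have "ln (1 / v l) = ln (1 / w) + ln (2 * (real (l + 1) * real (l + 2)))" by (simp only:)
      then have "sqrt (ln (1 / v l)) \<le> ?a + sqrt (ln (2 * (real (l + 1) * real (l + 2))))"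
      proof -
        have "1 * 1 \<le> real (l + 1) * real (l + 2)" by (intro mult_mono) auto
        then have "0 \<le> ln (2 * (real (l + 1) * real (l + 2)))" by (intro ln_ge_zero) simp
        moreover have "0 \<le> ln (1 / w)" using w by (intro ln_ge_zero) simp
        ultimately show ?thesis using \<open>ln (1 / v l) = _\<close> by (simp only: sqrt_add_le_add_sqrt)
      qed
      also have "\<dots> \<le> ?a + (2 * sqrt k + 2)" using k by (intro add_left_mono sqrt_ln_weight_le) auto
      finally show ?thesis .
    qed
    have sL: "sqrt (Lq l) \<le> sqrt (ln (1 / v l)) + sqrt q"
      unfolding Lq_def using Lq(4)[of l] q by (intro sqrt_add_le_add_sqrt) auto
    \<comment> \<open>The two halves of the potential change places: \<open>P l\<close> lies in a
      ball of radius \<open>r / 8\<close> of \<open>A\<close>, and \<open>growth\<close> bounds its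
      own \<open>gloc\<close> by \<open>g A\<close>.\<close>
    have gP: "g (P l) + gloc (r / 64) (P l) \<le> g A + gloc (r / 8) A - c * (r / 8 * sqrt k)"
    proof -
      have "t l \<in> A" using tP[OF l(1)] PA by auto
      have "g (P l) \<le> g (near (r / 8) A (t l))"
        using l(2) DA[of l] by (intro g_mono finite_subset[OF near_subset A]) (auto simp: P_def near_def)
      also have "\<dots> \<le> gloc (r / 8) A" using A \<open>t l \<in> A\<close> by (rule gloc_ge)
      finally show ?thesis using growth[OF l(1) k(1)] by linarith
    qed
    let ?al = "20 * (K + 1) / c"
    have al: "0 \<le> ?al" using K c by simp
    have "X x y - X x0 y \<le> (K + 1) * r * sqrt (Lq l) + r / sqrt q * ?u +
       (?al * (g (P l) + gloc (r / 64) (P l)) + 2 * (K + 1) * (r / 8) * (sqrt (ln (1 / v l)) + sqrt q + 2) + 2 * (r / 8) / sqrt q * lnp (S l y))"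
      using S(4)[OF l, of y] edge by simp
    also have "\<dots> \<le> (K + 1) * r * (?a + (2 * sqrt k + 2) + sqrt q) + r / sqrt q * ?u +
       (?al * (g A + gloc (r / 8) A - c * (r / 8 * sqrt k)) + 2 * (K + 1) * (r / 8) * (?a + (2 * sqrt k + 2) + sqrt q + 2) + 2 * (r / 8) / sqrt q * ?u)"
      using K r q sv sL by (intro add_mono mult_left_mono[OF gP al] mult_left_mono[OF SU] mult_left_mono[of _ _ "(K + 1) * r"] mult_left_mono[of _ _ "2 * (K + 1) * (r / 8)"] order_refl) auto
    \<comment> \<open>This fixes the constant 20. In units of \<open>(K + 1) * r\<close>, the edge
      costs \<open>2 * sqrt k\<close> and the subtree, of radius \<open>r / 8\<close>, another half
      \<open>sqrt k\<close>; the potential repays 20/8 = 5/2. The other terms acquire a factor 1 +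
      1/4 and a constant 2 + 1, both within the slack of the claim.\<close>
    also have "\<dots> = ?al * (g A + gloc (r / 8) A) + (K + 1) * r * (5 / 4 * (?a + sqrt q) + 3) + (5 / 4) * (r / sqrt q * ?u)"
    proof -
      have "(K + 1) * r * (a + (2 * s + 2) + p) + z + (20 * (K + 1) / c * (G - c * (r / 8 * s)) + 2 * (K + 1) * (r / 8) * (a + (2 * s + 2) + p + 2) + z / 4)
        = 20 * (K + 1) / c * G + (K + 1) * r * (5 / 4 * (a + p) + 3) + 5 / 4 * z" for a s p z G
        using c by (simp add: field_simps)
      moreover have "2 * (r / 8) / sqrt q * ?u = (r / sqrt q * ?u) / 4" by simp
      ultimately show ?thesis by (simp only:)
    qed
    also have "\<dots> \<le> ?al * (g A + gloc (r / 8) A) + (K + 1) * r * (2 * (?a + sqrt q + 2)) + 2 * (r / sqrt q * ?u)"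
    proof (intro add_mono order_refl mult_left_mono)
      have "0 \<le> ?a" "0 \<le> sqrt q" using w q by (auto simp: ln_ge_zero)
      then show "5 / 4 * (?a + sqrt q) + 3 \<le> 2 * (?a + sqrt q + 2)" by argo
      show "5 / 4 * (r / sqrt q * ?u) \<le> 2 * (r / sqrt q * ?u)"
        using r q by (intro mult_right_mono) auto
    qed (use K r in auto)
    finally show "X x y - X x0 y \<le> ?al * (g A + gloc (r / 8) A)
         + 2 * (K + 1) * r * (?a + sqrt q + 2) + 2 * r / sqrt q * ?u" by (simp add: algebra_simps)
  qed
qed

text \<open>The number of scales is absent from the inductive bound, so it may be chosen with
  \<open>r / 8 ^ n\<close> below the least distance in the finite set. Total mass
  \<open>w = 1\<close> removes the logarithm, and \<open>gloc_le\<close> doubles 20 to 40.\<close>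

theorem chaining_bound:
  assumes q: "1 \<le> q" and A: "finite A" "x0 \<in> A" and r: "0 < r" "\<And>x. x \<in> A \<Longrightarrow> d x x0 \<le> r"
    and pos: "\<And>x y. x \<in> A \<Longrightarrow> y \<in> A \<Longrightarrow> x \<noteq> y \<Longrightarrow> 0 < d x y"
  shows "\<exists>S. S \<in> borel_measurable M \<and> (\<forall>y. 0 \<le> S y) \<and> (\<integral>\<^sup>+y. ennreal (S y) \<partial>M) \<le> 1 \<and>
      (\<forall>x\<in>A. \<forall>y. X x y - X x0 y \<le> 40 * (K + 1) / c * g A + 2 * (K + 1) * r * (sqrt q + 2) + 2 * r / sqrt q * lnp (S y))"
proof -
  \<comment> \<open>The extra 1 keeps the set nonempty when \<open>A\<close> has a single
    point.\<close>
  define \<delta> where "\<delta> = Min (insert 1 ((\<lambda>(x, y). d x y) ` {(x, y) \<in> A \<times> A. x \<noteq> y}))"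
  have fin: "finite {(x, y) \<in> A \<times> A. x \<noteq> y}" using A by (auto intro: finite_subset[of _ "A \<times> A"])
  have \<delta>: "0 < \<delta>" unfolding \<delta>_def using fin pos by (subst Min_gr_iff) auto
  have \<delta>_le: "\<delta> \<le> d x y" if "x \<in> A" "y \<in> A" "x \<noteq> y" for x y
    unfolding \<delta>_def using fin that by (intro Min_le) auto
  obtain n where "(1 / 8) ^ n < \<delta> / r" using real_arch_pow_inv[of "\<delta> / r" "1 / 8"] \<delta> r by auto
  then have n: "r / 8 ^ n < \<delta>" using r by (simp add: field_simps power_divide)
  have gl: "gloc (r / 8) A \<le> g A" using A r by (intro gloc_le) auto
  have al: "20 * (K + 1) / c * (g A + gloc (r / 8) A) \<le> 40 * (K + 1) / c * g A"
  proof -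
    have "20 * (K + 1) / c * (g A + gloc (r / 8) A) \<le> 20 * (K + 1) / c * (g A + g A)"
      using gl K c by (intro mult_left_mono) auto
    also have "\<dots> = 40 * (K + 1) / c * g A" using c by (simp add: field_simps)
    finally show ?thesis .
  qed
  obtain S where S: "S \<in> borel_measurable M" "\<forall>y. 0 \<le> S y" "(\<integral>\<^sup>+y. ennreal (S y) \<partial>M) \<le> ennreal 1"
     "\<forall>x\<in>A. \<forall>y. X x y - X x0 y \<le> 20 * (K + 1) / c * (g A + gloc (r / 8) A)
         + 2 * (K + 1) * r * (sqrt (ln (1 / 1)) + sqrt q + 2) + 2 * r / sqrt q * lnp (S y)"
    using chaining_step[OF q A r(2,1), of n 1] n \<delta>_le by (force intro: less_le_trans)
  show ?thesis
  proof (intro exI[of _ S] conjI ballI allI)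
    fix x y assume "x \<in> A"
    then show "X x y - X x0 y \<le> 40 * (K + 1) / c * g A + 2 * (K + 1) * r * (sqrt q + 2) + 2 * r / sqrt q * lnp (S y)"
      using S(4)[rule_format, of x y] al unfolding div_by_1 ln_one real_sqrt_zero add_0_left by linarith
  qed (use S in auto)
qed

end

section \<open>Subgaussian product measures\<close>

text \<open>With \<open>p = exp x + exp (- x)\<close>, which is at least 2, the chain is
  \<open>exp x - x \<le> p - 1 \<le> (p^2 - 2) / 2\<close>, and the last term is
  \<open>cosh (2 * x)\<close>.\<close>

lemma exp_minus_le_cosh: "exp x - x \<le> cosh (2 * x :: real)"
proof -
  define p where "p = exp x + exp (- x)"
  have "0 \<le> (exp x - 1)\<^sup>2 * exp (- x)" by simp
  also have "\<dots> = exp x * (exp x * exp (- x)) - 2 * (exp x * exp (- x)) + exp (- x)"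
    by (simp add: power2_eq_square algebra_simps)
  also have "\<dots> = p - 2" by (simp add: p_def exp_minus)
  finally have p: "2 \<le> p" by simp
  have "exp x - x \<le> p - 1" using exp_ge_add_one_self[of "- x"] by (simp add: p_def)
  also have "\<dots> \<le> (p\<^sup>2 - 2) / 2"
    using mult_right_mono[OF p, of p] p by (simp add: power2_eq_square)
  also have "p\<^sup>2 = exp (2 * x) + exp (- (2 * x)) + 2 * (exp x * exp (- x))"
    unfolding p_def power2_sum by (simp add: exp_double[symmetric] power2_eq_square exp_add[symmetric])
  also have "(exp (2 * x) + exp (- (2 * x)) + 2 * (exp x * exp (- x)) - 2) / 2 = cosh (2 * x)"
    by (simp add: cosh_def exp_minus)
  finally show ?thesis .
qed

lemma fact_mult_power_le: "fact k * k ^ m \<le> (fact (k + m) :: nat)"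
proof (induction m)
  case (Suc m)
  have "fact k * k ^ Suc m = k * (fact k * k ^ m)" by simp
  also have "\<dots> \<le> Suc (k + m) * fact (k + m)" using Suc by (intro mult_mono) auto
  finally show ?case by simp
qed simp

lemma cosh_sums_even: "(\<lambda>k. x ^ (2 * k) / fact (2 * k)) sums cosh (x :: real)"
proof -
  have "strict_mono (\<lambda>k::nat. 2 * k)" by (auto simp: strict_mono_def)
  then have "(\<lambda>k. (\<lambda>n. if even n then x ^ n /\<^sub>R fact n else 0) (2 * k)) sums cosh x"
    by (subst sums_mono_reindex) (use cosh_converges[of x] in \<open>auto elim!: evenE\<close>)
  then show ?thesis by (simp add: divide_inverse mult.commute)
qed

text \<open>Moments growing like \<open>(2 * k) ^ k\<close> are absorbed by half of the factorial,
  since the factors of \<open>(2 * k)!\<close> beyond \<open>k!\<close> all exceed \<open>k\<close>.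
  What is left is a term of an exponential series.\<close>

lemma even_moment_term_le:
  fixes b :: real
  shows "b ^ (2 * k) * (2 * real k) ^ k / fact (2 * k) \<le> (2 * b\<^sup>2) ^ k / fact k"
proof -
  have "real (fact k * k ^ k) \<le> real (fact (2 * k))"
    using fact_mult_power_le[of k k] by (simp only: of_nat_le_iff mult_2)
  then have f: "fact k * real k ^ k \<le> fact (2 * k)" by simp
  have "b ^ (2 * k) * (2 * real k) ^ k / fact (2 * k) = (2 * b\<^sup>2) ^ k * (real k ^ k / fact (2 * k))"
    by (simp add: power_mult power_mult_distrib)
  also have "real k ^ k / fact (2 * k) \<le> 1 / fact k"
    using f by (simp add: divide_simps mult.commute)
  then have "(2 * b\<^sup>2) ^ k * (real k ^ k / fact (2 * k)) \<le> (2 * b\<^sup>2) ^ k * (1 / fact k)"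
    by (intro mult_left_mono) auto
  finally show ?thesis by simp
qed

text \<open>Since \<open>E Z = 0\<close>, the exponential may be replaced by \<open>exp x - x\<close>, which is bounded by an even
 function; so only even moments enter.\<close>

lemma (in prob_space) mgf_of_moments:
  fixes Z :: "'a \<Rightarrow> real"
  assumes m: "\<And>m::nat. 1 \<le> m \<Longrightarrow> integrable M (\<lambda>x. \<bar>Z x\<bar> ^ m)"
    and b: "\<And>m::nat. 1 \<le> m \<Longrightarrow> (\<integral>x. \<bar>Z x\<bar> ^ m \<partial>M) \<le> (B * sqrt m) ^ m"
    and Z: "integrable M Z" "(\<integral>x. Z x \<partial>M) = 0"
  shows "(\<integral>\<^sup>+x. ennreal (exp (h * Z x)) \<partial>M) \<le> ennreal (exp (8 * B\<^sup>2 * h\<^sup>2))"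
proof -
  have [measurable]: "Z \<in> borel_measurable M" using Z by auto
  have "(\<integral>\<^sup>+x. ennreal (cosh (2 * (h * Z x))) \<partial>M)
      = (\<integral>\<^sup>+x. suminf (\<lambda>k. ennreal ((2 * (h * Z x)) ^ (2 * k) / fact (2 * k))) \<partial>M)"
  proof (intro nn_integral_cong)
    fix x
    show "ennreal (cosh (2 * (h * Z x))) = suminf (\<lambda>k. ennreal ((2 * (h * Z x)) ^ (2 * k) / fact (2 * k)))"
      by (rule suminf_ennreal_eq[symmetric, OF _ cosh_sums_even]) (auto simp: power_mult)
  qed
  also have "\<dots> = suminf (\<lambda>k. \<integral>\<^sup>+x. ennreal ((2 * (h * Z x)) ^ (2 * k) / fact (2 * k)) \<partial>M)"
    by (rule nn_integral_suminf) measurable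
  also have "\<dots> \<le> suminf (\<lambda>k. ennreal ((8 * B\<^sup>2 * h\<^sup>2) ^ k / fact k))"
  proof (rule suminf_le)
    fix k :: nat
    show "(\<integral>\<^sup>+x. ennreal ((2 * (h * Z x)) ^ (2 * k) / fact (2 * k)) \<partial>M) \<le> ennreal ((8 * B\<^sup>2 * h\<^sup>2) ^ k / fact k)"
    proof (cases "k = 0")
      case True
      then show ?thesis by (simp add: emeasure_space_1)
    next
      case False
      have e: "(2 * (h * Z x)) ^ (2 * k) / fact (2 * k) = (2 * h) ^ (2 * k) / fact (2 * k) * \<bar>Z x\<bar> ^ (2 * k)" for x
        by (simp add: power_mult_distrib power_mult)
      have nn: "0 \<le> (2 * h) ^ (2 * k) / (fact (2 * k) :: real)" by (simp add: power_mult)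
      have i: "integrable M (\<lambda>x. \<bar>Z x\<bar> ^ (2 * k))" by (rule m) (use False in auto)
      have "(\<integral>\<^sup>+x. ennreal ((2 * (h * Z x)) ^ (2 * k) / fact (2 * k)) \<partial>M)
        = ennreal ((2 * h) ^ (2 * k) / fact (2 * k) * (\<integral>x. \<bar>Z x\<bar> ^ (2 * k) \<partial>M))"
        unfolding e using i nn by (subst nn_integral_eq_integral) auto
      also have "\<dots> \<le> ennreal ((2 * h) ^ (2 * k) / fact (2 * k) * (B * sqrt (real (2 * k))) ^ (2 * k))"
        using b[of "2 * k"] False nn by (intro ennreal_leI mult_left_mono) auto
      also have "(2 * h) ^ (2 * k) / fact (2 * k) * (B * sqrt (real (2 * k))) ^ (2 * k)
        = (2 * h * B) ^ (2 * k) * (2 * real k) ^ k / fact (2 * k)"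
        by (simp add: power_mult_distrib power_mult)
      also have "ennreal \<dots> \<le> ennreal ((2 * (2 * h * B)\<^sup>2) ^ k / fact k)"
        by (intro ennreal_leI even_moment_term_le)
      also have "2 * (2 * h * B)\<^sup>2 = 8 * B\<^sup>2 * h\<^sup>2" by (simp add: power_mult_distrib)
      finally show ?thesis .
    qed
  qed auto
  also have "\<dots> = ennreal (exp (8 * B\<^sup>2 * h\<^sup>2))"
    using exp_converges[of "8 * B\<^sup>2 * h\<^sup>2"] by (intro suminf_ennreal_eq) (auto simp: divide_inverse mult.commute)
  finally have c: "(\<integral>\<^sup>+x. ennreal (cosh (2 * (h * Z x))) \<partial>M) \<le> ennreal (exp (8 * B\<^sup>2 * h\<^sup>2))" .
  \<comment> \<open>The finite bound in \<open>ennreal\<close> gives integrability first of the even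
    function and then, by domination, of the exponential. Only now can the linear term
    \<open>h * Z x\<close> be dropped on account of its zero mean.\<close>
  have ic: "integrable M (\<lambda>x. cosh (2 * (h * Z x)))"
  proof (rule integrableI_bounded)
    show "(\<integral>\<^sup>+x. ennreal (norm (cosh (2 * (h * Z x)))) \<partial>M) < \<infinity>"
      using le_less_trans[OF c ennreal_less_top] by simp
  qed (simp add: cosh_def)
  have ie: "integrable M (\<lambda>x. exp (h * Z x))"
  proof (rule Bochner_Integration.integrable_bound[where f="\<lambda>x. cosh (2 * (h * Z x)) + h * Z x"])
    show "AE x in M. norm (exp (h * Z x)) \<le> norm (cosh (2 * (h * Z x)) + h * Z x)"
    proof (rule AE_I2)
      fix x show "norm (exp (h * Z x)) \<le> norm (cosh (2 * (h * Z x)) + h * Z x)"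
        using exp_minus_le_cosh[of "h * Z x"] by simp
    qed
  qed (use ic Z in auto)
  have "(\<integral>\<^sup>+x. ennreal (exp (h * Z x)) \<partial>M) = ennreal (\<integral>x. exp (h * Z x) \<partial>M)"
    using ie by (intro nn_integral_eq_integral) auto
  also have "\<dots> \<le> ennreal (\<integral>x. cosh (2 * (h * Z x)) + h * Z x \<partial>M)"
  proof (intro ennreal_leI integral_mono ie Bochner_Integration.integrable_add ic integrable_mult_right Z)
    fix x show "exp (h * Z x) \<le> cosh (2 * (h * Z x)) + h * Z x"
      using exp_minus_le_cosh[of "h * Z x"] by simp
  qed
  also have "\<dots> = (\<integral>\<^sup>+x. ennreal (cosh (2 * (h * Z x))) \<partial>M)"
    using ic Z by (subst nn_integral_eq_integral) auto
  also note c
  finally show ?thesis .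
qed

lemma inner_d_measurable [measurable]: "inner_d d v \<in> borel_measurable (borel_d d)"
  unfolding inner_d_def borel_d_def by measurable

text \<open>Zero mean removes the centring from the moment condition; its \<open>m\<close>-th power
  is then the hypothesis of \<open>mgf_of_moments\<close> with
  \<open>B = C0 * s * norm_d d v\<close>.\<close>

lemma subgaussian_mgf:
  assumes P: "subgaussian d s P" "zero_mean d P"
  shows "(\<integral>\<^sup>+y. ennreal (exp (h * inner_d d v y)) \<partial>P) \<le> ennreal (exp (8 * C0\<^sup>2 * (h * s)\<^sup>2 * (norm_d d v)\<^sup>2))"
proof -
  interpret prob_space P using P by (simp add: subgaussian_def)
  have mean: "inner_d d v (x - mean_d P) = inner_d d v x" for x
    using P(2) unfolding inner_d_def zero_mean_def mean_d_def by (intro sum.cong) auto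
  have m: "integrable P (\<lambda>x. \<bar>inner_d d v x\<bar> ^ m)"
    "(\<integral>x. \<bar>inner_d d v x\<bar> ^ m \<partial>P) powr (1 / real m) \<le> C0 * s * sqrt (real m) * norm_d d v" if "1 \<le> m" for m
  proof -
    have "integrable P (\<lambda>x. \<bar>inner_d d v (x - mean_d P)\<bar> ^ m) \<and>
      (\<integral>x. \<bar>inner_d d v (x - mean_d P)\<bar> ^ m \<partial>P) powr (1 / real m) \<le> C0 * s * sqrt (real m) * norm_d d v"
      using P(1) that unfolding subgaussian_def by blast
    then show "integrable P (\<lambda>x. \<bar>inner_d d v x\<bar> ^ m)"
      "(\<integral>x. \<bar>inner_d d v x\<bar> ^ m \<partial>P) powr (1 / real m) \<le> C0 * s * sqrt (real m) * norm_d d v"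
      unfolding mean by auto
  qed
  have b: "(\<integral>x. \<bar>inner_d d v x\<bar> ^ m \<partial>P) \<le> (C0 * s * norm_d d v * sqrt m) ^ m" if "1 \<le> m" for m
  proof -
    let ?I = "\<integral>x. \<bar>inner_d d v x\<bar> ^ m \<partial>P"
    have I: "0 \<le> ?I" by (intro integral_nonneg_AE AE_I2) auto
    have "?I = (?I powr (1 / real m)) ^ m"
      using I that by (cases "?I = 0") (auto simp: powr_realpow[symmetric] powr_powr)
    also have "\<dots> \<le> (C0 * s * sqrt (real m) * norm_d d v) ^ m" using m(2)[OF that] by (intro power_mono) auto
    finally show ?thesis by (simp add: mult_ac)
  qed
  have Z: "integrable P (inner_d d v)" "(\<integral>x. inner_d d v x \<partial>P) = 0"
    unfolding inner_d_def[abs_def] using P(2) by (auto simp: zero_mean_def Bochner_Integration.integral_sum)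
  show ?thesis using mgf_of_moments[OF m(1) b Z, of h] by (simp add: power_mult_distrib mult_ac)
qed

section \<open>Independent samples and the flattened Gaussian array\<close>

definition nlin :: "nat \<Rightarrow> nat \<Rightarrow> (nat \<times> nat \<Rightarrow> real) \<Rightarrow> (nat \<Rightarrow> nat \<Rightarrow> real) \<Rightarrow> real" where
  "nlin n d a y = (\<Sum>i<n. \<Sum>j<d. a (i, j) * y i j)"

abbreviation Idx :: "nat \<Rightarrow> nat \<Rightarrow> (nat \<times> nat) set" where
  "Idx n d \<equiv> {..<n} \<times> {..<d}"

lemma nlin_inner: "nlin n d a y = (\<Sum>i<n. inner_d d (\<lambda>j. a (i, j)) (y i))"
  by (simp add: nlin_def inner_d_def)

lemma nlin_diff: "nlin n d a y - nlin n d b y = nlin n d (\<lambda>k. a k - b k) y"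
  by (simp add: nlin_def left_diff_distrib sum_subtractf)

lemma prod_mono_ennreal:
  fixes f g :: "'i \<Rightarrow> ennreal"
  shows "(\<And>i. i \<in> I \<Longrightarrow> f i \<le> g i) \<Longrightarrow> prod f I \<le> prod g I"
  by (induction I rule: infinite_finite_induct) (auto intro!: mult_mono)

text \<open>Exponential moments of independent rows multiply, and the squared row norms add up to
  the squared norm of the whole coefficient array.\<close>

lemma subgaussian_prod:
  assumes P: "\<And>i. i < n \<Longrightarrow> subgaussian d s (P i) \<and> zero_mean d (P i)"
  shows "prob_space (PiM {..<n} P)" "nlin n d a \<in> borel_measurable (PiM {..<n} P)"
    "(\<integral>\<^sup>+y. ennreal (exp (h * nlin n d a y)) \<partial>PiM {..<n} P)
      \<le> ennreal (exp (8 * C0\<^sup>2 * (h * s)\<^sup>2 * (\<Sum>k\<in>Idx n d. (a k)\<^sup>2)))"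
    "integrable (PiM {..<n} P) (nlin n d a)" "(\<integral>y. nlin n d a y \<partial>PiM {..<n} P) = 0"
proof -
  \<comment> \<open>The product locale asks for a probability measure at every index, so
    \<open>P\<close> is continued beyond \<open>n\<close> by a point mass.\<close>
  define Q where "Q = (\<lambda>i. if i < n then P i else return (borel_d d) (\<lambda>_. undefined))"
  have Qp: "prob_space (Q i)" for i
    using P[of i] by (auto simp: Q_def subgaussian_def borel_d_def space_PiM intro!: prob_space_return)
  have PQ: "PiM {..<n} P = PiM {..<n} Q" by (intro PiM_cong) (auto simp: Q_def)
  interpret Q: product_prob_space Q "{..<n}" by (intro product_prob_spaceI Qp)
  have sQ [measurable_cong]: "i < n \<Longrightarrow> sets (Q i) = sets (borel_d d)" for i
    using P[of i] by (auto simp: Q_def subgaussian_def)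
  have inner [measurable]: "i < n \<Longrightarrow> inner_d d v \<in> borel_measurable (Q i)" for i v
    using inner_d_measurable measurable_cong_sets[OF sQ refl] by blast
  show "prob_space (PiM {..<n} P)" unfolding PQ by (rule prob_space_PiM[OF Qp])
  show m: "nlin n d a \<in> borel_measurable (PiM {..<n} P)"
    unfolding PQ nlin_inner[abs_def] by measurable
  have comp: "integrable (PiM {..<n} Q) (\<lambda>y. y i j) \<and> (\<integral>y. y i j \<partial>PiM {..<n} Q) = 0" if ij: "i < n" "j < d" for i j
  proof -
    have d: "distr (PiM {..<n} Q) (Q i) (\<lambda>y. y i) = Q i" using ij by (intro Q.PiM_component) auto
    have z: "integrable (Q i) (\<lambda>x. x j)" "(\<integral>x. x j \<partial>Q i) = 0"
      using P[OF ij(1)] ij by (auto simp: Q_def zero_mean_def)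
    have mm: "(\<lambda>x. x j) \<in> borel_measurable (Q i)" using z by auto
    have "integrable (distr (PiM {..<n} Q) (Q i) (\<lambda>y. y i)) (\<lambda>x. x j)" "(\<integral>x. x j \<partial>distr (PiM {..<n} Q) (Q i) (\<lambda>y. y i)) = 0"
      unfolding d by (fact z)+
    then show ?thesis
      using ij mm by (simp add: integrable_distr_eq integral_distr)
  qed
  show "integrable (PiM {..<n} P) (nlin n d a)"
    unfolding PQ nlin_def[abs_def] using comp
    by (intro Bochner_Integration.integrable_sum integrable_mult_right) auto
  show "(\<integral>y. nlin n d a y \<partial>PiM {..<n} P) = 0"
    unfolding PQ nlin_def[abs_def] using comp
    by (subst Bochner_Integration.integral_sum) (auto intro!: Bochner_Integration.integrable_sum simp: Bochner_Integration.integral_sum)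
  have "(\<integral>\<^sup>+y. ennreal (exp (h * nlin n d a y)) \<partial>PiM {..<n} P)
     = (\<integral>\<^sup>+y. (\<Prod>i<n. ennreal (exp (h * inner_d d (\<lambda>j. a (i, j)) (y i)))) \<partial>PiM {..<n} Q)"
    unfolding PQ by (intro nn_integral_cong) (simp add: nlin_inner sum_distrib_left exp_sum prod_ennreal)
  also have "\<dots> = (\<Prod>i<n. \<integral>\<^sup>+y. ennreal (exp (h * inner_d d (\<lambda>j. a (i, j)) y)) \<partial>Q i)"
    by (rule Q.product_nn_integral_prod) auto
  also have "\<dots> \<le> (\<Prod>i<n. ennreal (exp (8 * C0\<^sup>2 * (h * s)\<^sup>2 * (norm_d d (\<lambda>j. a (i, j)))\<^sup>2)))"
  proof (rule prod_mono_ennreal)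
    fix i assume "i \<in> {..<n}"
    then show "(\<integral>\<^sup>+y. ennreal (exp (h * inner_d d (\<lambda>j. a (i, j)) y)) \<partial>Q i)
      \<le> ennreal (exp (8 * C0\<^sup>2 * (h * s)\<^sup>2 * (norm_d d (\<lambda>j. a (i, j)))\<^sup>2))"
      using P[of i] by (simp add: Q_def subgaussian_mgf)
  qed
  also have "\<dots> = ennreal (exp (\<Sum>i<n. 8 * C0\<^sup>2 * (h * s)\<^sup>2 * (norm_d d (\<lambda>j. a (i, j)))\<^sup>2))"
    by (simp add: prod_ennreal exp_sum)
  also have "(\<Sum>i<n. 8 * C0\<^sup>2 * (h * s)\<^sup>2 * (norm_d d (\<lambda>j. a (i, j)))\<^sup>2) = 8 * C0\<^sup>2 * (h * s)\<^sup>2 * (\<Sum>k\<in>Idx n d. (a k)\<^sup>2)"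
    unfolding sum_distrib_left[symmetric] sum.cartesian_product[symmetric] norm_d_def inner_d_def
    by (intro arg_cong2[where f="(*)"] sum.cong refl) (simp add: sum_nonneg power2_eq_square sum.cartesian_product)
  finally show "(\<integral>\<^sup>+y. ennreal (exp (h * nlin n d a y)) \<partial>PiM {..<n} P)
      \<le> ennreal (exp (8 * C0\<^sup>2 * (h * s)\<^sup>2 * (\<Sum>k\<in>Idx n d. (a k)\<^sup>2)))" .
qed

text \<open>The samples form an iterated product, whereas \<open>gwidth\<close> lives on one flat
  product over pairs. Uncurrying carries one to the other, since the measures agree on
  rectangles.\<close>

lemma nested_gauss:
  fixes n d :: nat
  defines "u \<equiv> \<lambda>y::nat \<Rightarrow> nat \<Rightarrow> real. \<lambda>(i, j)\<in>Idx n d. y i j"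
  shows "distr (PiM {..<n} (\<lambda>_. gauss_d d)) (gauss (Idx n d)) u = gauss (Idx n d)"
    "u \<in> measurable (PiM {..<n} (\<lambda>_. gauss_d d)) (gauss (Idx n d))"
proof -
  show m: "u \<in> measurable (PiM {..<n} (\<lambda>_. gauss_d d)) (gauss (Idx n d))"
    unfolding u_def gauss_d_def split_beta
  proof (intro measurable_restrict)
    fix k :: "nat \<times> nat" assume k: "k \<in> Idx n d"
    have "(\<lambda>y. y (fst k)) \<in> measurable (PiM {..<n} (\<lambda>_. gauss {..<d})) (gauss {..<d})"
      using k by (intro measurable_component_singleton) auto
    moreover have "(\<lambda>x. x (snd k)) \<in> measurable (gauss {..<d}) std_normal"
      using k by (intro measurable_component_singleton) auto
    ultimately show "(\<lambda>y. y (fst k) (snd k)) \<in> measurable (PiM {..<n} (\<lambda>_. gauss {..<d})) std_normal"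
      by (rule measurable_compose)
  qed
  interpret g: product_prob_space "\<lambda>_. gauss_d d"
    by (intro product_prob_spaceI) (simp add: gauss_d_def prob_space_gauss)
  show "distr (PiM {..<n} (\<lambda>_. gauss_d d)) (gauss (Idx n d)) u = gauss (Idx n d)"
  proof (rule std_normal_prod.PiM_eqI)
    fix A :: "nat \<times> nat \<Rightarrow> real set" assume A: "\<And>k. k \<in> Idx n d \<Longrightarrow> A k \<in> sets std_normal"
    have "u -` (Pi\<^sub>E (Idx n d) A) \<inter> space (PiM {..<n} (\<lambda>_. gauss_d d)) = Pi\<^sub>E {..<n} (\<lambda>i. Pi\<^sub>E {..<d} (\<lambda>j. A (i, j)))"
      by (auto simp: u_def gauss_d_def space_PiM PiE_iff extensional_def)
    moreover have "Pi\<^sub>E (Idx n d) A \<in> sets (gauss (Idx n d))" using A by (intro sets_PiM_I_finite) auto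
    ultimately have "emeasure (distr (PiM {..<n} (\<lambda>_. gauss_d d)) (gauss (Idx n d)) u) (Pi\<^sub>E (Idx n d) A)
      = emeasure (PiM {..<n} (\<lambda>_. gauss_d d)) (Pi\<^sub>E {..<n} (\<lambda>i. Pi\<^sub>E {..<d} (\<lambda>j. A (i, j))))"
      using m by (simp add: emeasure_distr)
    also have "\<dots> = (\<Prod>i<n. emeasure (gauss_d d) (Pi\<^sub>E {..<d} (\<lambda>j. A (i, j))))"
      using A by (intro g.emeasure_PiM) (auto simp: gauss_d_def intro!: sets_PiM_I_finite)
    also have "\<dots> = (\<Prod>i<n. \<Prod>j<d. emeasure std_normal (A (i, j)))"
      unfolding gauss_d_def using A by (intro prod.cong refl std_normal_prod.emeasure_PiM) auto
    also have "\<dots> = (\<Prod>k\<in>Idx n d. emeasure std_normal (A k))"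
      by (simp add: prod.cartesian_product)
    finally show "emeasure (distr (PiM {..<n} (\<lambda>_. gauss_d d)) (gauss (Idx n d)) u) (Pi\<^sub>E (Idx n d) A)
      = (\<Prod>k\<in>Idx n d. emeasure std_normal (A k))" .
  qed auto
qed

lemma nested_gauss_facts:
  fixes n d :: nat
  defines "G \<equiv> PiM {..<n} (\<lambda>_. gauss_d d)"
  shows "prob_space G" "nlin n d a \<in> borel_measurable G" "integrable G (nlin n d a)" "(\<integral>y. nlin n d a y \<partial>G) = 0"
    "finite A \<Longrightarrow> A \<noteq> {} \<Longrightarrow> integrable G (\<lambda>y. Max ((\<lambda>x. nlin n d x y) ` A))"
    "finite A \<Longrightarrow> A \<noteq> {} \<Longrightarrow> (\<integral>y. Max ((\<lambda>x. nlin n d x y) ` A) \<partial>G) = gwidth (Idx n d) A"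
proof -
  define u where "u = (\<lambda>y::nat \<Rightarrow> nat \<Rightarrow> real. \<lambda>(i, j)\<in>Idx n d. y i j)"
  have D: "distr G (gauss (Idx n d)) u = gauss (Idx n d)" and [measurable]: "u \<in> measurable G (gauss (Idx n d))"
    unfolding G_def u_def by (rule nested_gauss)+
  have L: "nlin n d a y = lin (Idx n d) a (u y)" for a y
    unfolding nlin_def lin_def u_def by (simp add: sum.cartesian_product) (auto intro!: sum.cong)
  show "prob_space G" unfolding G_def by (intro prob_space_PiM) (simp add: gauss_d_def prob_space_gauss)
  show "nlin n d a \<in> borel_measurable G" unfolding L[abs_def] by measurable
  have tr: "integrable G (\<lambda>y. f (u y))" "(\<integral>y. f (u y) \<partial>G) = (\<integral>w. f w \<partial>gauss (Idx n d))"
    if "integrable (gauss (Idx n d)) f" for f :: "_ \<Rightarrow> real"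
  proof -
    have "integrable (distr G (gauss (Idx n d)) u) f" using that by (simp add: D)
    then show "integrable G (\<lambda>y. f (u y))" by (subst (asm) integrable_distr_eq) (use that in auto)
    have "(\<integral>w. f w \<partial>distr G (gauss (Idx n d)) u) = (\<integral>y. f (u y) \<partial>G)"
      by (rule integral_distr) (use that in auto)
    then show "(\<integral>y. f (u y) \<partial>G) = (\<integral>w. f w \<partial>gauss (Idx n d))" by (simp add: D)
  qed
  have f: "finite (Idx n d)" by simp
  show "integrable G (nlin n d a)" "(\<integral>y. nlin n d a y \<partial>G) = 0"
    unfolding L[abs_def] using tr[OF integrable_lin[OF f, of a]] integral_lin[OF f, of a] by auto
  assume A: "finite A" "A \<noteq> {}"
  show "integrable G (\<lambda>y. Max ((\<lambda>x. nlin n d x y) ` A))" "(\<integral>y. Max ((\<lambda>x. nlin n d x y) ` A) \<partial>G) = gwidth (Idx n d) A"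
    unfolding L gwidth_def using tr[OF integrable_Max_lin'[OF f A]] by auto
qed

section \<open>Pseudoexpectations of linear forms\<close>

lemma mdeg_superset: "finite K \<Longrightarrow> Poly_Mapping.keys m \<subseteq> K \<Longrightarrow> mdeg m = (\<Sum>x\<in>K. Poly_Mapping.lookup m x)"
  unfolding mdeg_def by (rule sum.mono_neutral_left) (auto simp: in_keys_iff)

lemma mdeg_add: "mdeg (a + b) = mdeg a + mdeg b"
proof -
  let ?K = "Poly_Mapping.keys a \<union> Poly_Mapping.keys b"
  have "mdeg (a + b) = (\<Sum>x\<in>?K. Poly_Mapping.lookup (a + b) x)"
    by (rule mdeg_superset) (use Poly_Mapping.keys_add[of a b] in auto)
  then show ?thesis
    using mdeg_superset[of ?K a] mdeg_superset[of ?K b] by (simp add: lookup_add sum.distrib)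
qed

text \<open>Bundles the side conditions of \<open>pseudoexp\<close> in a form that can be read off
  monomial by monomial, so that closure under sums and products follows from bounds on
  \<open>keys\<close>.\<close>

definition poly_in :: "(nat + nat) set \<Rightarrow> nat \<Rightarrow> mpoly \<Rightarrow> bool" where
  "poly_in V t p \<longleftrightarrow> pvars p \<subseteq> V \<and> pdeg p \<le> t"

lemma poly_in_iff: "poly_in V t p \<longleftrightarrow> (\<forall>m\<in>Poly_Mapping.keys p. Poly_Mapping.keys m \<subseteq> V \<and> mdeg m \<le> t)"
  unfolding poly_in_def pvars_def pdeg_def by auto

lemma poly_in_mono: "poly_in V t p \<Longrightarrow> t \<le> u \<Longrightarrow> poly_in V u p"
  by (auto simp: poly_in_def)

lemma poly_in_zero: "poly_in V t 0"
  by (simp add: poly_in_iff)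

lemma poly_in_add: "poly_in V t p \<Longrightarrow> poly_in V t q \<Longrightarrow> poly_in V t (p + q)"
  unfolding poly_in_iff using Poly_Mapping.keys_add[of p q] by blast

lemma poly_in_mult: "poly_in V t p \<Longrightarrow> poly_in V u q \<Longrightarrow> poly_in V (t + u) (p * q)"
  unfolding poly_in_iff
proof
  assume pq: "\<forall>m\<in>Poly_Mapping.keys p. Poly_Mapping.keys m \<subseteq> V \<and> mdeg m \<le> t" "\<forall>m\<in>Poly_Mapping.keys q. Poly_Mapping.keys m \<subseteq> V \<and> mdeg m \<le> u"
  fix m assume "m \<in> Poly_Mapping.keys (p * q)"
  then obtain a b where ab: "a \<in> Poly_Mapping.keys p" "b \<in> Poly_Mapping.keys q" "m = a + b"
    using keys_mult[of p q] by auto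
  then have "Poly_Mapping.keys m \<subseteq> V" using pq Poly_Mapping.keys_add[of a b] by blast
  moreover have "mdeg m \<le> t + u" using ab pq by (auto simp: mdeg_add intro!: add_mono)
  ultimately show "Poly_Mapping.keys m \<subseteq> V \<and> mdeg m \<le> t + u" ..
qed

lemma poly_in_pconst: "poly_in V t (pconst c)"
  by (auto simp: poly_in_iff pconst_def mdeg_def split: if_splits)

lemma poly_in_pvar: "x \<in> V \<Longrightarrow> poly_in V 1 (pvar x)"
  by (auto simp: poly_in_iff pvar_def mdeg_def)

lemma poly_in_sum: "(\<And>i. i \<in> I \<Longrightarrow> poly_in V t (f i)) \<Longrightarrow> poly_in V t (\<Sum>i\<in>I. f i)"
  by (induction I rule: infinite_finite_induct) (auto intro: poly_in_add poly_in_zero)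

context
  fixes V :: "(nat + nat) set" and t :: nat and E :: "mpoly \<Rightarrow> real"
  assumes E: "pseudoexp V t E"
begin

lemma pseudoexp_add: "poly_in V t p \<Longrightarrow> poly_in V t q \<Longrightarrow> E (p + q) = E p + E q"
  using E unfolding pseudoexp_def poly_in_def by blast

lemma pseudoexp_scale: "poly_in V t p \<Longrightarrow> E (pconst c * p) = c * E p"
  using E unfolding pseudoexp_def poly_in_def by blast

lemma pseudoexp_zero: "E 0 = 0"
  using pseudoexp_scale[OF poly_in_zero, of 0] by simp

lemma pseudoexp_sum: "(\<And>i. i \<in> I \<Longrightarrow> poly_in V t (f i)) \<Longrightarrow> E (\<Sum>i\<in>I. f i) = (\<Sum>i\<in>I. E (f i))"
  by (induction I rule: infinite_finite_induct) (auto simp: pseudoexp_zero pseudoexp_add poly_in_sum)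

lemma pseudoexp_lin_v:
  assumes p: "\<And>i. i < n \<Longrightarrow> pvars (p i) \<subseteq> V \<and> pdeg (p i) < t - 1" and V: "Inr ` {..<d} \<subseteq> V"
  shows "E (pconst c * (\<Sum>i<n. p i * lin_v d (y i)))
    = (\<Sum>i<n. \<Sum>j<d. y i j * E (pconst c * p i * pvar (Inr j)))"
proof -
  have in1: "poly_in V t (pconst c * p i * pvar (Inr j))" if "i < n" "j < d" for i j
  proof -
    \<comment> \<open>Under truncated subtraction \<open>pdeg (p i) < t - 1\<close> forces
      \<open>t \<ge> 2\<close>, hence degree at most \<open>t - 2\<close>; one more variable keeps
      the product within degree \<open>t\<close>.\<close>
    have "poly_in V (0 + (t - 2) + 1) (pconst c * p i * pvar (Inr j))"
      using p[OF that(1)] V that(2)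
      by (intro poly_in_mult poly_in_pconst poly_in_pvar) (auto simp: poly_in_def)
    then show ?thesis using p[OF that(1)] by (elim poly_in_mono) auto
  qed
  have in2: "poly_in V t (pconst a * (pconst c * p i * pvar (Inr j)))" if "i < n" "j < d" for i j a
    using poly_in_mult[OF poly_in_pconst[of V 0 a] in1[OF that]] by simp
  have "pconst c * (\<Sum>i<n. p i * lin_v d (y i)) = (\<Sum>i<n. \<Sum>j<d. pconst (y i j) * (pconst c * p i * pvar (Inr j)))"
    unfolding lin_v_def sum_distrib_left by (intro sum.cong refl) (simp add: mult_ac)
  then have "E (pconst c * (\<Sum>i<n. p i * lin_v d (y i))) = E (\<Sum>i<n. \<Sum>j<d. pconst (y i j) * (pconst c * p i * pvar (Inr j)))"
    by (simp only:)
  also have "\<dots> = (\<Sum>i<n. E (\<Sum>j<d. pconst (y i j) * (pconst c * p i * pvar (Inr j))))"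
    by (rule pseudoexp_sum) (auto intro!: poly_in_sum in2)
  also have "\<dots> = (\<Sum>i<n. \<Sum>j<d. E (pconst (y i j) * (pconst c * p i * pvar (Inr j))))"
    by (intro sum.cong refl pseudoexp_sum) (auto intro!: in2)
  also have "\<dots> = (\<Sum>i<n. \<Sum>j<d. y i j * E (pconst c * p i * pvar (Inr j)))"
    by (intro sum.cong refl pseudoexp_scale) (auto intro!: in1)
  finally show ?thesis .
qed

end

text \<open>Integer and real powers agree in absolute value, so the denominators in
  \<open>Sfun\<close> are the absolute values of those in \<open>Ffun\<close>.\<close>

lemma abs_gpow: "\<bar>gpow x a\<bar> = \<bar>x\<bar> powr a"
proof (cases "x < 0 \<and> a \<in> \<int>")
  case True
  then obtain k where k: "a = of_int k" by (auto elim: Ints_cases)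
  have "\<bar>x powi k\<bar> = \<bar>x\<bar> powi k" by (simp add: power_int_abs)
  then show ?thesis using True k by (simp add: gpow_def powr_real_of_int')
qed (auto simp: gpow_def)

section \<open>Suprema of linear functionals\<close>

text \<open>The coefficient functions form a second countable space and \<open>nlin n d a y\<close>
  is continuous in \<open>a\<close>, so one countable subset gives the right supremum for every
  \<open>y\<close> at once. Maxima over prefixes of its enumeration increase, which later yields
  measurability and monotone convergence.\<close>

lemma nlin_countable_reduction:
  fixes \<A> :: "(nat \<times> nat \<Rightarrow> real) set"
  assumes a0: "a0 \<in> \<A>"
  obtains b :: "nat \<Rightarrow> nat \<times> nat \<Rightarrow> real" where "b 0 = a0" "range b \<subseteq> \<A>"
    "\<And>y. (SUP a\<in>\<A>. ereal (nlin n d a y)) = (SUP m. ereal (Max ((\<lambda>x. nlin n d x y) ` b ` {..m})))"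
proof -
  obtain B :: "(nat \<times> nat \<Rightarrow> real) set set" where B: "countable B" "topological_basis B"
    using ex_countable_basis by blast
  define pick where "pick = (\<lambda>U. SOME x. x \<in> U \<inter> \<A>)"
  have pick: "pick U \<in> U \<inter> \<A>" if "U \<inter> \<A> \<noteq> {}" for U
    unfolding pick_def by (rule someI_ex[of "\<lambda>x. x \<in> U \<inter> \<A>"]) (use that in blast)
  define D where "D = insert a0 (pick ` {U\<in>B. U \<inter> \<A> \<noteq> {}})"
  have D: "countable D" "D \<subseteq> \<A>" "D \<noteq> {}" unfolding D_def using B(1) a0 pick by auto
  define b where "b = case_nat a0 (from_nat_into D)"
  have b0: "b 0 = a0" by (simp add: b_def)
  have "b m \<in> \<A>" for m
    using a0 D(2) from_nat_into[OF D(3)] by (cases m) (auto simp: b_def)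
  then have ran: "range b \<subseteq> \<A>" by blast
  have Db: "D \<subseteq> range b"
  proof
    fix x assume "x \<in> D"
    then obtain m where "x = from_nat_into D m" using from_nat_into_surj[OF D(1)] by metis
    then have "x = b (Suc m)" by (simp add: b_def)
    then show "x \<in> range b" by blast
  qed
  have "(SUP a\<in>\<A>. ereal (nlin n d a y)) = (SUP m. ereal (Max ((\<lambda>x. nlin n d x y) ` b ` {..m})))" for y
  proof (rule antisym)
    show "(SUP a\<in>\<A>. ereal (nlin n d a y)) \<le> (SUP m. ereal (Max ((\<lambda>x. nlin n d x y) ` b ` {..m})))"
    proof (rule SUP_least)
      fix a assume a: "a \<in> \<A>"
      show "ereal (nlin n d a y) \<le> (SUP m. ereal (Max ((\<lambda>x. nlin n d x y) ` b ` {..m})))"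
      proof (rule ereal_le_epsilon2)
        fix e :: real assume e: "0 < e"
        let ?O = "{x. nlin n d a y - e < nlin n d x y}"
        have "continuous_on UNIV (\<lambda>x::nat \<times> nat \<Rightarrow> real. nlin n d x y)"
          unfolding nlin_def by (intro continuous_intros continuous_on_product_coordinates)
        then have "open ?O" by (intro open_Collect_less continuous_intros)
        then obtain U where U: "U \<in> B" "a \<in> U" "U \<subseteq> ?O"
          using topological_basisE[OF B(2), of ?O a] e by auto
        then have "U \<inter> \<A> \<noteq> {}" using a by blast
        then have "pick U \<in> D" "pick U \<in> ?O" using U pick[of U] by (auto simp: D_def)
        then obtain m where m: "b m \<in> ?O" using Db by auto
        have "nlin n d (b m) y \<le> Max ((\<lambda>x. nlin n d x y) ` b ` {..m})" by (intro Max_ge) auto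
        moreover have "nlin n d a y - e < nlin n d (b m) y" using m by simp
        ultimately have "nlin n d a y \<le> Max ((\<lambda>x. nlin n d x y) ` b ` {..m}) + e" by linarith
        then have "ereal (nlin n d a y) \<le> ereal (Max ((\<lambda>x. nlin n d x y) ` b ` {..m})) + ereal e"
          by (simp only: plus_ereal.simps ereal_less_eq)
        also have "\<dots> \<le> (SUP m. ereal (Max ((\<lambda>x. nlin n d x y) ` b ` {..m}))) + ereal e"
          by (intro add_right_mono SUP_upper) simp
        finally show "ereal (nlin n d a y) \<le> (SUP m. ereal (Max ((\<lambda>x. nlin n d x y) ` b ` {..m}))) + ereal e" .
      qed
    qed
    show "(SUP m. ereal (Max ((\<lambda>x. nlin n d x y) ` b ` {..m}))) \<le> (SUP a\<in>\<A>. ereal (nlin n d a y))"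
    proof (rule SUP_least)
      fix m
      obtain x where "x \<in> b ` {..m}" "Max ((\<lambda>x. nlin n d x y) ` b ` {..m}) = nlin n d x y"
        by (rule Max_image_attained[of "b ` {..m}" "\<lambda>x. nlin n d x y"]) auto
      then show "ereal (Max ((\<lambda>x. nlin n d x y) ` b ` {..m})) \<le> (SUP a\<in>\<A>. ereal (nlin n d a y))"
        using ran by (auto intro!: SUP_upper)
    qed
  qed
  with b0 ran show ?thesis by (rule that)
qed

text \<open>\<open>V\<close> may have infinite integral, so the expectation cannot be split inside
  the Bochner integral. The negative part of \<open>F\<close> is dominated by that of
  \<open>Z\<close>, hence has finite integral, and \<open>eexpect\<close> is a legitimate
  difference.\<close>

lemma eexpect_centered:
  fixes F :: "'a \<Rightarrow> ereal" and V :: "'a \<Rightarrow> ennreal" and Z :: "'a \<Rightarrow> real"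
  assumes V [measurable]: "V \<in> borel_measurable M" and Z: "integrable M Z" "(\<integral>y. Z y \<partial>M) = 0"
    and F: "\<And>y. F y = ereal (Z y) + enn2ereal (V y)"
  shows "eexpect M F = enn2ereal (\<integral>\<^sup>+y. V y \<partial>M)"
proof -
  have [measurable]: "Z \<in> borel_measurable M" using Z by auto
  have [measurable]: "F \<in> borel_measurable M" unfolding F[abs_def] by measurable
  \<comment> \<open>Positive and negative parts, rearranged so that no subtraction occurs; this is
    valid in \<open>ennreal\<close> also when \<open>V y\<close> is infinite.\<close>
  have pt: "e2ennreal (F y) + ennreal (- Z y) = V y + (e2ennreal (- F y) + ennreal (Z y))" for y
  proof (cases "V y" rule: ennreal_cases)
    case (real r)
    then have "F y = ereal (Z y + r)" by (simp add: F enn2ereal_ennreal)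
    then have "e2ennreal (F y) = ennreal (Z y + r)" "e2ennreal (- F y) = ennreal (- (Z y + r))"
      by (simp_all add: ennreal.abs_eq[symmetric] e2ennreal_ereal)
    then show ?thesis using real
      by (cases "0 \<le> Z y"; cases "0 \<le> Z y + r") (auto simp: ennreal_plus[symmetric] ennreal_neg simp del: ennreal_plus)
  next
    case top
    then have "F y = \<infinity>" by (simp add: F)
    then show ?thesis using top by simp
  qed
  have Z': "(\<integral>\<^sup>+y. ennreal (Z y) \<partial>M) = (\<integral>\<^sup>+y. ennreal (- Z y) \<partial>M)" "(\<integral>\<^sup>+y. ennreal (- Z y) \<partial>M) \<noteq> \<infinity>"
  proof -
    have fin: "(\<integral>\<^sup>+y. ennreal (Z y) \<partial>M) \<noteq> \<infinity>" "(\<integral>\<^sup>+y. ennreal (- Z y) \<partial>M) \<noteq> \<infinity>"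
      using Z(1) by (auto simp: real_integrable_def)
    have "enn2real (\<integral>\<^sup>+y. ennreal (Z y) \<partial>M) = enn2real (\<integral>\<^sup>+y. ennreal (- Z y) \<partial>M)"
      using Z by (simp add: real_lebesgue_integral_def)
    then show "(\<integral>\<^sup>+y. ennreal (Z y) \<partial>M) = (\<integral>\<^sup>+y. ennreal (- Z y) \<partial>M)" using fin
      by (cases "\<integral>\<^sup>+y. ennreal (Z y) \<partial>M" rule: ennreal_cases; cases "\<integral>\<^sup>+y. ennreal (- Z y) \<partial>M" rule: ennreal_cases) auto
    show "(\<integral>\<^sup>+y. ennreal (- Z y) \<partial>M) \<noteq> \<infinity>" by (fact fin)
  qed
  let ?p = "\<integral>\<^sup>+y. e2ennreal (F y) \<partial>M" and ?m = "\<integral>\<^sup>+y. e2ennreal (- F y) \<partial>M" and ?z = "\<integral>\<^sup>+y. ennreal (- Z y) \<partial>M"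
  have "?p + ?z = (\<integral>\<^sup>+y. e2ennreal (F y) + ennreal (- Z y) \<partial>M)" by (simp add: nn_integral_add)
  also have "\<dots> = (\<integral>\<^sup>+y. V y \<partial>M) + (?m + ?z)" unfolding pt by (simp add: nn_integral_add Z'(1))
  finally have "?z + ?p = ?z + ((\<integral>\<^sup>+y. V y \<partial>M) + ?m)" by (simp add: ac_simps)
  then have eq: "?p = (\<integral>\<^sup>+y. V y \<partial>M) + ?m"
    using Z'(2) unfolding ennreal_add_left_cancel by blast
  have "?m \<le> ?z"
  proof (rule nn_integral_mono)
    fix y
    have "ereal (Z y) \<le> F y" unfolding F by (cases "V y" rule: ennreal_cases) (auto simp: enn2ereal_ennreal)
    then have "- F y \<le> - ereal (Z y)" by (simp only: ereal_minus_le_minus)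
    then have "e2ennreal (- F y) \<le> e2ennreal (ereal (- Z y))" by (intro e2ennreal_mono) simp
    then show "e2ennreal (- F y) \<le> ennreal (- Z y)" by (simp only: e2ennreal_ereal)
  qed
  then have "?m \<noteq> \<infinity>" using Z'(2) by (auto simp: top_unique)
  then show ?thesis unfolding eexpect_def eq
    by (cases ?m rule: ennreal_cases; cases "\<integral>\<^sup>+y. V y \<partial>M" rule: ennreal_cases)
       (auto simp: plus_ennreal.rep_eq enn2ereal_ennreal)
qed

section \<open>Powers of extended nonnegative reals\<close>

lemma SUP_power_ennreal_le:
  fixes f :: "nat \<Rightarrow> ennreal"
  assumes f: "incseq f"
  shows "(SUP m. f m) ^ q \<le> (SUP m. f m ^ q)"
proof (induction q)
  case (Suc q)
  have "(SUP m. f m) ^ Suc q \<le> (SUP m. f m) * (SUP m. f m ^ q)"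
    using Suc by (simp add: mult_left_mono)
  also have "\<dots> = (SUP m. SUP k. f m * f k ^ q)"
    by (subst SUP_mult_right_ennreal) (simp only: SUP_mult_left_ennreal)
  also have "\<dots> \<le> (SUP m. f m ^ Suc q)"
  proof (intro SUP_least)
    fix m k
    \<comment> \<open>Monotonicity moves both indices to their maximum, so the double supremum is
      controlled by the diagonal.\<close>
    have "f m * f k ^ q \<le> f (max m k) * f (max m k) ^ q"
      by (intro mult_mono power_mono_ennreal incseqD[OF f]) auto
    also have "\<dots> \<le> (SUP m. f m ^ Suc q)" by (intro SUP_upper2[of "max m k"]) auto
    finally show "f m * f k ^ q \<le> (SUP m. f m ^ Suc q)" .
  qed
  finally show ?case .
qed simp

lemma ennreal_power_add_le:
  fixes a b :: ennreal
  shows "(a + b) ^ q \<le> 2 ^ q * (a ^ q + b ^ q)"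
proof -
  have "(a + b) ^ q \<le> (2 * max a b) ^ q"
    by (intro power_mono_ennreal) (auto simp: mult_2 intro!: add_mono)
  also have "\<dots> = 2 ^ q * (max a b) ^ q" by (simp add: power_mult_distrib)
  also have "\<dots> \<le> 2 ^ q * (a ^ q + b ^ q)"
    by (intro mult_left_mono) (auto simp: max_def)
  finally show ?thesis .
qed

lemma ennreal_add_power_le:
  fixes a b :: ennreal
  assumes "1 \<le> q"
  shows "a ^ q + b ^ q \<le> (a + b) ^ q"
proof -
  obtain k where q: "q = Suc k" using assms by (cases q) auto
  have "a ^ Suc k + b ^ Suc k \<le> a * (a + b) ^ k + b * (a + b) ^ k"
    unfolding power_Suc by (intro add_mono mult_left_mono power_mono_ennreal) auto
  then show ?thesis by (simp add: q distrib_right)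
qed

lemma ennreal_power_double: "0 \<le> c \<Longrightarrow> ennreal (c ^ q) * 2 ^ q = ennreal (2 * c) ^ q"
  by (simp add: ennreal_mult power_mult_distrib ennreal_power mult.commute)

lemma le_exp_power:
  fixes z :: real
  assumes "0 \<le> z"
  shows "(1 + z) ^ q \<le> exp (real q * z)"
proof -
  have "(1 + z) ^ q \<le> exp z ^ q" using assms exp_ge_add_one_self[of z] by (intro power_mono) auto
  then show ?thesis by (simp add: exp_of_nat_mult)
qed

text \<open>The growth constant of the Gaussian side; \<open>mgf_const\<close> is its counterpart
  for the subgaussian side. Both are free of \<open>n\<close>, \<open>d\<close> and
  \<open>s\<close>.\<close>

definition width_const :: real where "width_const = (\<integral>x. \<bar>x\<bar> \<partial>std_normal) / 3"
definition mgf_const :: real where "mgf_const = 8 * C0\<^sup>2"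

lemma width_const_pos: "0 < width_const"
  using integral_std_normal_abs_pos by (simp add: width_const_def)

lemma mgf_const_nonneg: "0 \<le> mgf_const"
  by (simp add: mgf_const_def)

section \<open>Moment bounds under the subgaussian law\<close>

locale subgaussian_family =
  fixes n d :: nat and s :: real and P :: "nat \<Rightarrow> (nat \<Rightarrow> real) measure"
  assumes s: "0 < s" and P: "\<And>i. i < n \<Longrightarrow> subgaussian d s (P i) \<and> zero_mean d (P i)"
begin

abbreviation Y :: "(nat \<Rightarrow> nat \<Rightarrow> real) measure" where "Y \<equiv> PiM {..<n} P"

lemmas nlin_facts = subgaussian_prod[OF P]

text \<open>Here the two laws meet: the process runs on the subgaussian product, while the
  functional is the Gaussian width. Division by \<open>s\<close> makes the increment constant
  independent of \<open>s\<close>.\<close>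

sublocale chaining Y "\<lambda>a y. nlin n d a y / s" "l2d (Idx n d)" "gwidth (Idx n d)" mgf_const width_const
proof -
  interpret prob_space Y by (rule nlin_facts)
  show "chaining Y (\<lambda>a y. nlin n d a y / s) (l2d (Idx n d)) (gwidth (Idx n d)) mgf_const width_const"
  proof unfold_locales
    show "(\<lambda>y. nlin n d v y / s) \<in> borel_measurable Y" for v using nlin_facts(2) by measurable
    show "l2d (Idx n d) x y = l2d (Idx n d) y x" for x y by (rule l2d_commute)
    show "(\<integral>\<^sup>+y. ennreal (exp (h * (nlin n d a y / s - nlin n d b y / s))) \<partial>Y)
      \<le> ennreal (exp (mgf_const * h\<^sup>2 * (l2d (Idx n d) a b)\<^sup>2))" for a b h
    proof -
      have "h * (nlin n d a y / s - nlin n d b y / s) = (h / s) * nlin n d (\<lambda>k. a k - b k) y" for y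
        by (simp add: nlin_diff[symmetric] diff_divide_distrib[symmetric])
      then show ?thesis
        using nlin_facts(3)[where a="\<lambda>k. a k - b k" and h="h / s"] s
        by (simp add: l2d_square mgf_const_def)
    qed
    show "gwidth (Idx n d) A \<le> gwidth (Idx n d) B" if "finite B" "A \<subseteq> B" "A \<noteq> {}" for A B
      using that by (intro gwidth_mono) auto
    show "0 \<le> gwidth (Idx n d) A" if "finite A" "A \<noteq> {}" for A using that by (intro gwidth_nonneg) auto
    show "m + width_const * (\<rho> * sqrt k) \<le> gwidth (Idx n d) A"
      if "finite A" "0 < k" "0 \<le> \<rho>" "\<And>T. T \<subseteq> {..<k} \<Longrightarrow> H T \<subseteq> A" "\<And>T. T \<subseteq> {..<k} \<Longrightarrow> H T \<noteq> {}"
        "\<And>T U. T \<subseteq> {..<k} \<Longrightarrow> U \<subseteq> {..<k} \<Longrightarrow> T \<noteq> U \<Longrightarrow> \<rho> \<le> l2d (Idx n d) (t T) (t U)"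
        "\<And>T x. T \<subseteq> {..<k} \<Longrightarrow> x \<in> H T \<Longrightarrow> l2d (Idx n d) x (t T) \<le> \<rho> / 8"
        "\<And>T. T \<subseteq> {..<k} \<Longrightarrow> m \<le> gwidth (Idx n d) (H T)"
      for A and k :: nat and \<rho> m and t :: "nat set \<Rightarrow> nat \<times> nat \<Rightarrow> real" and H
      unfolding width_const_def by (rule gwidth_super_sudakov[OF _ that]) auto
  qed (auto simp: mgf_const_nonneg width_const_pos)
qed

text \<open>The chaining bound is at most a constant times \<open>1 + z\<close> with
  \<open>z = lnp (S y) / q\<close>, and \<open>(1 + z) ^ q \<le> exp (q * z) = max 1 (S y)\<close>.
  Since \<open>S\<close> has mean at most 1, the \<open>q\<close>-th moment costs only a further
  factor 2.\<close>

lemma nn_moment_Max: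
  fixes q :: nat
  assumes q: "1 \<le> q" and A: "finite A" "x0 \<in> A" and van: "\<And>x k. x \<in> A \<Longrightarrow> k \<notin> Idx n d \<Longrightarrow> x k = 0"
    and \<rho>: "\<And>x. x \<in> A \<Longrightarrow> l2d (Idx n d) x x0 \<le> \<rho>"
  shows "(\<integral>\<^sup>+y. ennreal (Max ((\<lambda>x. nlin n d x y) ` A) - nlin n d x0 y) ^ q \<partial>Y)
    \<le> ennreal (s * (80 * (mgf_const + 1) / width_const * gwidth (Idx n d) A + 4 * (3 * (mgf_const + 1) + 1) * \<rho> * sqrt q)) ^ q"
proof -
  let ?J = "Idx n d" and ?Mx = "\<lambda>y. Max ((\<lambda>x. nlin n d x y) ` A)"
  have Ane: "A \<noteq> {}" using A by auto
  have \<rho>0: "0 \<le> \<rho>" using \<rho>[OF A(2)] by simp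
  have pos: "0 < l2d ?J x y" if "x \<in> A" "y \<in> A" "x \<noteq> y" for x y
  proof -
    obtain k where k: "x k \<noteq> y k" using \<open>x \<noteq> y\<close> by (meson ext)
    then have "k \<in> ?J" using van[OF that(1), of k] van[OF that(2), of k] by fastforce
    then have "l2d ?J x y \<noteq> 0" using k unfolding l2d_def by (subst L2_set_eq_0_iff) auto
    then show ?thesis using l2d_nonneg[of ?J x y] by linarith
  qed
  show ?thesis
  \<comment> \<open>Chaining starts from a positive radius. Radius zero means that \<open>A\<close>
    is a single point, because \<open>van\<close> makes the distance separate the points of
    \<open>A\<close>.\<close>
  proof (cases "\<rho> = 0")
    case True
    have "A = {x0}"
    proof -
      have "x = x0" if "x \<in> A" for x using pos[OF that A(2)] \<rho>[OF that] True by fastforce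
      then show ?thesis using A by blast
    qed
    then show ?thesis using q by (simp add: power_0_left)
  next
    case False
    then have \<rho>1: "0 < \<rho>" using \<rho>0 by simp
    define K where "K = mgf_const"
    have K: "0 \<le> K" unfolding K_def by (rule mgf_const_nonneg)
    define al where "al = 40 * (K + 1) / width_const * gwidth ?J A"
    have al: "0 \<le> al" unfolding al_def using K width_const_pos gwidth_nonneg[of ?J A] A Ane by simp
    obtain S where S: "S \<in> borel_measurable Y" "\<And>y. 0 \<le> S y" "(\<integral>\<^sup>+y. ennreal (S y) \<partial>Y) \<le> 1"
      "\<And>x y. x \<in> A \<Longrightarrow> nlin n d x y / s - nlin n d x0 y / s
         \<le> al + 2 * (K + 1) * \<rho> * (sqrt (real q) + 2) + 2 * \<rho> / sqrt (real q) * lnp (S y)"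
      using chaining_bound[of "real q" A x0 \<rho>, OF _ A \<rho>1 \<rho> pos] q unfolding al_def K_def by auto
    define a where "a = al + 6 * (K + 1) * \<rho> * sqrt q"
    define u where "u = 2 * \<rho> * sqrt q"
    have a: "0 \<le> a" unfolding a_def using al K \<rho>0 by (intro add_nonneg_nonneg mult_nonneg_nonneg) auto
    have u: "0 \<le> u" unfolding u_def using \<rho>0 by simp
    have sq: "1 \<le> sqrt (real q)" using q by simp
    have pw: "ennreal (?Mx y - nlin n d x0 y) ^ q \<le> ennreal ((s * (a + u)) ^ q) * (1 + ennreal (S y))" for y
    proof -
      define z where "z = lnp (S y) / q"
      have z: "0 \<le> z" by (simp add: z_def)
      obtain x where x: "x \<in> A" "?Mx y = nlin n d x y" using Max_image_attained[OF A(1) Ane] by metis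
      have "?Mx y - nlin n d x0 y = s * (nlin n d x y / s - nlin n d x0 y / s)"
        using s by (simp add: x(2) right_diff_distrib)
      also have "\<dots> \<le> s * (al + 2 * (K + 1) * \<rho> * (sqrt (real q) + 2) + 2 * \<rho> / sqrt (real q) * lnp (S y))"
        using S(4)[OF x(1), of y] s by (intro mult_left_mono) auto
      also have "\<dots> \<le> s * ((a + u) * (1 + z))"
      proof (intro mult_left_mono)
        have "2 * (K + 1) * \<rho> * (sqrt (real q) + 2) \<le> 2 * (K + 1) * \<rho> * (3 * sqrt (real q))"
          using K \<rho>0 sq by (intro mult_left_mono mult_nonneg_nonneg) auto
        moreover have "2 * \<rho> / sqrt (real q) * lnp (S y) = u * z"
          using q unfolding u_def z_def by (simp add: field_simps)
        moreover have "a + u * z \<le> (a + u) * (1 + z)" using a u z by (simp add: algebra_simps)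
        ultimately show "al + 2 * (K + 1) * \<rho> * (sqrt (real q) + 2) + 2 * \<rho> / sqrt (real q) * lnp (S y) \<le> (a + u) * (1 + z)"
          unfolding a_def by (simp add: mult_ac)
      qed (use s in auto)
      finally have "ennreal (?Mx y - nlin n d x0 y) \<le> ennreal (s * (a + u) * (1 + z))"
        by (intro ennreal_leI) (simp add: mult.assoc)
      then have "ennreal (?Mx y - nlin n d x0 y) ^ q \<le> ennreal (s * (a + u) * (1 + z)) ^ q"
        by (rule power_mono_ennreal)
      also have "\<dots> = ennreal ((s * (a + u)) ^ q * (1 + z) ^ q)"
        using s a u z by (simp add: ennreal_power power_mult_distrib)
      also have "\<dots> \<le> ennreal ((s * (a + u)) ^ q * (1 + S y))"
      proof (intro ennreal_leI mult_left_mono)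
        have "(1 + z) ^ q \<le> exp (real q * z)" using z by (rule le_exp_power)
        also have "\<dots> = max 1 (S y)" using q unfolding z_def lnp_def by simp
        also have "\<dots> \<le> 1 + S y" using S(2)[of y] by simp
        finally show "(1 + z) ^ q \<le> 1 + S y" .
      qed (use s a u in auto)
      also have "\<dots> = ennreal ((s * (a + u)) ^ q) * (1 + ennreal (S y))"
        using s a u S(2)[of y] by (simp add: ennreal_mult ennreal_plus)
      finally show ?thesis .
    qed
    have "(\<integral>\<^sup>+y. ennreal (?Mx y - nlin n d x0 y) ^ q \<partial>Y) \<le> (\<integral>\<^sup>+y. ennreal ((s * (a + u)) ^ q) * (1 + ennreal (S y)) \<partial>Y)"
      by (intro nn_integral_mono pw)
    also have "\<dots> = ennreal ((s * (a + u)) ^ q) * (1 + (\<integral>\<^sup>+y. ennreal (S y) \<partial>Y))"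
      using S(1) by (simp add: nn_integral_cmult nn_integral_add emeasure_space_1)
    also have "\<dots> \<le> ennreal ((s * (a + u)) ^ q) * (1 + 1)" using S(3) by (intro mult_left_mono add_left_mono) auto
    also have "\<dots> = ennreal ((s * (a + u)) ^ q) * 2" by simp
    also have "\<dots> \<le> ennreal ((s * (a + u)) ^ q) * 2 ^ q"
      using power_increasing[of 1 q "2::ennreal"] q by (intro mult_left_mono) auto
    also have "\<dots> = ennreal (2 * (s * (a + u))) ^ q"
      using s a u by (intro ennreal_power_double) simp
    also have "2 * (s * (a + u)) = s * (80 * (K + 1) / width_const * gwidth ?J A + 4 * (3 * (K + 1) + 1) * \<rho> * sqrt q)"
      unfolding a_def u_def al_def by (simp add: algebra_simps add_divide_distrib)
    finally show ?thesis unfolding K_def .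
  qed
qed

text \<open>With \<open>b = s * sqrt q * \<sigma>\<close>, the \<open>q\<close>-th power of
  \<open>\<bar>nlin n d a y\<bar> / b\<close> is at most the exponential of \<open>q\<close> times
  it. The resulting exponent \<open>h\<close> makes both one-sided exponential moments at most
  \<open>exp (mgf_const * q)\<close>, again a \<open>q\<close>-th power.\<close>

lemma nn_moment_nlin:
  fixes q :: nat
  assumes q: "1 \<le> q" and \<sigma>: "L2_set a (Idx n d) \<le> \<sigma>"
  shows "(\<integral>\<^sup>+y. ennreal \<bar>nlin n d a y\<bar> ^ q \<partial>Y) \<le> ennreal (2 * exp mgf_const * (s * sqrt q * \<sigma>)) ^ q"
proof (cases "\<sigma> = 0")
  case True
  then have "L2_set a (Idx n d) = 0" using \<sigma> L2_set_nonneg[of a "Idx n d"] by linarith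
  then have "\<forall>k\<in>Idx n d. a k = 0" by (subst (asm) L2_set_eq_0_iff) auto
  then have "nlin n d a y = 0" for y unfolding nlin_def by (intro sum.neutral ballI) auto
  then show ?thesis using q by (simp add: power_0_left)
next
  case False
  then have \<sigma>0: "0 < \<sigma>" using \<sigma> L2_set_nonneg[of a "Idx n d"] by linarith
  define h where "h = sqrt q / (s * \<sigma>)"
  define b where "b = s * sqrt q * \<sigma>"
  have b: "0 < b" using s q \<sigma>0 by (simp add: b_def)
  have hb: "real q / b = h" using q s \<sigma>0 real_sqrt_pow2[of "real q"] by (simp add: h_def b_def field_simps power2_eq_square)
  have m: "(\<integral>\<^sup>+y. ennreal (exp (t * nlin n d a y)) \<partial>Y) \<le> ennreal (exp (mgf_const * q))" if "t\<^sup>2 = h\<^sup>2" for t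
  proof -
    have "(\<Sum>k\<in>Idx n d. (a k)\<^sup>2) = (L2_set a (Idx n d))\<^sup>2" by (simp add: L2_set_def sum_nonneg)
    also have "\<dots> \<le> \<sigma>\<^sup>2" using \<sigma> by (intro power_mono) auto
    finally have "(t * s)\<^sup>2 * (\<Sum>k\<in>Idx n d. (a k)\<^sup>2) \<le> (t * s)\<^sup>2 * \<sigma>\<^sup>2" by (intro mult_left_mono) auto
    also have "\<dots> = q" using s \<sigma>0 by (simp add: power_mult_distrib that h_def power_divide)
    finally have "mgf_const * ((t * s)\<^sup>2 * (\<Sum>k\<in>Idx n d. (a k)\<^sup>2)) \<le> mgf_const * q"
      by (rule mult_left_mono[OF _ mgf_const_nonneg])
    then have le: "8 * C0\<^sup>2 * (t * s)\<^sup>2 * (\<Sum>k\<in>Idx n d. (a k)\<^sup>2) \<le> mgf_const * q"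
      by (simp only: mgf_const_def mult.assoc)
    have "(\<integral>\<^sup>+y. ennreal (exp (t * nlin n d a y)) \<partial>Y)
       \<le> ennreal (exp (8 * C0\<^sup>2 * (t * s)\<^sup>2 * (\<Sum>k\<in>Idx n d. (a k)\<^sup>2)))" by (rule nlin_facts)
    also have "\<dots> \<le> ennreal (exp (mgf_const * q))"
      using le by (rule ennreal_leI[OF iffD2[OF exp_le_cancel_iff]])
    finally show ?thesis .
  qed
  have [measurable]: "nlin n d a \<in> borel_measurable Y" by (rule nlin_facts)
  have pw: "ennreal \<bar>nlin n d a y\<bar> ^ q \<le> ennreal (b ^ q) * (ennreal (exp (h * nlin n d a y)) + ennreal (exp (- h * nlin n d a y)))" for y
  proof -
    let ?z = "\<bar>nlin n d a y\<bar> / b"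
    have "\<bar>nlin n d a y\<bar> ^ q = b ^ q * ?z ^ q" using b by (simp add: power_divide)
    also have "?z ^ q \<le> (1 + ?z) ^ q" using b by (intro power_mono) auto
    then have "b ^ q * ?z ^ q \<le> b ^ q * (1 + ?z) ^ q" using b by (intro mult_left_mono) auto
    also have "(1 + ?z) ^ q \<le> exp (real q * ?z)" using b by (intro le_exp_power) auto
    then have "b ^ q * (1 + ?z) ^ q \<le> b ^ q * exp (real q * ?z)" using b by (intro mult_left_mono) auto
    also have "real q * ?z = h * \<bar>nlin n d a y\<bar>" unfolding hb[symmetric] by simp
    also have "exp (h * \<bar>nlin n d a y\<bar>) \<le> exp (h * nlin n d a y) + exp (- h * nlin n d a y)"
      by (auto simp: abs_real_def add_increasing add_increasing2)
    then have "b ^ q * exp (h * \<bar>nlin n d a y\<bar>) \<le> b ^ q * (exp (h * nlin n d a y) + exp (- h * nlin n d a y))"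
      using b by (intro mult_left_mono) auto
    finally show ?thesis using b by (simp add: ennreal_power ennreal_mult[symmetric] ennreal_plus[symmetric] ennreal_leI del: ennreal_plus)
  qed
  have "(\<integral>\<^sup>+y. ennreal \<bar>nlin n d a y\<bar> ^ q \<partial>Y)
     \<le> (\<integral>\<^sup>+y. ennreal (b ^ q) * (ennreal (exp (h * nlin n d a y)) + ennreal (exp (- h * nlin n d a y))) \<partial>Y)"
    by (intro nn_integral_mono pw)
  also have "\<dots> = ennreal (b ^ q) * ((\<integral>\<^sup>+y. ennreal (exp (h * nlin n d a y)) \<partial>Y) + (\<integral>\<^sup>+y. ennreal (exp (- h * nlin n d a y)) \<partial>Y))"
    by (simp add: nn_integral_cmult nn_integral_add)
  also have "\<dots> \<le> ennreal (b ^ q) * (ennreal (exp (mgf_const * q)) + ennreal (exp (mgf_const * q)))"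
    by (intro mult_left_mono add_mono m) auto
  also have "\<dots> = ennreal (b ^ q * exp mgf_const ^ q) * 2"
    using b by (simp add: ennreal_mult exp_of_nat2_mult mult_2 distrib_left mult.commute)
  also have "\<dots> \<le> ennreal (b ^ q * exp mgf_const ^ q) * 2 ^ q"
    using power_increasing[of 1 q "2::ennreal"] q by (intro mult_left_mono) auto
  also have "\<dots> = ennreal (2 * exp mgf_const * b) ^ q"
    using ennreal_power_double[of "b * exp mgf_const" q] b by (simp add: power_mult_distrib mult_ac)
  finally show ?thesis by (simp add: b_def)
qed

end

section \<open>The comparison theorem\<close>

text \<open>Sum of the constants of both conclusions. With \<alpha> and \<beta> from the bound for
  finite maxima, the mean needs \<open>\<alpha> + \<beta> / width_const\<close>, the moments
  \<open>2 * \<alpha>\<close> and \<open>4 * \<beta> + 4 * exp mgf_const\<close>.\<close>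

definition comparison_const :: real where
  "comparison_const = 160 * (mgf_const + 1) / width_const + 4 * (3 * (mgf_const + 1) + 1) / width_const
     + 16 * (3 * (mgf_const + 1) + 1) + 4 * exp mgf_const"

lemma SUP_nlin_decomp:
  fixes n d :: nat and b :: "nat \<Rightarrow> nat \<times> nat \<Rightarrow> real"
  defines "v \<equiv> \<lambda>m y. Max ((\<lambda>x. nlin n d x y) ` b ` {..m}) - nlin n d (b 0) y"
  shows "0 \<le> v m y" "incseq (\<lambda>m. v m y)"
    "(SUP m. ereal (Max ((\<lambda>x. nlin n d x y) ` b ` {..m}))) = ereal (nlin n d (b 0) y) + enn2ereal (SUP m. ennreal (v m y))"
proof -
  show v0: "0 \<le> v m y" for m unfolding v_def by simp
  show "incseq (\<lambda>m. v m y)" unfolding v_def incseq_def by (auto intro!: Max_mono)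
  \<comment> \<open>A supremum in \<open>ennreal\<close> is represented with a truncation at 0,
    which is void here because every prefix contains \<open>b 0\<close>.\<close>
  have "enn2ereal (SUP m. ennreal (v m y)) = sup 0 (SUP m. ereal (v m y))"
    by (simp add: Sup_ennreal.rep_eq image_image enn2ereal_ennreal v0)
  also have "\<dots> = (SUP m. ereal (v m y))"
    using v0[of 0] by (intro sup_absorb2 SUP_upper2[of 0]) auto
  finally have "ereal (nlin n d (b 0) y) + enn2ereal (SUP m. ennreal (v m y)) = (SUP m. ereal (nlin n d (b 0) y) + ereal (v m y))"
    by (simp only:) (rule SUP_ereal_add_right[symmetric], auto)
  then show "(SUP m. ereal (Max ((\<lambda>x. nlin n d x y) ` b ` {..m}))) = ereal (nlin n d (b 0) y) + enn2ereal (SUP m. ennreal (v m y))"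
    by (simp add: v_def)
qed

context subgaussian_family
begin

text \<open>One moment bound for the centred supremum serves both claims with different radii: a
  multiple of the width by \<open>diam_le\<close> for the mean, twice \<sigma> for the moments. The
  moment claim must also restore the value at \<open>b 0\<close>, which
  \<open>nn_moment_nlin\<close> controls.\<close>

theorem sup_comparison:
  fixes \<A> :: "(nat \<times> nat \<Rightarrow> real) set"
  defines "F \<equiv> \<lambda>y. SUP a\<in>\<A>. ereal (nlin n d a y)"
    and "\<sigma> \<equiv> SUP a\<in>\<A>. ennreal (L2_set a (Idx n d))"
    and "G \<equiv> PiM {..<n} (\<lambda>_. gauss_d d)"
  assumes ne: "\<A> \<noteq> {}" and van: "\<And>a k. a \<in> \<A> \<Longrightarrow> k \<notin> Idx n d \<Longrightarrow> a k = 0"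
  shows "eexpect Y F \<le> ereal comparison_const * (ereal s * eexpect G F)"
    "1 \<le> q \<Longrightarrow> emoment Y F q \<le> (ennreal comparison_const * (e2ennreal (ereal s * eexpect G F) + ennreal (s * sqrt (real q)) * \<sigma>)) ^ q"
proof -
  let ?J = "Idx n d"
  define \<alpha> where "\<alpha> = 80 * (mgf_const + 1) / width_const"
  define \<beta> where "\<beta> = 4 * (3 * (mgf_const + 1) + 1)"
  have \<alpha>: "0 \<le> \<alpha>" and \<beta>: "0 \<le> \<beta>" using mgf_const_nonneg width_const_pos by (auto simp: \<alpha>_def \<beta>_def)
  have C: "comparison_const = 2 * \<alpha> + \<beta> / width_const + 4 * \<beta> + 4 * exp mgf_const"
    by (simp add: comparison_const_def \<alpha>_def \<beta>_def)
  have Cpos: "0 < comparison_const" unfolding C using \<alpha> \<beta> width_const_pos by (intro add_nonneg_pos add_nonneg_nonneg) auto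
  obtain a0 where a0: "a0 \<in> \<A>" using ne by auto
  obtain b :: "nat \<Rightarrow> nat \<times> nat \<Rightarrow> real" where b: "b 0 = a0" "range b \<subseteq> \<A>"
    "\<And>y. (SUP a\<in>\<A>. ereal (nlin n d a y)) = (SUP m. ereal (Max ((\<lambda>x. nlin n d x y) ` b ` {..m})))"
    by (rule nlin_countable_reduction[OF a0, where n=n and d=d]) (rule that)
  define A where "A = (\<lambda>m. b ` {..m})"
  have A: "finite (A m)" "b 0 \<in> A m" "A m \<subseteq> \<A>" "A m \<noteq> {}" for m using b(2) by (auto simp: A_def)
  define v where "v = (\<lambda>m y. Max ((\<lambda>x. nlin n d x y) ` A m) - nlin n d (b 0) y)"
  define V where "V = (\<lambda>y. SUP m. ennreal (v m y))"
  have v0: "0 \<le> v m y" and vinc: "incseq (\<lambda>m. v m y)" for m y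
    unfolding v_def A_def by (rule SUP_nlin_decomp)+
  have vinc': "incseq (\<lambda>m. ennreal (v m y))" for y
    using vinc[of y] by (auto simp: incseq_def intro!: ennreal_leI)
  have F: "F y = ereal (nlin n d (b 0) y) + enn2ereal (V y)" for y
    unfolding F_def b(3) V_def v_def A_def by (rule SUP_nlin_decomp)
  note Gf = nested_gauss_facts[where n=n and d=d, folded G_def]
  have mvY [measurable]: "v m \<in> borel_measurable Y" and mvG [measurable]: "v m \<in> borel_measurable G" for m
    unfolding v_def using A(1)[of m] nlin_facts(2) Gf(2) by (auto intro!: borel_measurable_diff borel_measurable_Max)
  have mV [measurable]: "V \<in> borel_measurable Y" "V \<in> borel_measurable G"
    unfolding V_def by measurable
  have eY: "eexpect Y F = enn2ereal (\<integral>\<^sup>+y. V y \<partial>Y)"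
    by (rule eexpect_centered[OF mV(1) nlin_facts(4,5) F])
  have eG: "eexpect G F = enn2ereal (\<integral>\<^sup>+y. V y \<partial>G)"
    by (rule eexpect_centered[OF mV(2) Gf(3,4) F])
  have gw: "ennreal (gwidth ?J (A m)) \<le> (\<integral>\<^sup>+y. V y \<partial>G)" for m
  proof -
    have i: "integrable G (v m)" unfolding v_def by (intro Bochner_Integration.integrable_diff Gf A)
    have "gwidth ?J (A m) = (\<integral>y. v m y \<partial>G)"
      unfolding v_def using Gf(3-6) A[of m] by simp
    then have "ennreal (gwidth ?J (A m)) = (\<integral>\<^sup>+y. ennreal (v m y) \<partial>G)"
      using i v0 by (subst nn_integral_eq_integral) auto
    also have "\<dots> \<le> (\<integral>\<^sup>+y. V y \<partial>G)" unfolding V_def by (intro nn_integral_mono SUP_upper) auto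
    finally show ?thesis .
  qed
  have vanA: "x k = 0" if "x \<in> A m" "k \<notin> ?J" for x k m using van that A(3) by blast
  have mom: "(\<integral>\<^sup>+y. V y ^ q \<partial>Y) \<le> ennreal (s * (\<alpha> * \<gamma> + \<beta> * \<rho> * sqrt q)) ^ q"
    if q: "1 \<le> q" and \<gamma>: "\<And>m. gwidth ?J (A m) \<le> \<gamma>" and \<rho>: "\<And>m x. x \<in> A m \<Longrightarrow> l2d ?J x (b 0) \<le> \<rho>" for q :: nat and \<gamma> \<rho>
  proof -
    have "(\<integral>\<^sup>+y. V y ^ q \<partial>Y) \<le> (\<integral>\<^sup>+y. (SUP m. ennreal (v m y) ^ q) \<partial>Y)"
      unfolding V_def by (intro nn_integral_mono SUP_power_ennreal_le vinc')
    also have "\<dots> = (SUP m. \<integral>\<^sup>+y. ennreal (v m y) ^ q \<partial>Y)"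
    proof (rule nn_integral_monotone_convergence_SUP)
      show "incseq (\<lambda>m y. ennreal (v m y) ^ q)"
        using vinc' by (auto simp: incseq_def le_fun_def intro!: power_mono_ennreal)
    qed measurable
    also have "\<dots> \<le> ennreal (s * (\<alpha> * \<gamma> + \<beta> * \<rho> * sqrt q)) ^ q"
    proof (rule SUP_least)
      fix m
      have "(\<integral>\<^sup>+y. ennreal (v m y) ^ q \<partial>Y) \<le> ennreal (s * (\<alpha> * gwidth ?J (A m) + \<beta> * \<rho> * sqrt q)) ^ q"
        unfolding v_def \<alpha>_def \<beta>_def by (intro nn_moment_Max[OF q A(1,2)]) (auto intro: vanA \<rho>)
      also have "\<dots> \<le> ennreal (s * (\<alpha> * \<gamma> + \<beta> * \<rho> * sqrt q)) ^ q"
        using \<gamma>[of m] \<alpha> s by (intro power_mono_ennreal ennreal_leI mult_left_mono add_right_mono) auto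
      finally show "(\<integral>\<^sup>+y. ennreal (v m y) ^ q \<partial>Y) \<le> ennreal (s * (\<alpha> * \<gamma> + \<beta> * \<rho> * sqrt q)) ^ q" .
    qed
    finally show ?thesis .
  qed
  show "eexpect Y F \<le> ereal comparison_const * (ereal s * eexpect G F)"
  proof (cases "\<integral>\<^sup>+y. V y \<partial>G" rule: ennreal_cases)
    case (real \<gamma>)
    then have \<gamma>: "gwidth ?J (A m) \<le> \<gamma>" for m using gw[of m] by simp
    have "l2d ?J x (b 0) \<le> \<gamma> / width_const" if "x \<in> A m" for m x
      using diam_le[OF A(1) that A(2)] \<gamma>[of m] width_const_pos by (simp add: field_simps)
    from mom[of 1, OF _ \<gamma> this] have "(\<integral>\<^sup>+y. V y \<partial>Y) \<le> ennreal (s * (\<alpha> * \<gamma> + \<beta> * (\<gamma> / width_const)))" by simp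
    also have "\<dots> \<le> ennreal (comparison_const * (s * \<gamma>))"
    proof (rule ennreal_leI)
      have "(\<alpha> + \<beta> / width_const) * (s * \<gamma>) \<le> comparison_const * (s * \<gamma>)"
        unfolding C using \<alpha> \<beta> s real by (intro mult_right_mono) auto
      then show "s * (\<alpha> * \<gamma> + \<beta> * (\<gamma> / width_const)) \<le> comparison_const * (s * \<gamma>)" by (simp add: algebra_simps)
    qed
    finally have "enn2ereal (\<integral>\<^sup>+y. V y \<partial>Y) \<le> enn2ereal (ennreal (comparison_const * (s * \<gamma>)))"
      by (simp only: less_eq_ennreal.rep_eq)
    then show ?thesis unfolding eY eG using real s Cpos by (simp add: enn2ereal_ennreal)
  next
    case top
    then show ?thesis unfolding eG using s Cpos by simp
  qed
  show "emoment Y F q \<le> (ennreal comparison_const * (e2ennreal (ereal s * eexpect G F) + ennreal (s * sqrt (real q)) * \<sigma>)) ^ q" if q: "1 \<le> q"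
  proof -
    have R: "e2ennreal (ereal s * eexpect G F) = ennreal s * (\<integral>\<^sup>+y. V y \<partial>G)"
      unfolding eG using s
      by (cases "\<integral>\<^sup>+y. V y \<partial>G" rule: ennreal_cases) (auto simp: enn2ereal_ennreal ennreal_mult ennreal_mult_top)
    have sq: "0 < s * sqrt (real q)" using s q by simp
    have t: "ennreal c * \<top> = \<top>" if "0 < c" for c
      unfolding ennreal_mult_eq_top_iff using that by (simp add: ennreal_eq_0_iff)
    show ?thesis
    \<comment> \<open>If the width or \<sigma> is infinite, so is the right-hand side, because the
      constant, \<open>s\<close> and \<open>sqrt q\<close> are positive and
      \<open>q \<ge> 1\<close>.\<close>
    proof (cases "(\<integral>\<^sup>+y. V y \<partial>G) = \<top> \<or> \<sigma> = \<top>")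
      case True
      then have "e2ennreal (ereal s * eexpect G F) + ennreal (s * sqrt (real q)) * \<sigma> = \<top>"
      proof -
        from True show ?thesis unfolding R
        proof
          assume "(\<integral>\<^sup>+y. V y \<partial>G) = \<top>"
          then show "ennreal s * (\<integral>\<^sup>+y. V y \<partial>G) + ennreal (s * sqrt (real q)) * \<sigma> = \<top>"
            using t[OF s] by (simp only: add_top_left_ennreal)
        next
          assume "\<sigma> = \<top>"
          then show "ennreal s * (\<integral>\<^sup>+y. V y \<partial>G) + ennreal (s * sqrt (real q)) * \<sigma> = \<top>"
            using t[OF sq] by (simp only: add_top_right_ennreal)
        qed
      qed
      then have "(ennreal comparison_const * (e2ennreal (ereal s * eexpect G F) + ennreal (s * sqrt (real q)) * \<sigma>)) ^ q = \<top>"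
        by (simp only: t[OF Cpos]) (use q in simp)
      then show ?thesis by simp
    next
      case False
      then obtain \<gamma> \<tau> where \<gamma>\<tau>: "0 \<le> \<gamma>" "(\<integral>\<^sup>+y. V y \<partial>G) = ennreal \<gamma>" "0 \<le> \<tau>" "\<sigma> = ennreal \<tau>"
        by (metis ennreal_cases)
      have \<gamma>: "gwidth ?J (A m) \<le> \<gamma>" for m using gw[of m] \<gamma>\<tau> by simp
      have nrm: "L2_set a ?J \<le> \<tau>" if "a \<in> \<A>" for a
      proof -
        have "ennreal (L2_set a ?J) \<le> \<sigma>" unfolding \<sigma>_def by (rule SUP_upper[OF that])
        then show ?thesis using \<gamma>\<tau> by simp
      qed
      have \<rho>: "l2d ?J x (b 0) \<le> 2 * \<tau>" if "x \<in> A m" for m x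
      proof -
        have "l2d ?J x (b 0) \<le> l2d ?J x (\<lambda>_. 0) + l2d ?J (\<lambda>_. 0) (b 0)" by (rule l2d_triangle)
        also have "\<dots> = L2_set x ?J + L2_set (b 0) ?J" by (simp add: l2d_def L2_set_def)
        finally show ?thesis using nrm[of x] nrm[of "b 0"] that A(2,3) by force
      qed
      have pw: "e2ennreal \<bar>F y\<bar> \<le> V y + ennreal \<bar>nlin n d (b 0) y\<bar>" for y
      proof (cases "V y" rule: ennreal_cases)
        case (real r)
        then have "F y = ereal (nlin n d (b 0) y + r)" by (simp add: F enn2ereal_ennreal)
        then have "e2ennreal \<bar>F y\<bar> = ennreal \<bar>nlin n d (b 0) y + r\<bar>" by simp
        also have "\<dots> \<le> ennreal (r + \<bar>nlin n d (b 0) y\<bar>)" using real by (intro ennreal_leI) auto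
        finally show ?thesis using real by simp
      qed simp
      have "emoment Y F q \<le> (\<integral>\<^sup>+y. 2 ^ q * (V y ^ q + ennreal \<bar>nlin n d (b 0) y\<bar> ^ q) \<partial>Y)"
        unfolding emoment_def
        by (intro nn_integral_mono order_trans[OF power_mono_ennreal[OF pw] ennreal_power_add_le])
      also have "\<dots> = 2 ^ q * ((\<integral>\<^sup>+y. V y ^ q \<partial>Y) + (\<integral>\<^sup>+y. ennreal \<bar>nlin n d (b 0) y\<bar> ^ q \<partial>Y))"
        using nlin_facts(2) by (simp add: nn_integral_cmult nn_integral_add)
      also have "\<dots> \<le> 2 ^ q * (ennreal (s * (\<alpha> * \<gamma> + \<beta> * (2 * \<tau>) * sqrt q)) ^ q + ennreal (2 * exp mgf_const * (s * sqrt q * \<tau>)) ^ q)"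
        using nrm[of "b 0"] A(2,3) by (intro mult_left_mono add_mono mom[OF q \<gamma> \<rho>] nn_moment_nlin[OF q]) auto
      also have "\<dots> \<le> 2 ^ q * (ennreal (s * (\<alpha> * \<gamma> + \<beta> * (2 * \<tau>) * sqrt q)) + ennreal (2 * exp mgf_const * (s * sqrt q * \<tau>))) ^ q"
        by (intro mult_left_mono ennreal_add_power_le q) auto
      also have "\<dots> = (2 * (ennreal (s * (\<alpha> * \<gamma> + \<beta> * (2 * \<tau>) * sqrt q)) + ennreal (2 * exp mgf_const * (s * sqrt q * \<tau>)))) ^ q"
        by (simp only: power_mult_distrib)
      also have "\<dots> = ennreal (2 * \<alpha> * (s * \<gamma>) + (4 * \<beta> + 4 * exp mgf_const) * (s * sqrt q * \<tau>)) ^ q"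
      proof -
        have "2 * (ennreal x + ennreal y) = ennreal (2 * (x + y))" if "0 \<le> x" "0 \<le> y" for x y :: real
          using that by (simp add: ennreal_mult)
        then have "2 * (ennreal (s * (\<alpha> * \<gamma> + \<beta> * (2 * \<tau>) * sqrt q)) + ennreal (2 * exp mgf_const * (s * sqrt q * \<tau>)))
          = ennreal (2 * (s * (\<alpha> * \<gamma> + \<beta> * (2 * \<tau>) * sqrt q) + 2 * exp mgf_const * (s * sqrt q * \<tau>)))"
          using s \<alpha> \<beta> \<gamma>\<tau> by simp
        also have "2 * (s * (\<alpha> * \<gamma> + \<beta> * (2 * \<tau>) * sqrt q) + 2 * exp mgf_const * (s * sqrt q * \<tau>))
          = 2 * \<alpha> * (s * \<gamma>) + (4 * \<beta> + 4 * exp mgf_const) * (s * sqrt q * \<tau>)" by (simp add: algebra_simps)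
        finally show ?thesis by (simp only:)
      qed
      also have "\<dots> \<le> ennreal (comparison_const * (s * \<gamma> + s * sqrt q * \<tau>)) ^ q"
      proof (intro power_mono_ennreal ennreal_leI)
        have "2 * \<alpha> * (s * \<gamma>) \<le> comparison_const * (s * \<gamma>)"
          unfolding C using \<alpha> \<beta> s \<gamma>\<tau> width_const_pos by (intro mult_right_mono) auto
        moreover have "(4 * \<beta> + 4 * exp mgf_const) * (s * sqrt q * \<tau>) \<le> comparison_const * (s * sqrt q * \<tau>)"
          unfolding C using \<alpha> \<beta> s \<gamma>\<tau> width_const_pos by (intro mult_right_mono) auto
        ultimately show "2 * \<alpha> * (s * \<gamma>) + (4 * \<beta> + 4 * exp mgf_const) * (s * sqrt q * \<tau>) \<le> comparison_const * (s * \<gamma> + s * sqrt q * \<tau>)"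
          by (simp add: distrib_left)
      qed
      also have "ennreal (comparison_const * (s * \<gamma> + s * sqrt q * \<tau>))
        = ennreal comparison_const * (e2ennreal (ereal s * eexpect G F) + ennreal (s * sqrt (real q)) * \<sigma>)"
        unfolding R \<gamma>\<tau>(2,4) using s \<gamma>\<tau> Cpos by (simp add: ennreal_mult ennreal_plus)
      finally show ?thesis .
    qed
  qed
qed

end

theorem theorem3p1:
  "\<exists>C>0. \<forall>(s::real) (n::nat) (d::nat) (N::nat) (t::nat) (n'::nat)
      (P :: nat \<Rightarrow> (nat \<Rightarrow> real) measure) (a :: nat \<Rightarrow> real)
      (h :: nat \<Rightarrow> mpoly) (p :: nat \<Rightarrow> mpoly) (T :: (mpoly \<Rightarrow> real) set).
     s > 0 \<longrightarrow>
     (\<forall>i<n. subgaussian d s (P i) \<and> zero_mean d (P i)) \<longrightarrow>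
     even t \<longrightarrow>
     (\<forall>j<n'. pvars (h j) \<subseteq> uv_vars N d \<and> pdeg (h j) \<le> t) \<longrightarrow>
     (\<forall>i<n. pvars (p i) \<subseteq> uv_vars N d \<and> pdeg (p i) < t - 1) \<longrightarrow>
     (\<forall>E\<in>T. pseudoexp (uv_vars N d) t E) \<longrightarrow>
     (let F = Ffun d n T n' h a p;
          Y = PiM {..<n} P;
          G = PiM {..<n} (\<lambda>_. gauss_d d);
          R = ereal s * eexpect G F
      in eexpect Y F \<le> ereal C * R \<and>
         (\<forall>q::nat. q \<ge> 1 \<longrightarrow>
            emoment Y F q
              \<le> (ennreal C * (e2ennreal R + ennreal (s * sqrt (real q)) * Sfun d n T n' h a p)) ^ q))"
proof (intro exI[of _ comparison_const] conjI allI impI)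
  show "0 < comparison_const"
    unfolding comparison_const_def using mgf_const_nonneg width_const_pos
    by (intro add_nonneg_pos add_nonneg_nonneg) auto
  fix s :: real and n d N t n' :: nat and P :: "nat \<Rightarrow> (nat \<Rightarrow> real) measure" and a :: "nat \<Rightarrow> real"
    and h p :: "nat \<Rightarrow> mpoly" and T :: "(mpoly \<Rightarrow> real) set"
  assume s: "s > 0" and P: "\<forall>i<n. subgaussian d s (P i) \<and> zero_mean d (P i)"
    and p: "\<forall>i<n. pvars (p i) \<subseteq> uv_vars N d \<and> pdeg (p i) < t - 1"
    and T: "\<forall>E\<in>T. pseudoexp (uv_vars N d) t E"
  interpret subgaussian_family n d s P using s P by unfold_locales auto
  define F where "F = Ffun d n T n' h a p"
  define \<Delta> where "\<Delta> = (\<lambda>E::mpoly \<Rightarrow> real. \<Prod>j<n'. gpow (E (h j)) (a j))"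
  \<comment> \<open>The denominator is folded into the vector, which turns \<open>Tstar\<close> into
    a plain index set. The value 0 outside the index pairs secures that distinct vectors have
    positive distance.\<close>
  define vec where "vec = (\<lambda>E k. if k \<in> Idx n d
     then E (pconst (1 / real n) * p (fst k) * pvar (Inr (snd k))) / \<Delta> E else 0)"
  define \<A> where "\<A> = vec ` Tstar T n' h"
  have "eexpect Y F \<le> ereal comparison_const * (ereal s * eexpect (PiM {..<n} (\<lambda>_. gauss_d d)) F) \<and>
     (\<forall>q\<ge>1. emoment Y F q \<le> (ennreal comparison_const * (e2ennreal (ereal s * eexpect (PiM {..<n} (\<lambda>_. gauss_d d)) F)
        + ennreal (s * sqrt (real q)) * Sfun d n T n' h a p)) ^ q)"
  proof (cases "Tstar T n' h = {}")
    \<comment> \<open>With empty \<open>Tstar\<close> the function is identically 0, and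
      \<open>q \<ge> 1\<close> makes its moments vanish.\<close>
    case True
    then have "F = (\<lambda>_. 0)" by (auto simp: F_def Ffun_def)
    then show ?thesis by (simp add: eexpect_def emoment_def power_0_left)
  next
    case False
    have Feq: "F = (\<lambda>y. SUP v\<in>\<A>. ereal (nlin n d v y))"
    proof
      fix y
      have "E (pconst (1 / real n) * (\<Sum>i<n. p i * lin_v d (y i))) / \<Delta> E = nlin n d (vec E) y"
        if "E \<in> Tstar T n' h" for E
      proof -
        have E: "pseudoexp (uv_vars N d) t E" using that T by (auto simp: Tstar_def)
        have "E (pconst (1 / real n) * (\<Sum>i<n. p i * lin_v d (y i)))
          = (\<Sum>i<n. \<Sum>j<d. y i j * E (pconst (1 / real n) * p i * pvar (Inr j)))"
          using p by (intro pseudoexp_lin_v[OF E]) (auto simp: uv_vars_def)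
        then show ?thesis
          by (simp add: nlin_def vec_def sum_divide_distrib mult.commute)
      qed
      then show "F y = (SUP v\<in>\<A>. ereal (nlin n d v y))"
        using False by (simp add: F_def Ffun_def \<A>_def image_image \<Delta>_def)
    qed
    have Seq: "Sfun d n T n' h a p = (SUP v\<in>\<A>. ennreal (L2_set v (Idx n d)))"
    proof -
      have "sqrt (\<Sum>i<n. \<Sum>j<d. (E (pconst (1 / real n) * p i * pvar (Inr j)))\<^sup>2) / (\<Prod>j<n'. \<bar>E (h j)\<bar> powr (a j))
         = L2_set (vec E) (Idx n d)" for E
      proof -
        have "(\<Prod>j<n'. \<bar>E (h j)\<bar> powr (a j)) = \<bar>\<Delta> E\<bar>" by (simp add: \<Delta>_def abs_prod abs_gpow)
        moreover have "(\<Sum>k\<in>Idx n d. (vec E k)\<^sup>2) = (\<Sum>i<n. \<Sum>j<d. (E (pconst (1 / real n) * p i * pvar (Inr j)))\<^sup>2) / (\<Delta> E)\<^sup>2"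
          by (simp add: sum.cartesian_product split_beta vec_def sum_divide_distrib power_divide)
        ultimately show ?thesis by (simp add: L2_set_def real_sqrt_divide)
      qed
      then show ?thesis by (simp add: Sfun_def \<A>_def image_image)
    qed
    have "\<A> \<noteq> {}" using False by (simp add: \<A>_def)
    moreover have "v k = 0" if "v \<in> \<A>" "k \<notin> Idx n d" for v k using that by (auto simp: \<A>_def vec_def)
    ultimately show ?thesis unfolding Feq Seq using sup_comparison[of \<A>] by blast
  qed
  then show "let F = Ffun d n T n' h a p; Y = PiM {..<n} P; G = PiM {..<n} (\<lambda>_. gauss_d d); R = ereal s * eexpect G F
    in eexpect Y F \<le> ereal comparison_const * R \<and>
      (\<forall>q::nat. q \<ge> 1 \<longrightarrow> emoment Y F q
        \<le> (ennreal comparison_const * (e2ennreal R + ennreal (s * sqrt (real q)) * Sfun d n T n' h a p)) ^ q)"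
    unfolding F_def Let_def .
qed

end
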